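(* Let $f:S^1\to S^2$ be a CaTherine wheel with associated zipper $Z^\pm\subset S^2$. Then each of $Z^+$ and $Z^-$ has short hair.
   Context: $S^1$ and $S^2$ are the oriented circle and 2-sphere. Conventions: "components" always means path components; a cut point of a path-connected set $X$ is a point $p\in X$ such that $X-p$ has at least two path components; paths are embedded (simple) and considered modulo parametrization. CaTherine wheel: a continuous surjective map $f:S^1\to S^2$ such that for every closed interval $J\subset S^1$ (nondegenerate, proper) the image $f(J)$ is homeomorphic to a closed 2-dimensional disk and $f(\partial J)\subset\partial f(J)$; wheels are viewed modulo changes of time parametrization. Zipper of a CaTherine wheel $f$: for a closed interval $J=[J^-,J^+]\subset S^1$ (oriented by $S^1$) with $f(J^-)\ne f(J^+)$, the Jordan curve $\partial f(J)$ minus the two points $f(J^\pm)$ consists of two open arcs. The right arc is the one which, traversed from $f(J^-)$ to $f(J^+)$, has the interior of $f(J)$ on its left; the other arc is the left arc. $Z^+$ is the union over all such $J$ of the right arcs, and $Z^-$ is the union over all such $J$ of the left arcs. It is known that $Z^+$ and $Z^-$ are disjoint, dense, path-connected subsets of $S^2$, with a unique simple path in $Z^+$ (resp. $Z^-$) between any two of its points. Short hair: a set $Z\subset S^2$ of this kind has short hair if, for any (equivalently, every) metric $d_0$ on $S^2$ inducing the standard topology, for every $\epsilon>0$ there is a compact subset $T$ of $Z$ homeomorphic to a finite tree (finite connected graph without cycles) such that every path component of $Z-T$ has $d_0$-diameter $<\epsilon$. *)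

theory Defs
  imports "HOL-Analysis.Analysis" "HOL-Analysis.Cross3" "HOL-Complex_Analysis.Complex_Analysis"
begin

text \<open>
  The circle is the unit circle in the complex plane, oriented counterclockwise. The 2-sphere is
  the unit sphere in three-space, oriented by its outward unit normal.
\<close>

abbreviation S1 :: "complex set" where "S1 \<equiv> sphere 0 1"

abbreviation S2 :: "(real^3) set" where "S2 \<equiv> sphere 0 1"

text \<open>
  A nondegenerate proper closed interval of the circle is \<open>circ_interval a b\<close> with
  \<open>a < b < a + 2 * pi\<close>; its initial and final endpoints are \<open>cis a\<close> and \<open>cis b\<close>.
\<close>

definition circ_interval :: "real \<Rightarrow> real \<Rightarrow> complex set" where
  "circ_interval a b = cis ` {a..b}"

text \<open>
  For a closed disk embedded in the sphere, its topological frontier and interior in the sphere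
  are its boundary circle and its open disk.
\<close>

definition bdry :: "(real^3) set \<Rightarrow> (real^3) set" where
  "bdry D = (top_of_set S2) frontier_of D"

definition intr :: "(real^3) set \<Rightarrow> (real^3) set" where
  "intr D = (top_of_set S2) interior_of D"

definition catherine_wheel :: "(complex \<Rightarrow> real^3) \<Rightarrow> bool" where
  "catherine_wheel f \<longleftrightarrow>
     continuous_on S1 f \<and> f ` S1 = S2 \<and>
     (\<forall>a b. a < b \<and> b < a + 2 * pi \<longrightarrow>
        f ` circ_interval a b homeomorphic cball (0::real^2) 1 \<and>
        f ` {cis a, cis b} \<subseteq> bdry (f ` circ_interval a b))"

text \<open>
  Stereographic projection from the north pole \<open>axis 3 1\<close>. The minus sign in the imaginary part
  makes it orientation preserving: seen from outside, a counterclockwise loop around the south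
  pole is mapped to a counterclockwise loop around \<open>0\<close>.
\<close>

definition stereo :: "real^3 \<Rightarrow> complex" where
  "stereo x = Complex (x $ 1) (- (x $ 2)) / complex_of_real (1 - x $ 3)"

text \<open>
  For a simple closed curve \<open>c\<close> in the sphere and a component \<open>U\<close> of its complement: \<open>U\<close> lies to
  the left of \<open>c\<close> iff, after moving a point \<open>q\<close> of the other component to the north pole by a
  rotation \<open>A\<close> and projecting stereographically, the resulting plane Jordan curve winds
  once counterclockwise around the points of \<open>U\<close>. Both components are nonempty, so the
  quantifiers are not vacuous, and the winding number does not depend on \<open>p\<close>, \<open>q\<close> and \<open>A\<close>.
\<close>

definition on_left_of :: "(real^3) set \<Rightarrow> (real \<Rightarrow> real^3) \<Rightarrow> bool" where
  "on_left_of U c \<longleftrightarrow>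
     (\<forall>p\<in>U. \<forall>q\<in>S2 - (U \<union> path_image c). \<forall>A :: real^3^3.
        rotation_matrix A \<and> A *v q = axis 3 1 \<longrightarrow>
        winding_number (\<lambda>t. stereo (A *v c t)) (stereo (A *v p)) = 1)"

text \<open>
  \<open>g\<close> and \<open>h\<close> parametrize the closures of the right and the left arc of the interval, both
  traversed from the image of its initial endpoint to the image of its final endpoint.
\<close>

definition right_left_arcs ::
  "(complex \<Rightarrow> real^3) \<Rightarrow> real \<Rightarrow> real \<Rightarrow> (real \<Rightarrow> real^3) \<Rightarrow> (real \<Rightarrow> real^3) \<Rightarrow> bool" where
  "right_left_arcs f a b g h \<longleftrightarrow>
     arc g \<and> pathstart g = f (cis a) \<and> pathfinish g = f (cis b) \<and>
     arc h \<and> pathstart h = f (cis a) \<and> pathfinish h = f (cis b) \<and>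
     path_image g \<inter> path_image h = {f (cis a), f (cis b)} \<and>
     path_image g \<union> path_image h = bdry (f ` circ_interval a b) \<and>
     on_left_of (intr (f ` circ_interval a b)) (g +++ reversepath h)"

definition zipper_plus :: "(complex \<Rightarrow> real^3) \<Rightarrow> (real^3) set" where
  "zipper_plus f =
     \<Union> {path_image g - {f (cis a), f (cis b)} | a b g h.
          a < b \<and> b < a + 2 * pi \<and> f (cis a) \<noteq> f (cis b) \<and> right_left_arcs f a b g h}"

definition zipper_minus :: "(complex \<Rightarrow> real^3) \<Rightarrow> (real^3) set" where
  "zipper_minus f =
     \<Union> {path_image h - {f (cis a), f (cis b)} | a b g h.
          a < b \<and> b < a + 2 * pi \<and> f (cis a) \<noteq> f (cis b) \<and> right_left_arcs f a b g h}"

text \<open>Cycles of a simple graph with edge set \<open>E\<close>, given as cyclic lists of distinct vertices.\<close>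

definition graph_cycle :: "nat set set \<Rightarrow> nat list \<Rightarrow> bool" where
  "graph_cycle E p \<longleftrightarrow>
     3 \<le> length p \<and> distinct p \<and>
     (\<forall>i<length p. {p ! i, p ! (Suc i mod length p)} \<in> E)"

text \<open>A graph without cycles has no loops or multiple edges, so simple graphs suffice.\<close>

definition finite_tree_graph :: "nat set \<Rightarrow> nat set set \<Rightarrow> bool" where
  "finite_tree_graph V E \<longleftrightarrow>
     finite V \<and> V \<noteq> {} \<and>
     (\<forall>e\<in>E. \<exists>u\<in>V. \<exists>v\<in>V. u \<noteq> v \<and> e = {u, v}) \<and>
     (\<forall>u\<in>V. \<forall>v\<in>V. (u, v) \<in> {(x, y). {x, y} \<in> E}\<^sup>*) \<and>
     \<not> (\<exists>p. graph_cycle E p)"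

text \<open>
  The geometric realization of a graph, viewed as a one-dimensional simplicial complex, in
  barycentric coordinates (a subspace of a product of real lines).
\<close>

definition graph_realization :: "nat set \<Rightarrow> nat set set \<Rightarrow> (nat \<Rightarrow> real) set" where
  "graph_realization V E =
     {x. (\<forall>i. 0 \<le> x i) \<and> {i. x i \<noteq> 0} \<in> (\<lambda>v. {v}) ` V \<union> E \<and> (\<Sum>i\<in>V. x i) = 1}"

definition topological_finite_tree :: "'a::topological_space set \<Rightarrow> bool" where
  "topological_finite_tree T \<longleftrightarrow>
     (\<exists>V E. finite_tree_graph V E \<and> T homeomorphic graph_realization V E)"

text \<open>
  The diameter of a nonempty set with respect to an arbitrary metric \<open>d\<close>. For a metric inducing the
  topology of the (compact) sphere the supremum is over a bounded set.
\<close>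

definition diam :: "('a \<Rightarrow> 'a \<Rightarrow> real) \<Rightarrow> 'a set \<Rightarrow> real" where
  "diam d C = (SUP (x, y) \<in> C \<times> C. d x y)"

definition short_hair :: "(real^3) set \<Rightarrow> bool" where
  "short_hair Z \<longleftrightarrow>
     (\<forall>d. Metric_space S2 d \<and> Metric_space.mtopology S2 d = top_of_set S2 \<longrightarrow>
        (\<forall>\<epsilon>>0. \<exists>T. T \<subseteq> Z \<and> compact T \<and> topological_finite_tree T \<and>
           (\<forall>C\<in>path_components_of (top_of_set (Z - T)). diam d C < \<epsilon>)))"

end

theory Submission
  imports Defs
begin

text \<open>
  Angles parametrize time. For an interval of angles from \<open>a\<close> to \<open>b\<close> that is shorter than a full
  turn, let \<open>D a b\<close> be its image under the wheel, a disk, and \<open>F a\<close>, \<open>F b\<close> the images of its ends. A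
  time outside the interval is not mapped into the interior of \<open>D a b\<close>, because it would be an end of
  a longer interval whose image contains that interior. So the image of the complementary interval is
  the sphere minus the interior of \<open>D a b\<close> (\<open>intr_eq\<close>): complementary intervals have the same boundary
  curve and, by the orientation convention, the same right and the same left arc
  (\<open>right_left_arcs_complement\<close>).

  The one further geometric fact is that the right arc of an interval is disjoint from the left arc of
  an adjacent interval (\<open>adjacent_arcs_disjoint\<close>). The two disks meet in a connected set, by
  Janiszewski's theorem. If the two arcs had a common point, then the two boundary curves would
  therefore share a whole arc, and comparing the winding numbers of both curves at points near this
  arc leads to a contradiction (\<open>two_orientations_core\<close>).

  The rest of the structure of the zipper follows formally from these two facts. The halves are
  disjoint (\<open>Zip_disjoint\<close>). They are path connected (\<open>path_connected_Zip\<close>), because three times cut the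
  circle into three intervals, and each of their right arcs intersects one of the other two. Both
  halves are dense, so neither contains a simple closed curve, which would separate the other half
  (\<open>no_simple_loop\<close>).

  For the short hair, the sphere is covered by finitely many small disks \<open>D a b\<close>. In a half \<open>Z\<close>, say the
  right one, choose a finite tree \<open>T\<close> that meets the right arc of each of these disks and contains
  those of the points \<open>F a\<close>, \<open>F b\<close> that lie in \<open>Z\<close>. A path in \<open>Z - T\<close> meets the boundaries of the disks
  only in right arcs. The right arcs at its first and at its last such point intersect, because
  otherwise the path, \<open>T\<close> and these two arcs would contain a simple closed curve in \<open>Z\<close> (\<open>sides_meet\<close>).
  Hence the ends of the path are at most four small diameters apart (\<open>short_hair_dist\<close>). The left half
  is treated in the same way, since the argument is symmetric in the two sides.
\<close>

declare transpose_matrix_vector [simp del]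

no_notation fps_nth (infixl "$" 75)

section \<open>Winding numbers under Moebius maps\<close>

text \<open>
  Every continuous logarithm computes the winding number, since two of them differ by a constant. So
  the effect of a Moebius map on winding numbers is found by adding and subtracting logarithms.
\<close>

lemma winding_number_exp_path:
  assumes q: "path q" and K: "K \<noteq> 0" and \<delta>: "\<And>t. t \<in> {0..1} \<Longrightarrow> \<delta> t - \<zeta> = K * exp (q t)"
  shows "winding_number \<delta> \<zeta> = (pathfinish q - pathstart q) / (2 * of_real pi * \<i>)"
proof -
  define u where "u t = Ln K + q t" for t
  let ?p = "\<lambda>t. \<zeta> + exp (u t)"
  have u: "path u" using q unfolding path_def u_def by (intro continuous_intros)
  have p: "path ?p" using u unfolding path_def by (intro continuous_intros)
  have nz: "\<zeta> \<notin> path_image ?p" by (auto simp: path_image_def)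
  have eq: "\<delta> t = ?p t" if "t \<in> {0..1}" for t
    using \<delta>[OF that] K by (simp add: u_def exp_add algebra_simps)
  obtain r where r: "path r" "pathfinish r - pathstart r = 2 * of_real pi * \<i> * winding_number ?p \<zeta>"
     "\<And>t. t \<in> {0..1} \<Longrightarrow> ?p t = \<zeta> + exp(r t)"
    using winding_number_as_continuous_log[OF p nz] by metis
  have *: "\<exists>n::int. u t - r t = of_int n * (2 * pi * \<i>)" if "t \<in> {0..1}" for t
  proof -
    have "exp (u t) = exp (r t)" using r(3)[OF that] by simp
    then show ?thesis by (auto simp: exp_eq)
  qed
  \<comment> \<open>Two continuous logarithms differ by a continuous function with discrete values, hence by a constant.\<close>
  have "(\<lambda>t. u t - r t) constant_on {0..1}"
  proof (rule continuous_discrete_range_constant)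
    show "continuous_on {0..1} (\<lambda>t. u t - r t)"
      using u r(1) unfolding path_def by (intro continuous_intros)
    fix x :: real assume x: "x \<in> {0..1}"
    show "\<exists>e>0. \<forall>y. y \<in> {0..1} \<and> u y - r y \<noteq> u x - r x \<longrightarrow> e \<le> norm (u y - r y - (u x - r x))"
    proof (intro exI[of _ "2*pi"] conjI allI impI)
      fix y :: real assume y: "y \<in> {0..1} \<and> u y - r y \<noteq> u x - r x"
      obtain m n :: int where mn: "u y - r y = of_int n * (2 * pi * \<i>)" "u x - r x = of_int m * (2 * pi * \<i>)"
        using * x y by metis
      then have "n \<noteq> m" using y by auto
      have "u y - r y - (u x - r x) = of_int (n - m) * (2 * pi * \<i>)"
        unfolding mn by (simp add: algebra_simps)
      then have "norm (u y - r y - (u x - r x)) = \<bar>of_int (n - m)\<bar> * (2 * pi)"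
        by (simp add: norm_mult del: of_int_diff)
      moreover have "\<bar>real_of_int (n-m)\<bar> \<ge> 1" using \<open>n \<noteq> m\<close> by linarith
      ultimately show "2*pi \<le> norm (u y - r y - (u x - r x))" by simp
    qed auto
  qed auto
  then have "u 1 - r 1 = u 0 - r 0" unfolding constant_on_def by force
  then have "q 1 - q 0 = r 1 - r 0" by (simp add: u_def algebra_simps)
  moreover have "winding_number \<delta> \<zeta> = winding_number ?p \<zeta>"
    using eq by (intro winding_number_cong) auto
  ultimately show ?thesis using r(2) by (simp add: pathfinish_def pathstart_def)
qed

lemma path_log:
  assumes "path \<gamma>" "\<zeta> \<notin> path_image \<gamma>"
  obtains a where "path a" "\<And>t. t \<in> {0..1} \<Longrightarrow> \<gamma> t - \<zeta> = exp (a t)"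
    "pathfinish a - pathstart a = 2 * of_real pi * \<i> * winding_number \<gamma> \<zeta>"
proof -
  obtain a where a: "path a" "pathfinish a - pathstart a = 2 * of_real pi * \<i> * winding_number \<gamma> \<zeta>"
     "\<And>t. t \<in> {0..1} \<Longrightarrow> \<gamma> t = \<zeta> + exp(a t)"
    using winding_number_as_continuous_log[OF assms] by metis
  have "\<gamma> t - \<zeta> = exp (a t)" if "t \<in> {0..1}" for t using a(3)[OF that] by simp
  then show thesis using that a(1,2) by blast
qed

text \<open>
  Here \<open>\<delta>\<close> and \<open>\<zeta>'\<close> are the images of \<open>\<gamma>\<close> and \<open>\<zeta>\<close> under a Moebius map with pole \<open>\<omega>\<close>. The next two
  lemmas are the cases in which the pole and the point \<open>\<zeta>\<close>, respectively, are at infinity.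
\<close>

lemma winding_number_quotient:
  assumes "path \<gamma>" "\<zeta> \<notin> path_image \<gamma>" "\<omega> \<notin> path_image \<gamma>" "K \<noteq> 0"
    and \<delta>: "\<And>t. t \<in> {0..1} \<Longrightarrow> \<delta> t - \<zeta>' = K * (\<gamma> t - \<zeta>) / (\<gamma> t - \<omega>)"
  shows "winding_number \<delta> \<zeta>' = winding_number \<gamma> \<zeta> - winding_number \<gamma> \<omega>"
proof -
  obtain a where a: "path a" "\<And>t. t \<in> {0..1} \<Longrightarrow> \<gamma> t - \<zeta> = exp (a t)"
    "pathfinish a - pathstart a = 2 * of_real pi * \<i> * winding_number \<gamma> \<zeta>"
    using path_log[OF assms(1,2)] by blast
  obtain b where b: "path b" "\<And>t. t \<in> {0..1} \<Longrightarrow> \<gamma> t - \<omega> = exp (b t)"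
    "pathfinish b - pathstart b = 2 * of_real pi * \<i> * winding_number \<gamma> \<omega>"
    using path_log[OF assms(1,3)] by blast
  have q: "path (\<lambda>t. a t - b t)" using a(1) b(1) unfolding path_def by (intro continuous_intros)
  have "winding_number \<delta> \<zeta>' = (pathfinish (\<lambda>t. a t - b t) - pathstart (\<lambda>t. a t - b t)) / (2 * of_real pi * \<i>)"
    by (rule winding_number_exp_path[OF q \<open>K \<noteq> 0\<close>]) (simp add: \<delta> a(2) b(2) exp_diff)
  also have "\<dots> = ((pathfinish a - pathstart a) - (pathfinish b - pathstart b)) / (2 * of_real pi * \<i>)"
    by (simp add: pathfinish_def pathstart_def)
  also have "\<dots> = (2 * of_real pi * \<i> * (winding_number \<gamma> \<zeta> - winding_number \<gamma> \<omega>)) / (2 * of_real pi * \<i>)"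
    unfolding a(3) b(3) by (simp add: right_diff_distrib)
  finally show ?thesis by simp
qed

lemma winding_number_scale:
  assumes "path \<gamma>" "\<zeta> \<notin> path_image \<gamma>" "K \<noteq> 0"
    and \<delta>: "\<And>t. t \<in> {0..1} \<Longrightarrow> \<delta> t - \<zeta>' = K * (\<gamma> t - \<zeta>)"
  shows "winding_number \<delta> \<zeta>' = winding_number \<gamma> \<zeta>"
proof -
  obtain a where a: "path a" "\<And>t. t \<in> {0..1} \<Longrightarrow> \<gamma> t - \<zeta> = exp (a t)"
    "pathfinish a - pathstart a = 2 * of_real pi * \<i> * winding_number \<gamma> \<zeta>"
    using path_log[OF assms(1,2)] by blast
  have "winding_number \<delta> \<zeta>' = (pathfinish a - pathstart a) / (2 * of_real pi * \<i>)"
    by (rule winding_number_exp_path[OF a(1) \<open>K \<noteq> 0\<close>]) (simp add: \<delta> a(2))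
  then show ?thesis unfolding a(3) by simp
qed

lemma winding_number_inverse:
  assumes "path \<gamma>" "\<omega> \<notin> path_image \<gamma>" "K \<noteq> 0"
    and \<delta>: "\<And>t. t \<in> {0..1} \<Longrightarrow> \<delta> t - \<zeta>' = K / (\<gamma> t - \<omega>)"
  shows "winding_number \<delta> \<zeta>' = - winding_number \<gamma> \<omega>"
proof -
  obtain a where a: "path a" "\<And>t. t \<in> {0..1} \<Longrightarrow> \<gamma> t - \<omega> = exp (a t)"
    "pathfinish a - pathstart a = 2 * of_real pi * \<i> * winding_number \<gamma> \<omega>"
    using path_log[OF assms(1,2)] by blast
  have q: "path (\<lambda>t. - a t)" using a(1) unfolding path_def by (intro continuous_intros)
  have "winding_number \<delta> \<zeta>' = (pathfinish (\<lambda>t. - a t) - pathstart (\<lambda>t. - a t)) / (2 * of_real pi * \<i>)"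
    by (rule winding_number_exp_path[OF q \<open>K \<noteq> 0\<close>]) (simp add: \<delta> a(2) exp_minus divide_inverse)
  also have "\<dots> = - (pathfinish a - pathstart a) / (2 * of_real pi * \<i>)"
    by (simp add: pathfinish_def pathstart_def)
  finally show ?thesis unfolding a(3) by simp
qed

section \<open>Arcs of two adjacent plane disks\<close>

text \<open>
  Two such arcs are reparametrizations of each other, hence homotopic in their image. This is used for
  arcs that are not closed, whose winding numbers need not be integers.
\<close>

lemma winding_number_arcs_same_image:
  assumes "arc g" "arc h" "path_image g = path_image h" "pathstart g = pathstart h" "pathfinish g = pathfinish h"
    and z: "z \<notin> path_image g"
  shows "winding_number g z = winding_number h z"
proof -
  obtain k where k: "homeomorphism {0..1} (path_image g) g k"
    using homeomorphism_arc[OF assms(1)] by blast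
  have hk: "\<And>t. t\<in>{0..1} \<Longrightarrow> h t \<in> path_image g" using assms(3) by (auto simp: path_image_def)
  have "homotopic_paths (-{z}) g h"
  proof (rule homotopic_paths_reparametrize)
    show "path g" using assms(1) by (rule arc_imp_path)
    show "path_image g \<subseteq> - {z}" using z by auto
    have "continuous_on {0..1} h" using arc_imp_path[OF assms(2)] by (simp add: path_def)
    moreover have "continuous_on (h ` {0..1}) k"
      using homeomorphism_cont2[OF k] assms(3) unfolding path_image_def by simp
    ultimately show "continuous_on {0..1} (k \<circ> h)" by (rule continuous_on_compose)
    show "(k \<circ> h) \<in> {0..1} \<rightarrow> {0..1}"
      using hk homeomorphism_image2[OF k] by (auto simp del: atLeastAtMost_iff)
    show "(k \<circ> h) 0 = 0" using homeomorphism_apply1[OF k, of 0] assms(4) by (simp add: pathstart_def)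
    show "(k \<circ> h) 1 = 1" using homeomorphism_apply1[OF k, of 1] assms(5) by (simp add: pathfinish_def)
    show "\<And>t. t \<in> {0..1} \<Longrightarrow> h t = g ((k \<circ> h) t)"
      using homeomorphism_apply2[OF k] hk by simp
  qed
  then show ?thesis by (rule winding_number_homotopic_paths)
qed

lemma arc_connected_subset_all:
  fixes g :: "real \<Rightarrow> 'a::t2_space"
  assumes "arc g" "connected S" "S \<subseteq> path_image g" "pathstart g \<in> S" "pathfinish g \<in> S"
  shows "S = path_image g"
proof -
  obtain k where k: "homeomorphism {0..1} (path_image g) g k"
    using homeomorphism_arc[OF assms(1)] by blast
  have "connected (k ` S)"
    using assms(2,3) homeomorphism_cont2[OF k] by (meson connected_continuous_image continuous_on_subset)
  moreover have "0 \<in> k ` S" "1 \<in> k ` S"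
    using homeomorphism_apply1[OF k, of 0] homeomorphism_apply1[OF k, of 1] assms(4,5)
    by (auto simp: pathstart_def pathfinish_def image_iff intro: bexI[of _ "g 0"] bexI[of _ "g 1"])
  ultimately have "{0..1} \<subseteq> k ` S"
    by (meson connected_contains_Icc)
  then have "g ` {0..1} \<subseteq> S"
    using assms(3) homeomorphism_apply2[OF k] by force
  then show ?thesis using assms(3) by (auto simp: path_image_def)
qed

text \<open>
  If \<open>M\<close> missed a point of each arc, then these two points would cut the circle into two parts, one
  with \<open>u\<close> and the other with \<open>v\<close>, and so disconnect \<open>M\<close>.
\<close>

lemma loop_arc_dichotomy:
  fixes s t :: "real \<Rightarrow> 'a::t2_space"
  assumes s: "arc s" and t: "arc t"
    and ends: "pathstart s = u" "pathfinish s = v" "pathstart t = v" "pathfinish t = u"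
    and int: "path_image s \<inter> path_image t = {u, v}"
    and M: "connected M" "M \<subseteq> path_image s \<union> path_image t" "u \<in> M" "v \<in> M"
  shows "path_image s \<subseteq> M \<or> path_image t \<subseteq> M"
proof (rule ccontr)
  assume "\<not> ?thesis"
  then obtain a b where a: "a \<in> path_image s" "a \<notin> M" and b: "b \<in> path_image t" "b \<notin> M" by auto
  obtain i where i: "i \<in> {0..1}" "s i = a" using a(1) by (auto simp: path_image_def)
  obtain j where j: "j \<in> {0..1}" "t j = b" using b(1) by (auto simp: path_image_def)
  have conts: "continuous_on {0..1} s" "continuous_on {0..1} t"
    using s t by (auto simp: arc_def path_def)
  have inj: "inj_on s {0..1}" "inj_on t {0..1}" using s t by (auto simp: arc_def)
  have e: "s 0 = u" "s 1 = v" "t 0 = v" "t 1 = u" using ends by (auto simp: pathstart_def pathfinish_def)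
  define E1 where "E1 = s ` {0..i} \<union> t ` {j..1}"
  define E2 where "E2 = s ` {i..1} \<union> t ` {0..j}"
  have uv: "u \<noteq> v" using e inj(1) by (metis atLeastAtMost_iff inj_on_def order_refl zero_le_one zero_neq_one)
  have cl: "closed E1" "closed E2"
    unfolding E1_def E2_def using i j conts
    by (intro closed_Un compact_imp_closed[OF compact_continuous_image] continuous_on_subset[OF conts(1)] continuous_on_subset[OF conts(2)]; auto)+
  have cov: "M \<subseteq> E1 \<union> E2"
  proof
    fix x assume "x \<in> M"
    then have "x \<in> path_image s \<union> path_image t" using M(2) by auto
    then consider k where "k \<in> {0..1}" "x = s k" | k where "k \<in> {0..1}" "x = t k"
      by (auto simp: path_image_def)
    then show "x \<in> E1 \<union> E2"
      by cases (auto simp: E1_def E2_def intro: image_eqI dest: le_cases simp del: atLeastAtMost_iff, (metis Un_iff atLeastAtMost_iff image_eqI linear)+)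
  qed
  have st: "s k = t l \<Longrightarrow> k\<in>{0..1} \<Longrightarrow> l\<in>{0..1} \<Longrightarrow> (k = 0 \<and> l = 1) \<or> (k = 1 \<and> l = 0)" for k l
  proof -
    assume A: "s k = t l" "k\<in>{0..1}" "l\<in>{0..1}"
    have "s k \<in> path_image s" "t l \<in> path_image t" unfolding path_image_def using imageI[OF A(2), of s] imageI[OF A(3), of t] by - 
    then have "s k \<in> {u,v}" using int A(1) by auto
    then consider "s k = u" | "s k = v" by auto
    then show ?thesis
    proof cases
      case 1
      then show ?thesis using A e inj by (metis atLeastAtMost_iff inj_onD order_refl zero_le_one)
    next
      case 2
      then show ?thesis using A e inj by (metis atLeastAtMost_iff inj_onD order_refl zero_le_one)
    qed
  qed
  have "E1 \<inter> E2 \<subseteq> {a, b}"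
  proof
    fix x assume x: "x \<in> E1 \<inter> E2"
    have i01: "0 \<le> i" "i \<le> 1" and j01: "0 \<le> j" "j \<le> 1" using i j by auto
    from x consider "x \<in> s ` {0..i}" "x \<in> s ` {i..1}" | "x \<in> s ` {0..i}" "x \<in> t ` {0..j}"
      | "x \<in> t ` {j..1}" "x \<in> s ` {i..1}" | "x \<in> t ` {j..1}" "x \<in> t ` {0..j}"
      unfolding E1_def E2_def by blast
    then show "x \<in> {a, b}"
    proof cases
      case 1
      then obtain k l where "x = s k" "x = s l" "0\<le>k" "k\<le>i" "i\<le>l" "l\<le>1" by fastforce
      note 1 = this
      then have "k = l" using inj(1) i01 by (auto simp: inj_on_def)
      then show ?thesis using 1 i by auto
    next
      case 2
      then obtain k l where "x = s k" "x = t l" "0\<le>k" "k\<le>i" "0\<le>l" "l\<le>j" by fastforce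
      note 2 = this
      then have "(k = 0 \<and> l = 1) \<or> (k = 1 \<and> l = 0)" using st[of k l] i01 j01 by auto
      then show ?thesis using 2 i j e i01 j01
        by (metis insertCI order_antisym)
    next
      case 3
      then obtain k l where "x = t k" "x = s l" "j\<le>k" "k\<le>1" "i\<le>l" "l\<le>1" by fastforce
      note 3 = this
      then have "(l = 0 \<and> k = 1) \<or> (l = 1 \<and> k = 0)" using st[of l k] i01 j01 by auto
      then show ?thesis using 3 i j e i01 j01
        by (metis insertCI order_antisym)
    next
      case 4
      then obtain k l where "x = t k" "x = t l" "j\<le>k" "k\<le>1" "0\<le>l" "l\<le>j" by fastforce
      note 4 = this
      then have "k = l" using inj(2) j01 by (auto simp: inj_on_def)
      then show ?thesis using 4 j by auto
    qed
  qed
  then have "M \<inter> E1 \<inter> E2 = {}" using a b by auto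
  moreover have "u \<in> E1" "v \<in> E2" unfolding E1_def E2_def using e i j by force+
  ultimately show False
    using connected_closedD[OF M(1) _ cov cl] M(3,4) by auto
qed

text \<open>
  Two boundary curves, each cut into two arcs at \<open>u\<close> and \<open>v\<close>, wind \<open>k\<close> times around disjoint regions \<open>UA\<close>
  and \<open>UB\<close>. As \<open>M\<close> lies on both curves and contains \<open>u\<close> and \<open>v\<close>, the curves share one of the arcs. If both
  traverse it from \<open>u\<close> to \<open>v\<close>, or both from \<open>v\<close> to \<open>u\<close>, then its winding number cancels in the difference
  of the two curves. What remains is continuous at every inner point of the shared arc, but it is \<open>k\<close> on
  \<open>UA\<close> and \<open>- k\<close> on \<open>UB\<close>. If they traverse it in opposite directions, then it is one of the arcs that
  contain \<open>P\<close> or \<open>S\<close>. Now the winding number of the shared arc cancels in the sum, and what remains is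
  continuous at that point, but it is \<open>k\<close> on \<open>UA\<close> and \<open>0\<close> on \<open>UC\<close>.
\<close>

lemma two_orientations_core:
  fixes s1 s2 t1 t2 :: "real \<Rightarrow> complex"
  assumes arcs: "arc s1" "arc s2" "arc t1" "arc t2"
    and ends: "pathstart s1 = u" "pathfinish s1 = v" "pathstart s2 = v" "pathfinish s2 = u"
              "pathstart t1 = u" "pathfinish t1 = v" "pathstart t2 = v" "pathfinish t2 = u"
    and int: "path_image s1 \<inter> path_image s2 = {u, v}" "path_image t1 \<inter> path_image t2 = {u, v}"
    and M: "connected M" "u \<in> M" "v \<in> M"
       "M \<subseteq> path_image s1 \<union> path_image s2" "M \<subseteq> path_image t1 \<union> path_image t2"
    and P: "P \<in> path_image s2" "P \<noteq> u" "P \<noteq> v" "P \<in> closure UC"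
    and S: "S \<in> path_image t2" "S \<noteq> u" "S \<noteq> v" "S \<in> closure UC"
    and clA: "path_image s1 \<union> path_image s2 \<subseteq> closure UA"
    and clB: "path_image t1 \<union> path_image t2 \<subseteq> closure UB"
    and off: "(UA \<union> UB \<union> UC) \<inter> (path_image s1 \<union> path_image s2 \<union> path_image t1 \<union> path_image t2) = {}"
    and wA: "\<And>z. z \<in> UA \<Longrightarrow> winding_number s1 z + winding_number s2 z = k"
            "\<And>z. z \<in> UB \<union> UC \<Longrightarrow> winding_number s1 z + winding_number s2 z = 0"
    and wB: "\<And>z. z \<in> UB \<Longrightarrow> winding_number t1 z + winding_number t2 z = k"
            "\<And>z. z \<in> UA \<union> UC \<Longrightarrow> winding_number t1 z + winding_number t2 z = 0"
    and k: "k \<noteq> 0"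
  shows False
proof -
  have paths: "path s1" "path s2" "path t1" "path t2" using arcs by (auto simp: arc_imp_path)
  have lim: "winding_number r y + c * winding_number r' y = l"
    if rr: "path r" "path r'" "y \<notin> path_image r" "y \<notin> path_image r'" "y \<in> closure U"
       "\<And>z. z \<in> U \<Longrightarrow> winding_number r z + c * winding_number r' z = l" for r r' y U l c
  proof -
    have c: "continuous (at y) (\<lambda>z. winding_number r z + c * winding_number r' z)"
      using continuous_at_winding_number rr(1-4) by (intro continuous_intros) auto
    obtain x where x: "\<And>n. x n \<in> U" "x \<longlonglongrightarrow> y" using rr(5) closure_sequential by metis
    have "(\<lambda>n. winding_number r (x n) + c * winding_number r' (x n)) \<longlonglongrightarrow> winding_number r y + c * winding_number r' y"
      using c x(2) by (rule isCont_tendsto_compose)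
    then have "(\<lambda>n::nat. l) \<longlonglongrightarrow> winding_number r y + c * winding_number r' y"
      using rr(6) x(1) by simp
    then show ?thesis using LIMSEQ_unique tendsto_const by blast
  qed
  \<comment> \<open>The sign \<open>\<sigma>\<close> tells whether the shared arc has the same direction in both curves. In the first case \<open>y\<close> will be
    any inner point of it and \<open>U\<close> will be \<open>UB\<close>; in the second case \<open>y\<close> will be \<open>P\<close> or \<open>S\<close> and \<open>U\<close> will be \<open>UC\<close>.\<close>
  have shared: False
    if st: "arc s" "arc t" "path s'" "path t'" "path_image s = path_image t"
      and \<sigma>: "\<sigma> = 1 \<and> pathstart s = pathstart t \<and> pathfinish s = pathfinish t \<or>
        \<sigma> = -1 \<and> pathstart s = pathfinish t \<and> pathfinish s = pathstart t"
      and cut: "path_image s \<inter> path_image s' = {u, v}" "path_image t \<inter> path_image t' = {u, v}"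
      and sums: "\<And>z. winding_number s z + winding_number s' z = winding_number s1 z + winding_number s2 z"
        "\<And>z. winding_number t z + winding_number t' z = winding_number t1 z + winding_number t2 z"
      and y: "y \<in> path_image s" "y \<noteq> u" "y \<noteq> v" "y \<in> closure UA" "y \<in> closure U"
      and off': "path_image s \<inter> (UA \<union> U) = {}"
      and l: "\<And>z. z \<in> U \<Longrightarrow> winding_number s1 z + winding_number s2 z - \<sigma> * (winding_number t1 z + winding_number t2 z) = l" "l \<noteq> k"
    for s t s' t' y U l and \<sigma> :: complex
  proof -
    have y': "y \<notin> path_image s'" "y \<notin> path_image t'" using st(5) cut y by auto
    have eq: "winding_number s z = \<sigma> * winding_number t z" if z: "z \<notin> path_image s" for z
      using \<sigma>
    proof
      assume "\<sigma> = 1 \<and> pathstart s = pathstart t \<and> pathfinish s = pathfinish t"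
      then show ?thesis using winding_number_arcs_same_image[OF st(1,2,5)] z by auto
    next
      assume \<sigma>: "\<sigma> = -1 \<and> pathstart s = pathfinish t \<and> pathfinish s = pathstart t"
      then have "winding_number s z = winding_number (reversepath t) z"
        using st z by (intro winding_number_arcs_same_image) (auto simp: arc_reversepath)
      then show ?thesis using \<sigma> st z by (simp add: winding_number_reversepath arc_imp_path)
    qed
    have rest: "winding_number s' z + (- \<sigma>) * winding_number t' z =
        winding_number s1 z + winding_number s2 z - \<sigma> * (winding_number t1 z + winding_number t2 z)"
      if "z \<notin> path_image s" for z
      unfolding sums[symmetric] eq[OF that] by (simp add: algebra_simps)
    have "winding_number s' y + (- \<sigma>) * winding_number t' y = k"
    proof (rule lim[OF st(3,4) y' y(4)])
      fix z assume z: "z \<in> UA"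
      then have "z \<notin> path_image s" using off' by auto
      then show "winding_number s' z + (- \<sigma>) * winding_number t' z = k"
        using rest[of z] wA(1)[OF z] wB(2)[of z] z by simp
    qed
    moreover have "winding_number s' y + (- \<sigma>) * winding_number t' y = l"
    proof (rule lim[OF st(3,4) y' y(5)])
      fix z assume z: "z \<in> U"
      then have "z \<notin> path_image s" using off' by auto
      then show "winding_number s' z + (- \<sigma>) * winding_number t' z = l"
        using rest[of z] l(1)[OF z] by simp
    qed
    ultimately show False using l(2) by simp
  qed
  have inner: "\<exists>y\<in>path_image s. y \<noteq> u \<and> y \<noteq> v" if "arc s" for s :: "real \<Rightarrow> complex"
  proof -
    have "infinite (path_image s)" using arc_image_uncountable[OF that] uncountable_infinite by blast
    then have "\<not> path_image s \<subseteq> {u, v}" by (meson finite.emptyI finite.insertI finite_subset)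
    then show ?thesis by blast
  qed
  \<comment> \<open>An arc in \<open>M\<close> with ends \<open>u\<close> and \<open>v\<close> is one of the two arcs of the second curve.\<close>
  have key: "path_image s = path_image t1 \<or> path_image s = path_image t2"
    if s: "arc s" "{pathstart s, pathfinish s} = {u, v}" "path_image s \<subseteq> M" for s
  proof -
    have uv: "u \<in> path_image s" "v \<in> path_image s"
      using s(2) pathstart_in_path_image[of s] pathfinish_in_path_image[of s] by (auto simp: doubleton_eq_iff)
    have "path_image t1 \<subseteq> path_image s \<or> path_image t2 \<subseteq> path_image s"
      using s M uv by (intro loop_arc_dichotomy[of t1 t2 u v]) (auto simp: arcs ends int connected_arc_image)
    moreover have "path_image t = path_image s"
      if "path_image t \<subseteq> path_image s" "arc t" "{pathstart t, pathfinish t} = {u, v}" for t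
    proof (rule arc_connected_subset_all)
      have uv: "u \<in> path_image t" "v \<in> path_image t"
        using that(3) pathstart_in_path_image[of t] pathfinish_in_path_image[of t] by (auto simp: doubleton_eq_iff)
      then show "pathstart s \<in> path_image t" "pathfinish s \<in> path_image t"
        using s(2) by (auto simp: doubleton_eq_iff)
    qed (use that s in \<open>auto simp: connected_arc_image\<close>)
    ultimately show ?thesis using arcs ends by (metis insert_commute)
  qed
  have M': "M \<subseteq> closure UA" "M \<subseteq> closure UB" using M clA clB by auto
  have neg: "- k \<noteq> k" using k by simp
  have "path_image s1 \<subseteq> M \<or> path_image s2 \<subseteq> M"
    using M by (intro loop_arc_dichotomy[of s1 s2 u v]) (auto simp: arcs ends int)
  then show False
  proof
    assume sM: "path_image s1 \<subseteq> M"
    obtain y where y: "y \<in> path_image s1" "y \<noteq> u" "y \<noteq> v" using inner[OF arcs(1)] by blast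
    have "path_image s1 = path_image t1 \<or> path_image s1 = path_image t2"
      using sM by (intro key) (auto simp: arcs ends)
    then show False
    proof
      assume "path_image s1 = path_image t1"
      then show False
        using sM M' off int y wA(2) wB(1) neg
        by (intro shared[of s1 t1 s2 t2 1 y UB "- k"]) (auto simp: arcs paths ends)
    next
      assume "path_image s1 = path_image t2"
      then show False
        using sM M' off int S wA(2) wB(2) k
        by (intro shared[of s1 t2 s2 t1 "-1" S UC 0]) (auto simp: arcs paths ends)
    qed
  next
    assume sM: "path_image s2 \<subseteq> M"
    obtain y where y: "y \<in> path_image s2" "y \<noteq> u" "y \<noteq> v" using inner[OF arcs(2)] by blast
    have "path_image s2 = path_image t1 \<or> path_image s2 = path_image t2"
      using sM by (intro key) (auto simp: arcs ends)
    then show False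
    proof
      assume "path_image s2 = path_image t2"
      then show False
        using sM M' off int y wA(2) wB(1) neg
        by (intro shared[of s2 t2 s1 t1 1 y UB "- k"]) (auto simp: arcs paths ends)
    next
      assume "path_image s2 = path_image t1"
      then show False
        using sM M' off int P wA(2) wB(2) k
        by (intro shared[of s2 t1 s1 t2 "-1" P UC 0]) (auto simp: arcs paths ends)
    qed
  qed
qed

lemma arc_cut:
  fixes g :: "real \<Rightarrow> 'a::real_normed_vector"
  assumes g: "arc g" and x: "x \<in> path_image g" "x \<noteq> pathstart g" "x \<noteq> pathfinish g"
  obtains s where "0 < s" "s < 1" "g s = x" "arc (subpath 0 s g)" "arc (subpath s 1 g)"
    "path_image (subpath 0 s g) \<union> path_image (subpath s 1 g) = path_image g"
    "path_image (subpath 0 s g) \<inter> path_image (subpath s 1 g) = {x}"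
proof -
  obtain s where s: "s \<in> {0..1}" "g s = x" using x(1) by (auto simp: path_image_def)
  have s01: "0 < s" "s < 1" using s x(2,3) by (auto simp: pathstart_def pathfinish_def less_le)
  let ?g1 = "subpath 0 s g" and ?g2 = "subpath s 1 g"
  have im: "path_image ?g1 = g ` {0..s}" "path_image ?g2 = g ` {s..1}"
    using s01 by (auto simp: path_image_subpath)
  have inj: "inj_on g {0..1}" using g by (simp add: arc_def)
  show thesis
  proof (rule that[OF s01 s(2)])
    show "arc ?g1" "arc ?g2" using g s01 by (auto intro!: arc_subpath_arc)
    show "path_image ?g1 \<union> path_image ?g2 = path_image g"
    proof -
      have "{0..s} \<union> {s..1} = {0..1}" using s01 by auto
      then show ?thesis unfolding im image_Un[symmetric] by (simp add: path_image_def)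
    qed
    have "{0..s} \<inter> {s..1} = {s}" using s01 by auto
    then show "path_image ?g1 \<inter> path_image ?g2 = {x}"
      unfolding im using inj_on_image_Int[OF inj, of "{0..s}" "{s..1}"] s01 s(2) by auto
  qed
qed

lemma arc_cut_winding:
  assumes g: "arc g" and x: "x \<in> path_image g" "x \<noteq> pathstart g" "x \<noteq> pathfinish g"
  obtains g1 g2 where "arc g1" "arc g2" "pathstart g1 = pathstart g" "pathfinish g1 = x"
    "pathstart g2 = x" "pathfinish g2 = pathfinish g" "path_image g1 \<union> path_image g2 = path_image g"
    "path_image g1 \<inter> path_image g2 = {x}"
    "\<And>z. z \<notin> path_image g \<Longrightarrow> winding_number g z = winding_number g1 z + winding_number g2 z"
proof -
  obtain s where s: "0 < s" "s < 1" "g s = x" "arc (subpath 0 s g)" "arc (subpath s 1 g)"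
    "path_image (subpath 0 s g) \<union> path_image (subpath s 1 g) = path_image g"
    "path_image (subpath 0 s g) \<inter> path_image (subpath s 1 g) = {x}"
    using arc_cut[OF assms] by blast
  show thesis
  proof (rule that[OF s(4,5) _ _ _ _ s(6,7)])
    fix z assume z: "z \<notin> path_image g"
    show "winding_number g z = winding_number (subpath 0 s g) z + winding_number (subpath s 1 g) z"
      using winding_number_subpath_combine[of g z 0 s 1] g z s by (simp add: arc_imp_path)
  qed (use s in \<open>auto simp: pathstart_def pathfinish_def subpath_def\<close>)
qed

text \<open>
  The boundary curves are \<open>g\<close> followed by the reverse of \<open>h\<close>, and \<open>g'\<close> followed by the reverse of \<open>h'\<close>.
  They are cut at \<open>x\<close> and at the common end \<open>Q\<close>, which puts \<open>P\<close> and \<open>S\<close> on the pieces from \<open>Q\<close> to \<open>x\<close>.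
\<close>

lemma opposite_sides_core:
  fixes g h g' h' :: "real \<Rightarrow> complex"
  assumes arcs: "arc g" "arc h" "arc g'" "arc h'"
    and ends: "pathstart g = P" "pathfinish g = Q" "pathstart h = P" "pathfinish h = Q"
              "pathstart g' = Q" "pathfinish g' = S" "pathstart h' = Q" "pathfinish h' = S"
    and int: "path_image g \<inter> path_image h = {P, Q}" "path_image g' \<inter> path_image h' = {Q, S}"
    and x: "x \<in> path_image g" "x \<in> path_image h'" "x \<noteq> P" "x \<noteq> Q" "x \<noteq> S"
    and M: "connected M" "x \<in> M" "Q \<in> M"
       "M \<subseteq> path_image g \<union> path_image h" "M \<subseteq> path_image g' \<union> path_image h'"
    and PS: "P \<in> closure UC" "S \<in> closure UC"
    and clA: "path_image g \<union> path_image h \<subseteq> closure UA"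
    and clB: "path_image g' \<union> path_image h' \<subseteq> closure UB"
    and off: "(UA \<union> UB \<union> UC) \<inter> (path_image g \<union> path_image h \<union> path_image g' \<union> path_image h') = {}"
    and wA: "\<And>z. z \<in> UA \<Longrightarrow> winding_number g z - winding_number h z = k"
            "\<And>z. z \<in> UB \<union> UC \<Longrightarrow> winding_number g z - winding_number h z = 0"
    and wB: "\<And>z. z \<in> UB \<Longrightarrow> winding_number g' z - winding_number h' z = k"
            "\<And>z. z \<in> UA \<union> UC \<Longrightarrow> winding_number g' z - winding_number h' z = 0"
    and k: "k \<noteq> 0"
  shows False
proof -
  obtain g1 g2 where g12: "arc g1" "arc g2" "pathstart g1 = P" "pathfinish g1 = x"
    "pathstart g2 = x" "pathfinish g2 = Q" "path_image g1 \<union> path_image g2 = path_image g"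
    "path_image g1 \<inter> path_image g2 = {x}"
    "\<And>z. z \<notin> path_image g \<Longrightarrow> winding_number g z = winding_number g1 z + winding_number g2 z"
    using arc_cut_winding[OF arcs(1) x(1)] x ends by metis
  obtain h1 h2 where h12: "arc h1" "arc h2" "pathstart h1 = Q" "pathfinish h1 = x"
    "pathstart h2 = x" "pathfinish h2 = S" "path_image h1 \<union> path_image h2 = path_image h'"
    "path_image h1 \<inter> path_image h2 = {x}"
    "\<And>z. z \<notin> path_image h' \<Longrightarrow> winding_number h' z = winding_number h1 z + winding_number h2 z"
    using arc_cut_winding[OF arcs(4) x(2)] x ends by metis
  have inP: "P \<in> path_image g1" "x \<in> path_image g1" "x \<in> path_image g2" "Q \<in> path_image g2"
      "P \<in> path_image h" "Q \<in> path_image h"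
    using g12 ends pathstart_in_path_image pathfinish_in_path_image by metis+
  have inS: "Q \<in> path_image h1" "x \<in> path_image h1" "x \<in> path_image h2" "S \<in> path_image h2"
      "Q \<in> path_image g'" "S \<in> path_image g'"
    using h12 ends pathstart_in_path_image pathfinish_in_path_image by metis+
  have PQ: "P \<noteq> Q" "S \<noteq> Q" using arcs ends arc_distinct_ends by metis+
  have ng: "Q \<notin> path_image g1" "P \<notin> path_image g2" "Q \<notin> path_image h2" "S \<notin> path_image h1"
    using g12(8) h12(8) inP(1,4) inS(1,4) x(3-5) by (metis IntI singletonD)+
  have sub: "path_image g1 \<subseteq> path_image g" "path_image g2 \<subseteq> path_image g"
    "path_image h1 \<subseteq> path_image h'" "path_image h2 \<subseteq> path_image h'"
    using g12(7) h12(7) by (metis Un_upper1 Un_upper2)+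
  have g1h: "path_image h \<inter> path_image g1 = {P}" and g2h: "path_image h \<inter> path_image g2 = {Q}"
    using int(1) sub(1,2) ng(1,2) inP(1,4,5,6) by auto
  have h2g: "path_image g' \<inter> path_image h2 = {S}" and h1g: "path_image g' \<inter> path_image h1 = {Q}"
    using int(2) sub(3,4) ng(3,4) inS(1,4,5,6) by auto
  let ?s2 = "reversepath h +++ g1" and ?t1 = "reversepath h1" and ?t2 = "g' +++ reversepath h2"
  have s2: "arc ?s2" using arcs g12 ends g1h by (intro arc_join) (auto simp: arc_reversepath)
  have t2: "arc ?t2" using arcs h12 ends h2g by (intro arc_join) (auto simp: arc_reversepath)
  have is2: "path_image ?s2 = path_image h \<union> path_image g1" using ends g12 by (simp add: path_image_join)
  have it2: "path_image ?t2 = path_image g' \<union> path_image h2" using ends h12 by (simp add: path_image_join)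
  have sa: "path_image g2 \<union> path_image ?s2 = path_image g \<union> path_image h" using is2 g12(7) by auto
  have ta: "path_image ?t1 \<union> path_image ?t2 = path_image g' \<union> path_image h'" using it2 h12(7) by auto
  have ws: "winding_number g2 z + winding_number ?s2 z = winding_number g z - winding_number h z"
    if "z \<notin> path_image g \<union> path_image h" for z
  proof -
    have "z \<notin> path_image g1" using that g12(7) by auto
    then have "winding_number ?s2 z = - winding_number h z + winding_number g1 z"
      using that arcs g12 ends by (simp add: winding_number_join arc_imp_path winding_number_reversepath)
    then show ?thesis using g12(9)[of z] that by simp
  qed
  have wt: "winding_number ?t1 z + winding_number ?t2 z = winding_number g' z - winding_number h' z"
    if "z \<notin> path_image g' \<union> path_image h'" for z
  proof -
    have "z \<notin> path_image h1" "z \<notin> path_image h2" using that h12(7) by auto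
    then have "winding_number ?t2 z = winding_number g' z - winding_number h2 z" "winding_number ?t1 z = - winding_number h1 z"
      using that arcs h12 ends by (simp_all add: winding_number_join arc_imp_path winding_number_reversepath)
    then show ?thesis using h12(9)[of z] that by simp
  qed
  show False
  proof (rule two_orientations_core[of g2 ?s2 ?t1 ?t2 x Q M P UC S UA UB k])
    show "path_image g2 \<inter> path_image ?s2 = {x, Q}"
      unfolding is2 Int_Un_distrib using g12(8) g2h by (simp add: Int_commute insert_commute)
    show "path_image ?t1 \<inter> path_image ?t2 = {x, Q}"
      unfolding it2 Int_Un_distrib path_image_reversepath using h12(8) h1g by (simp add: Int_commute insert_commute)
    show "P \<in> path_image ?s2" "S \<in> path_image ?t2" unfolding is2 it2 using inP inS by auto
    show "winding_number g2 z + winding_number ?s2 z = k" if "z \<in> UA" for z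
      using ws[of z] wA(1)[OF that] that off by auto
    show "winding_number g2 z + winding_number ?s2 z = 0" if "z \<in> UB \<union> UC" for z
      using ws[of z] wA(2)[OF that] that off by auto
    show "winding_number ?t1 z + winding_number ?t2 z = k" if "z \<in> UB" for z
      using wt[of z] wB(1)[OF that] that off by auto
    show "winding_number ?t1 z + winding_number ?t2 z = 0" if "z \<in> UA \<union> UC" for z
      using wt[of z] wB(2)[OF that] that off by auto
    show "(UA \<union> UB \<union> UC) \<inter> (path_image g2 \<union> path_image ?s2 \<union> path_image ?t1 \<union> path_image ?t2) = {}"
      using off sa ta by blast
    show "path_image g2 \<union> path_image ?s2 \<subseteq> closure UA" "path_image ?t1 \<union> path_image ?t2 \<subseteq> closure UB"
      unfolding sa ta by (rule clA, rule clB)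
    show "M \<subseteq> path_image g2 \<union> path_image ?s2" "M \<subseteq> path_image ?t1 \<union> path_image ?t2"
      unfolding sa ta by (rule M(4), rule M(5))
    show "arc ?t1" using h12 by (simp add: arc_reversepath)
  qed (use s2 t2 g12 h12 ends M(1-3) PS x PQ k in simp_all)
qed

section \<open>Stereographic projection and rotations\<close>

lemma mem_S2_iff: "(x::real^3) \<in> S2 \<longleftrightarrow> (x$1)^2 + (x$2)^2 + (x$3)^2 = 1"
proof -
  have "x \<in> S2 \<longleftrightarrow> x \<bullet> x = 1" by (simp add: norm_eq_1)
  then show ?thesis by (simp add: inner_vec_def sum_3 power2_eq_square)
qed

lemma mult_vec3_nth: "((A::real^3^3) *v x) $ i = A$i$1 * x$1 + A$i$2 * x$2 + A$i$3 * x$3"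
  by (simp add: matrix_vector_mult_def sum_3)

abbreviation north :: "real^3" where "north \<equiv> axis 3 1"

lemma north_nth [simp]: "north $ 1 = 0" "north $ 2 = 0" "north $ 3 = 1"
  by (simp_all add: axis_def)

lemma S2_third_eq_1: "x \<in> S2 \<Longrightarrow> x $ 3 = 1 \<longleftrightarrow> x = north"
  unfolding mem_S2_iff vec_eq_iff forall_3 by (auto simp: sum_power2_eq_zero_iff)

definition unstereo :: "complex \<Rightarrow> real^3" where
  "unstereo z = vector [2 * Re z / ((cmod z)^2 + 1), - 2 * Im z / ((cmod z)^2 + 1), ((cmod z)^2 - 1) / ((cmod z)^2 + 1)]"

lemma unstereo_nth [simp]:
  "unstereo z $ 1 = 2 * Re z / ((cmod z)^2 + 1)" "unstereo z $ 2 = - 2 * Im z / ((cmod z)^2 + 1)"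
  "unstereo z $ 3 = ((cmod z)^2 - 1) / ((cmod z)^2 + 1)"
  by (simp_all add: unstereo_def vector_3)

lemma cmod_sq_pos: "(cmod z)^2 + 1 > 0" "(cmod z)^2 + 1 \<noteq> 0"
  by (metis add.commute add_pos_nonneg zero_le_power2 zero_less_one, metis add.commute add_pos_nonneg less_irrefl zero_le_power2 zero_less_one)

lemma stereo_unstereo: "stereo (unstereo z) = z"
proof -
  have N: "(cmod z)^2 + 1 \<noteq> 0" by (rule cmod_sq_pos)
  have "1 - unstereo z $ 3 = 2 / ((cmod z)^2 + 1)" using N by (simp add: field_simps)
  then have "stereo (unstereo z) = Complex (2 * Re z / ((cmod z)^2 + 1)) (2 * Im z / ((cmod z)^2 + 1)) / complex_of_real (2 / ((cmod z)^2 + 1))"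
    unfolding stereo_def by simp
  also have "\<dots> = z"
    using N unfolding complex_eq_iff Re_divide_of_real Im_divide_of_real by simp
  finally show ?thesis .
qed

lemma unstereo_in: "unstereo z \<in> S2 - {north}"
proof -
  have N: "(cmod z)^2 + 1 \<noteq> 0" by (rule cmod_sq_pos)
  have "(2 * Re z)^2 + (- 2 * Im z)^2 + ((cmod z)^2 - 1)^2 = ((cmod z)^2 + 1)^2"
    unfolding cmod_power2 by (simp add: power2_eq_square algebra_simps)
  then have "unstereo z \<in> S2" unfolding mem_S2_iff unstereo_nth power_divide
    using N by (simp add: add_divide_distrib[symmetric])
  moreover have "unstereo z $ 3 \<noteq> 1" using N by (simp add: field_simps)
  ultimately show ?thesis using S2_third_eq_1[of "unstereo z"] by blast
qed

lemma unstereo_stereo: assumes "x \<in> S2" "x \<noteq> north" shows "unstereo (stereo x) = x"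
proof -
  define m where "m = 1 - x$3"
  have m: "m \<noteq> 0" using assms S2_third_eq_1 by (auto simp: m_def)
  have x3: "x$3 = 1 - m" by (simp add: m_def)
  have R: "Re (stereo x) = x$1 / m" and I: "Im (stereo x) = - x$2 / m"
    unfolding stereo_def Re_divide_of_real Im_divide_of_real m_def by simp_all
  have sq: "(x$1)^2 + (x$2)^2 = m * (2 - m)"
    using assms(1) unfolding mem_S2_iff x3 by (simp add: power2_eq_square algebra_simps)
  have "(cmod (stereo x))^2 = ((x$1)^2 + (x$2)^2) / m^2"
    unfolding cmod_power2 R I by (simp add: power_divide add_divide_distrib)
  then have c: "(cmod (stereo x))^2 = (2 - m) / m" unfolding sq using m by (simp add: power2_eq_square)
  have N: "(cmod (stereo x))^2 + 1 = 2 / m" unfolding c using m by (simp add: field_simps)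
  show ?thesis unfolding vec_eq_iff forall_3 unstereo_nth N unfolding R I c unfolding x3 using m
    by (simp add: field_simps)
qed

lemma continuous_on_unstereo: "continuous_on UNIV unstereo"
proof -
  have "continuous_on UNIV (\<lambda>z. unstereo z $ i)" for i
  proof -
    have "\<forall>i. continuous_on UNIV (\<lambda>z. unstereo z $ i)"
      unfolding forall_3 unstereo_nth using cmod_sq_pos(2)
      by (intro conjI continuous_intros) auto
    then show ?thesis by blast
  qed
  then have "continuous_on UNIV (\<lambda>z. \<chi> i. unstereo z $ i)" by (rule continuous_on_vec_lambda)
  then show ?thesis by simp
qed

lemma continuous_on_stereo: "continuous_on (S2 - {north}) stereo"
proof -
  have "continuous_on (S2 - {north}) (\<lambda>x. (complex_of_real (x$1) - \<i> * complex_of_real (x$2)) / complex_of_real (1 - x$3))"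
    using S2_third_eq_1 by (intro continuous_intros) auto
  moreover have "stereo = (\<lambda>x. (complex_of_real (x$1) - \<i> * complex_of_real (x$2)) / complex_of_real (1 - x$3))"
    unfolding stereo_def by (intro ext) (simp add: Complex_eq)
  ultimately show ?thesis by (simp only:)
qed

lemma rotation_norm:
  assumes "rotation_matrix (A::real^3^3)" shows "norm (A *v x) = norm x"
proof -
  have "orthogonal_transformation ((*v) A)"
    using assms by (simp add: rotation_matrix_def orthogonal_transformation_matrix matrix_of_matrix_vector_mul)
  then show ?thesis by (simp add: orthogonal_transformation)
qed

lemma rotation_transpose: "rotation_matrix (A::real^3^3) \<Longrightarrow> rotation_matrix (transpose A)"
  by (simp add: rotation_matrix_def orthogonal_matrix_transpose det_transpose)

lemma rotation_inverse: assumes "rotation_matrix (A::real^3^3)"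
  shows "transpose A *v (A *v x) = x" "A *v (transpose A *v x) = x"
  using assms by (simp_all add: rotation_matrix_def orthogonal_matrix_def matrix_vector_mul_assoc)

lemma rotation_mul: "rotation_matrix (A::real^3^3) \<Longrightarrow> rotation_matrix B \<Longrightarrow> rotation_matrix (A ** B)"
  by (simp add: rotation_matrix_def orthogonal_matrix_mul det_mul)

lemma rotation_to_north:
  assumes "q \<in> S2" obtains A :: "real^3^3" where "rotation_matrix A" "A *v q = north"
proof -
  obtain f :: "real^3 \<Rightarrow> real^3" where f: "orthogonal_transformation f" "det(matrix f) = 1" "f q = north"
    using rotation_exists_1[of q north] assms by (auto simp: norm_axis_1)
  show thesis
    by (rule that[of "matrix f"])
      (use f in \<open>auto simp: rotation_matrix_def orthogonal_transformation_matrix matrix_works orthogonal_transformation_linear\<close>)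
qed

text \<open>
  Stereographic projection from the point that the rotation \<open>A\<close> moves to the north pole.
\<close>

definition sproj :: "real^3^3 \<Rightarrow> real^3 \<Rightarrow> complex" where
  "sproj A x = stereo (A *v x)"

lemma homeomorphism_sproj:
  assumes A: "rotation_matrix A" and q: "A *v q = north"
  shows "homeomorphism (S2 - {q}) UNIV (sproj A) (\<lambda>z. transpose A *v unstereo z)"
proof -
  have q': "transpose A *v north = q" using rotation_inverse(1)[OF A, of q] q by simp
  have im: "A *v x \<in> S2 - {north}" if "x \<in> S2 - {q}" for x
    using that q' rotation_inverse(1)[OF A, of x] by (auto simp: rotation_norm[OF A])
  have im': "transpose A *v y \<in> S2 - {q}" if "y \<in> S2 - {north}" for y
    using that q rotation_inverse(2)[OF A, of y] by (auto simp: rotation_norm[OF rotation_transpose[OF A]])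
  have c1: "continuous_on (S2 - {q}) (sproj A)"
    unfolding sproj_def
    by (rule continuous_on_compose2[OF continuous_on_stereo]) (use im in \<open>auto intro!: continuous_intros\<close>)
  have c2: "continuous_on UNIV (\<lambda>z. transpose A *v unstereo z)"
    by (rule continuous_on_compose2[OF _ continuous_on_unstereo, where t=UNIV]) (auto intro!: continuous_intros)
  have 1: "transpose A *v unstereo (sproj A x) = x" if "x \<in> S2 - {q}" for x
    using im[OF that] by (simp add: sproj_def unstereo_stereo rotation_inverse[OF A])
  have 2: "sproj A (transpose A *v unstereo z) = z" for z
    by (simp add: sproj_def stereo_unstereo rotation_inverse[OF A])
  show ?thesis
    by (rule homeomorphismI) (use c1 c2 1 2 im' unstereo_in in auto)
qed

text \<open>
  Rotations of the sphere are Moebius maps in the stereographic coordinate. Let \<open>e\<close> be the first row of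
  \<open>B\<close> minus \<open>\<i>\<close> times the second one, and let \<open>w\<close> be the third row, which is also the point moved to the
  north pole. The rows are a positively oriented orthonormal basis, so \<open>e \<times> w = - \<i> e\<close>, and \<open>e\<close> is determined
  by \<open>w\<close> and the number \<open>E\<close>. With \<open>z\<close> for the coordinate of \<open>x\<close> and \<open>\<omega>\<close> for that of \<open>w\<close>, numerator and
  denominator of \<open>stereo (B *v x)\<close> then have the common factor \<open>cnj z - cnj \<omega>\<close>, and cancelling it leaves a
  fraction in \<open>z\<close> alone.
\<close>

lemma stereo_rotation:
  fixes B :: "real^3^3" and w :: "real^3" and E :: complex
  defines "w \<equiv> transpose B *v north"
  defines "E \<equiv> Complex (B$1$1 - B$2$2) (- (B$1$2 + B$2$1))"
  assumes B: "rotation_matrix B" and w: "w \<noteq> north"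
  shows "E \<noteq> 0" (is ?t1)
    and "\<And>x. x \<in> S2 - {north, w} \<Longrightarrow>
      stereo (B *v x) = E * (1 + cnj (stereo w) * stereo x) / (complex_of_real (1 - w$3) * (stereo x - stereo w))"
    and "stereo (B *v north) = E * cnj (stereo w) / complex_of_real (1 - w$3)" (is ?t3)
    and "w$3 \<noteq> 1" (is ?t4)
proof -
  have wn: "w $ j = B$3$j" for j unfolding w_def
    by (simp add: matrix_vector_mult_def transpose_def sum_3)
  have tr: "(transpose B *v axis i 1) $ j = B$i$j" for i j
    by (simp add: matrix_vector_mult_def transpose_def axis_def if_distrib sum.delta cong: if_cong)
  have R: "rotation_matrix (transpose B)" by (rule rotation_transpose[OF B])
  have c1: "cross3 (transpose B *v axis 2 1) (transpose B *v axis 3 1) = transpose B *v (axis 1 1)"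
    and c2: "cross3 (transpose B *v axis 3 1) (transpose B *v axis 1 1) = transpose B *v (axis 2 1)"
    and c3: "cross3 (transpose B *v axis 1 1) (transpose B *v axis 2 1) = transpose B *v (axis 3 1)"
    unfolding cross_rotation_matrix[OF R] by (simp_all add: cross_basis)
  have wS: "w \<in> S2" unfolding w_def by (simp add: rotation_norm[OF R] norm_axis_1)
  then have w1: "(B$3$1)^2 + (B$3$2)^2 + (B$3$3)^2 = 1" unfolding mem_S2_iff wn .
  have "transpose B *v axis 1 1 \<in> S2" by (simp add: rotation_norm[OF R] norm_axis_1)
  then have u1: "(B$1$1)^2 + (B$1$2)^2 + (B$1$3)^2 = 1" unfolding mem_S2_iff tr .
  have u: "B$1$1 = B$2$2*B$3$3 - B$2$3*B$3$2" "B$1$2 = B$2$3*B$3$1 - B$2$1*B$3$3" "B$1$3 = B$2$1*B$3$2 - B$2$2*B$3$1"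
    using c1 by (auto simp: vec_eq_iff forall_3 cross3_simps tr)
  have v: "B$2$1 = B$3$2*B$1$3 - B$3$3*B$1$2" "B$2$2 = B$3$3*B$1$1 - B$3$1*B$1$3" "B$2$3 = B$3$1*B$1$2 - B$3$2*B$1$1"
    using c2 by (auto simp: vec_eq_iff forall_3 cross3_simps tr)
  have dots: "B$1$1*B$3$1 + B$1$2*B$3$2 + B$1$3*B$3$3 = 0" "B$2$1*B$3$1 + B$2$2*B$3$2 + B$2$3*B$3$3 = 0"
    subgoal unfolding u by (simp add: algebra_simps)
    subgoal unfolding v by (simp add: algebra_simps)
    done
  define \<mu> where "\<mu> = 1 - B$3$3"
  have mu: "\<mu> \<noteq> 0" using w S2_third_eq_1[OF wS] by (simp add: \<mu>_def wn)
  show ?t4 using mu by (simp add: \<mu>_def wn)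
  define e3 where "e3 = Complex (B$1$3) (- B$2$3)"
  define E' where "E' = Complex (B$1$1 + B$2$2) (B$1$2 - B$2$1)"
  define W where "W = Complex (B$3$1) (- B$3$2)"
  have f1: "e3 * of_real \<mu> = E * cnj W"
  proof -
    have "(B$1$1 - B$2$2) * B$3$1 + (B$1$2 + B$2$1) * B$3$2 = B$1$3 * (1 - B$3$3)"
      using u(3) dots(1) by algebra
    moreover have "(B$1$1 - B$2$2) * B$3$2 - (B$1$2 + B$2$1) * B$3$1 = - B$2$3 * (1 - B$3$3)"
      using v(3) dots(2) by algebra
    ultimately show ?thesis by (simp add: complex_eq_iff E_def W_def e3_def \<mu>_def algebra_simps)
  qed
  have f2: "e3 * cnj W = - (of_real \<mu> * E')"
  proof -
    have r: "B$1$3*B$3$1 + B$2$3*B$3$2 = - ((1 - B$3$3) * (B$1$1 + B$2$2))"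
      "B$1$3*B$3$2 - B$2$3*B$3$1 = - ((1 - B$3$3) * (B$1$2 - B$2$1))"
      using u(1,2) v(1,2) by algebra+
    have "e3 * cnj W = Complex (B$1$3*B$3$1 + B$2$3*B$3$2) (B$1$3*B$3$2 - B$2$3*B$3$1)"
      by (simp add: complex_eq_iff e3_def W_def)
    also have "\<dots> = - (of_real \<mu> * E')"
      unfolding r by (simp add: complex_eq_iff E'_def \<mu>_def)
    finally show ?thesis .
  qed
  have f3: "W * cnj W = of_real (\<mu> * (2 - \<mu>))"
    unfolding complex_eq_iff W_def \<mu>_def using w1 by (simp add: algebra_simps power2_eq_square)
  show E0: ?t1
  proof
    assume "E = 0"
    then have "e3 = 0" using f1 mu by simp
    then have "E' = 0" using f2 mu by simp
    then have "B$1$1 = 0" "B$1$2 = 0" "B$1$3 = 0" using \<open>E = 0\<close> \<open>e3 = 0\<close>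
      by (simp_all add: complex_eq_iff E_def E'_def e3_def)
    then show False using u1 by simp
  qed
  define \<omega> where "\<omega> = stereo w"
  have om: "\<omega> = W / of_real \<mu>" unfolding \<omega>_def stereo_def W_def \<mu>_def by (simp add: wn)
  have W': "W = of_real \<mu> * \<omega>" unfolding om using mu by simp
  have Wc: "cnj W = of_real \<mu> * cnj \<omega>" unfolding W' by simp
  have e3': "e3 = E * cnj \<omega>"
  proof -
    have "of_real \<mu> * e3 = of_real \<mu> * (E * cnj \<omega>)"
      using f1 unfolding Wc by (simp only: mult_ac)
    then show ?thesis using mu by simp
  qed
  have E'': "E' = - E * cnj \<omega> * cnj \<omega>"
  proof -
    have "of_real \<mu> * E' = of_real \<mu> * (- E * cnj \<omega> * cnj \<omega>)"
      using f2 unfolding Wc e3' by (simp add: mult_ac minus_equation_iff[of "of_real \<mu> * E'"])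
    then show ?thesis by (metis mu mult_cancel_left of_real_eq_0_iff)
  qed
  have ww: "of_real \<mu> * \<omega> * cnj \<omega> = of_real (2 - \<mu>)"
  proof -
    have "of_real \<mu> * (of_real \<mu> * \<omega> * cnj \<omega>) = of_real \<mu> * complex_of_real (2 - \<mu>)"
      using f3 unfolding Wc W' by (simp add: mult_ac)
    then show ?thesis using mu by simp
  qed
  have dn: "stereo (B *v x) = Complex ((B *v x)$1) (- (B *v x)$2) / of_real (1 - (B *v x)$3)" for x
    by (simp add: stereo_def)
  show ?t3
  proof -
    have "stereo (B *v north) = e3 / of_real \<mu>"
      unfolding dn by (simp add: mult_vec3_nth e3_def \<mu>_def)
    then show ?thesis using e3' by (simp add: \<mu>_def wn \<omega>_def)
  qed
  fix x assume x: "x \<in> S2 - {north, w}"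
  define z where "z = stereo x"
  define N where "N = (cmod z)^2 + 1"
  have N: "N \<noteq> 0" unfolding N_def by (rule cmod_sq_pos)
  have xz: "x = unstereo z" using x unstereo_stereo by (simp add: z_def)
  have cz: "complex_of_real ((cmod z)^2) = z * cnj z" by (simp only: complex_norm_square)
  have x': "complex_of_real (x$1) = (z + cnj z) / of_real N" "complex_of_real (x$2) = \<i> * (z - cnj z) / of_real N" 
      "complex_of_real (x$3) = (z * cnj z - 1) / of_real N"
    subgoal unfolding xz unstereo_nth N_def[symmetric] of_real_divide by (simp add: complex_eq_iff)
    subgoal unfolding xz unstereo_nth N_def[symmetric] of_real_divide by (simp add: complex_eq_iff)
    subgoal unfolding xz unstereo_nth N_def[symmetric] of_real_divide of_real_diff cz by simp
    done
  have zne: "z \<noteq> \<omega>" using x unstereo_stereo[of x] unstereo_stereo[of w] wS w by (auto simp: z_def \<omega>_def)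
  have num: "Complex ((B *v x)$1) (- (B *v x)$2) = E * (cnj z - cnj \<omega>) * (1 + cnj \<omega> * z) / of_real N"
  proof -
    have "Complex ((B *v x)$1) (- (B *v x)$2) = 
       Complex (B$1$1) (- B$2$1) * of_real (x$1) + Complex (B$1$2) (- B$2$2) * of_real (x$2) + e3 * of_real (x$3)"
      by (simp add: complex_eq_iff mult_vec3_nth e3_def algebra_simps)
    also have "\<dots> = ((Complex (B$1$1) (- B$2$1) + \<i> * Complex (B$1$2) (- B$2$2)) * z + (Complex (B$1$1) (- B$2$1) - \<i> * Complex (B$1$2) (- B$2$2)) * cnj z + e3 * (z * cnj z - 1)) / of_real N"
      unfolding x' by (simp add: algebra_simps add_divide_distrib diff_divide_distrib)
    also have "Complex (B$1$1) (- B$2$1) + \<i> * Complex (B$1$2) (- B$2$2) = E'" by (simp add: complex_eq_iff E'_def)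
    also have "Complex (B$1$1) (- B$2$1) - \<i> * Complex (B$1$2) (- B$2$2) = E" by (simp add: complex_eq_iff E_def)
    finally show ?thesis unfolding E'' e3' by (simp add: algebra_simps)
  qed
  have den: "of_real (1 - (B *v x)$3) = of_real \<mu> * (z - \<omega>) * (cnj z - cnj \<omega>) / of_real N"
  proof -
    have "complex_of_real ((B *v x)$3) = of_real (B$3$1) * of_real (x$1) + of_real (B$3$2) * of_real (x$2) + of_real (B$3$3) * of_real (x$3)"
      by (simp add: mult_vec3_nth)
    also have "\<dots> = ((of_real (B$3$1) + \<i> * of_real (B$3$2)) * z + (of_real (B$3$1) - \<i> * of_real (B$3$2)) * cnj z + of_real (B$3$3) * (z * cnj z - 1)) / of_real N"
      unfolding x' by (simp add: algebra_simps add_divide_distrib diff_divide_distrib)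
    also have "of_real (B$3$1) + \<i> * of_real (B$3$2) = cnj W" by (simp add: complex_eq_iff W_def)
    also have "of_real (B$3$1) - \<i> * of_real (B$3$2) = W" by (simp add: complex_eq_iff W_def)
    finally have "complex_of_real (1 - (B *v x)$3) = 1 - (cnj W * z + W * cnj z + of_real (B$3$3) * (z * cnj z - 1)) / of_real N"
      by simp
    also have "\<dots> = (of_real N - (cnj W * z + W * cnj z + of_real (B$3$3) * (z * cnj z - 1))) / of_real N"
      using N by (simp add: diff_divide_distrib)
    also have "of_real N - (cnj W * z + W * cnj z + of_real (B$3$3) * (z * cnj z - 1)) = 
       of_real \<mu> * (z * cnj z) + of_real (2 - \<mu>) - cnj W * z - W * cnj z"
      unfolding N_def \<mu>_def of_real_add cz by (simp add: algebra_simps)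
    also have "\<dots> = of_real \<mu> * (z - \<omega>) * (cnj z - cnj \<omega>)"
      unfolding ww[symmetric] W' by (simp add: algebra_simps)
    finally show ?thesis .
  qed
  have "cnj z - cnj \<omega> \<noteq> 0" using zne by (simp add: complex_cnj_diff[symmetric] del: complex_cnj_diff)
  then have "stereo (B *v x) = E * (1 + cnj \<omega> * z) / (of_real \<mu> * (z - \<omega>))"
    unfolding dn num den using N by (simp add: divide_simps)
  then show "stereo (B *v x) = E * (1 + cnj (stereo w) * stereo x) / (complex_of_real (1 - w$3) * (stereo x - stereo w))"
    by (simp add: \<omega>_def z_def \<mu>_def wn)
qed

text \<open>
  A rotation that fixes the north pole turns the plane around the origin.
\<close>

lemma stereo_rotation_axis:
  fixes B :: "real^3^3"
  assumes B: "rotation_matrix B" and w: "transpose B *v north = north"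
  obtains k where "k \<noteq> 0" "\<And>x. stereo (B *v x) = k * stereo x"
proof -
  have tr: "(transpose B *v axis i 1) $ j = B$i$j" for i j
    by (simp add: matrix_vector_mult_def transpose_def axis_def if_distrib sum.delta cong: if_cong)
  have R: "rotation_matrix (transpose B)" by (rule rotation_transpose[OF B])
  have b3: "B$3$1 = 0" "B$3$2 = 0" "B$3$3 = 1" using tr[of 3] w by (metis north_nth)+
  have c1: "cross3 (transpose B *v axis 2 1) (transpose B *v axis 3 1) = transpose B *v (axis 1 1)"
    unfolding cross_rotation_matrix[OF R] by (simp_all add: cross_basis)
  have u: "B$1$1 = B$2$2" "B$1$2 = - B$2$1" "B$1$3 = 0"
    using c1 b3 by (auto simp: vec_eq_iff forall_3 cross3_simps tr)
  have c2: "cross3 (transpose B *v axis 3 1) (transpose B *v axis 1 1) = transpose B *v (axis 2 1)"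
    unfolding cross_rotation_matrix[OF R] by (simp_all add: cross_basis)
  have v: "B$2$3 = 0" using c2 b3 by (auto simp: vec_eq_iff forall_3 cross3_simps tr)
  have "transpose B *v axis 1 1 \<in> S2" by (simp add: rotation_norm[OF R] norm_axis_1)
  then have u1: "(B$1$1)^2 + (B$1$2)^2 + (B$1$3)^2 = 1" unfolding mem_S2_iff tr .
  let ?k = "Complex (B$1$1) (- B$2$1)"
  show thesis
  proof (rule that[of ?k])
    show "?k \<noteq> 0" using u1 u by (auto simp: complex_eq_iff)
    fix x
    show "stereo (B *v x) = ?k * stereo x"
      unfolding stereo_def mult_vec3_nth b3 using u v by (simp add: complex_eq_iff diff_divide_distrib algebra_simps Re_divide_of_real Im_divide_of_real add_divide_distrib)
  qed
qed

section \<open>Which side of a closed curve in the sphere\<close>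

text \<open>
  The winding number that occurs in \<open>on_left_of\<close>. For a closed curve it is the linking number with the
  pair consisting of \<open>p\<close> and the pole, see \<open>lk_change\<close>.
\<close>

definition lk :: "real^3^3 \<Rightarrow> (real \<Rightarrow> real^3) \<Rightarrow> real^3 \<Rightarrow> complex" where
  "lk A c p = winding_number (\<lambda>t. stereo (A *v c t)) (stereo (A *v p))"

lemma lk_alt: "lk A c p = winding_number (sproj A \<circ> c) (sproj A p)"
  by (simp add: lk_def sproj_def o_def)

lemma path_sproj:
  assumes "rotation_matrix A" "A *v q = north" "path c" "path_image c \<subseteq> S2 - {q}"
  shows "path (sproj A \<circ> c)"
  using assms homeomorphism_cont1[OF homeomorphism_sproj[OF assms(1,2)]]
  by (meson continuous_on_subset path_continuous_image)

lemma inj_on_sproj: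
  assumes "rotation_matrix A" "A *v q = north" shows "inj_on (sproj A) (S2 - {q})"
  by (metis homeomorphism_apply1[OF homeomorphism_sproj[OF assms]] inj_onI)

lemma sproj_notin_path:
  assumes "rotation_matrix A" "A *v q = north" "path_image c \<subseteq> S2 - {q}" "p \<in> S2 - {q}" "p \<notin> path_image c"
  shows "sproj A p \<notin> path_image (sproj A \<circ> c)"
  using inj_on_sproj[OF assms(1,2)] assms(3-5) unfolding path_image_compose
  by (metis (no_types, lifting) inj_on_image_mem_iff)

text \<open>
  In the coordinate of the pole \<open>q0\<close>, the change to the pole \<open>q\<close> is a Moebius map whose pole is the
  coordinate of \<open>q\<close>. This is where the term \<open>lk A0 c q\<close> comes from. The three cases correspond to the
  three winding number lemmas for Moebius maps.
\<close>

lemma lk_change: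
  assumes A0: "rotation_matrix A0" "A0 *v q0 = north" and A: "rotation_matrix A" "A *v q = north"
    and c: "path c" "path_image c \<subseteq> S2 - {q0, q}" and q: "q0 \<in> S2" "q \<in> S2"
  shows lk_change_pole: "q \<noteq> q0 \<Longrightarrow> p \<in> S2 - {q0, q} \<Longrightarrow> p \<notin> path_image c \<Longrightarrow> lk A c p = lk A0 c p - lk A0 c q"
    and lk_same_pole: "q = q0 \<Longrightarrow> p \<in> S2 - {q0} \<Longrightarrow> p \<notin> path_image c \<Longrightarrow> lk A c p = lk A0 c p"
    and lk_old_pole: "q \<noteq> q0 \<Longrightarrow> lk A c q0 = - lk A0 c q"
proof -
  define B where "B = A ** transpose A0"
  have B: "rotation_matrix B" unfolding B_def by (intro rotation_mul A0 A rotation_transpose)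
  have BA: "B *v (A0 *v x) = A *v x" for x
    by (simp add: B_def matrix_vector_mul_assoc[symmetric] rotation_inverse[OF A0(1)])
  define w where "w = transpose B *v north"
  have w: "w = A0 *v q"
    using BA[of q] rotation_inverse(1)[OF B, of "A0 *v q"] A(2) by (simp add: w_def)
  define \<gamma> where "\<gamma> = sproj A0 \<circ> c"
  define \<delta> where "\<delta> = sproj A \<circ> c"
  have \<gamma>: "path \<gamma>" unfolding \<gamma>_def using c by (intro path_sproj[OF A0]) auto
  have lkA: "lk A c p = winding_number \<delta> (stereo (A *v p))" for p
    by (simp add: lk_alt \<delta>_def sproj_def)
  have lkA0: "lk A0 c p = winding_number \<gamma> (stereo (A0 *v p))" for p
    by (simp add: lk_alt \<gamma>_def sproj_def)
  have nin: "stereo (A0 *v p) \<notin> path_image \<gamma>" if "p \<in> S2 - {q0}" "p \<notin> path_image c" for p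
    using sproj_notin_path[OF A0 _ that] c(2) by (auto simp: \<gamma>_def sproj_def)
  have A0in: "A0 *v x \<in> S2 - {north, w}" if "x \<in> S2 - {q0, q}" for x
  proof -
    have "A0 *v x \<noteq> A0 *v q0" "A0 *v x \<noteq> A0 *v q"
      using that rotation_inverse(1)[OF A0(1)] by (metis DiffE insertCI)+
    then show ?thesis using that A0(2) w by (auto simp: rotation_norm[OF A0(1)])
  qed
  have cin: "c t \<in> S2 - {q0, q}" if "t \<in> {0..1}" for t
    using c(2) imageI[OF that, of c] unfolding path_image_def by blast
  have qc: "q \<notin> path_image c" using c(2) by auto
  {
    assume qq: "q \<noteq> q0"
    have wn: "w \<noteq> north" using qq w A0 rotation_inverse(1)[OF A0(1)] by metis
    define E where "E = Complex (B$1$1 - B$2$2) (- (B$1$2 + B$2$1))"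
    define m where "m = complex_of_real (1 - w$3)"
    define \<omega> where "\<omega> = stereo w"
    have E0: "E \<noteq> 0" using stereo_rotation(1)[OF B] wn by (simp add: E_def w_def)
    have m0: "m \<noteq> 0" using stereo_rotation(4)[OF B] wn by (simp add: m_def w_def of_real_eq_1_iff)
    have mob: "stereo (A *v x) = E * (1 + cnj \<omega> * stereo (A0 *v x)) / (m * (stereo (A0 *v x) - \<omega>))"
      if "x \<in> S2 - {q0, q}" for x
      using stereo_rotation(2)[OF B, of "A0 *v x"] wn A0in[OF that] unfolding BA
      by (simp add: E_def m_def \<omega>_def w_def)
    have mobn: "stereo (A *v q0) = E * cnj \<omega> / m"
      using stereo_rotation(3)[OF B] wn BA[of q0] A0(2) by (simp add: E_def m_def \<omega>_def w_def)
    have om: "\<omega> = stereo (A0 *v q)" by (simp add: \<omega>_def w)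
    have omn: "\<omega> \<notin> path_image \<gamma>" unfolding om using nin[of q] q qq qc by auto
    define L where "L = 1 + \<omega> * cnj \<omega>"
    have "L = of_real (1 + (cmod \<omega>)^2)" unfolding L_def of_real_add of_real_1 complex_norm_square ..
    then have L0: "L \<noteq> 0" by (metis add_pos_nonneg less_irrefl of_real_eq_0_iff zero_le_power2 zero_less_one)
    have ne: "stereo (A0 *v x) \<noteq> \<omega>" if "x \<in> S2 - {q0, q}" for x
      unfolding om using inj_on_sproj[OF A0] that q qq unfolding sproj_def inj_on_def by blast
    {
      fix p assume p: "p \<in> S2 - {q0, q}" "p \<notin> path_image c"
      define \<zeta> where "\<zeta> = stereo (A0 *v p)"
      have zn: "\<zeta> \<noteq> \<omega>" unfolding \<zeta>_def by (rule ne[OF p(1)])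
      show "lk A c p = lk A0 c p - lk A0 c q"
        unfolding lkA lkA0 om[symmetric] \<zeta>_def[symmetric]
      proof (rule winding_number_quotient[OF \<gamma> _ omn])
        show "\<zeta> \<notin> path_image \<gamma>" unfolding \<zeta>_def using nin p by auto
        show "- (E * L / (m * (\<zeta> - \<omega>))) \<noteq> 0" using E0 L0 m0 zn by simp
        fix t :: real assume t: "t \<in> {0..1}"
        have g: "\<gamma> t = stereo (A0 *v c t)" by (simp add: \<gamma>_def sproj_def)
        define z where "z = \<gamma> t"
        have zo: "z \<noteq> \<omega>" unfolding z_def g by (rule ne[OF cin[OF t]])
        have "\<delta> t - stereo (A *v p) = E * (1 + cnj \<omega> * z) / (m * (z - \<omega>)) - E * (1 + cnj \<omega> * \<zeta>) / (m * (\<zeta> - \<omega>))"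
          using mob[OF cin[OF t]] mob[OF p(1)] by (simp add: \<delta>_def sproj_def z_def g \<zeta>_def)
        also have "\<dots> = (E / m) * ((1 + cnj \<omega> * z) / (z - \<omega>) - (1 + cnj \<omega> * \<zeta>) / (\<zeta> - \<omega>))"
          by (simp add: right_diff_distrib)
        also have "(1 + cnj \<omega> * z) / (z - \<omega>) - (1 + cnj \<omega> * \<zeta>) / (\<zeta> - \<omega>) = - L * (z - \<zeta>) / ((z - \<omega>) * (\<zeta> - \<omega>))"
          using zo zn by (simp add: diff_frac_eq L_def algebra_simps)
        also have "(E / m) * (- L * (z - \<zeta>) / ((z - \<omega>) * (\<zeta> - \<omega>))) = - (E * L / (m * (\<zeta> - \<omega>))) * (z - \<zeta>) / (z - \<omega>)"
          by (simp add: mult_ac)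
        finally show "\<delta> t - stereo (A *v p) = - (E * L / (m * (\<zeta> - \<omega>))) * (\<gamma> t - \<zeta>) / (\<gamma> t - \<omega>)"
          by (simp add: z_def)
      qed
    }
    show "lk A c q0 = - lk A0 c q"
      unfolding lkA lkA0 om[symmetric]
    proof (rule winding_number_inverse[OF \<gamma> omn])
      show "E * L / m \<noteq> 0" using E0 L0 m0 by simp
      fix t :: real assume t: "t \<in> {0..1}"
      have g: "\<gamma> t = stereo (A0 *v c t)" by (simp add: \<gamma>_def sproj_def)
      define z where "z = \<gamma> t"
      have zo: "z \<noteq> \<omega>" unfolding z_def g by (rule ne[OF cin[OF t]])
      have "\<delta> t - stereo (A *v q0) = E * (1 + cnj \<omega> * z) / (m * (z - \<omega>)) - E * cnj \<omega> / m"
        using mob[OF cin[OF t]] mobn by (simp add: \<delta>_def sproj_def z_def g)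
      also have "\<dots> = (E / m) * ((1 + cnj \<omega> * z) / (z - \<omega>) - cnj \<omega>)"
        by (simp add: right_diff_distrib)
      also have "(1 + cnj \<omega> * z) / (z - \<omega>) - cnj \<omega> = L / (z - \<omega>)"
        using zo by (simp add: field_simps L_def)
      finally show "\<delta> t - stereo (A *v q0) = E * L / m / (\<gamma> t - \<omega>)"
        by (simp add: z_def)
    qed
  }
  {
    assume qq: "q = q0" and p: "p \<in> S2 - {q0}" "p \<notin> path_image c"
    have "w = north" using qq w A0 by simp
    then obtain k where k: "k \<noteq> 0" "\<And>x. stereo (B *v x) = k * stereo x"
      using stereo_rotation_axis[OF B] by (auto simp: w_def)
    have kk: "stereo (A *v x) = k * stereo (A0 *v x)" for x using k(2)[of "A0 *v x"] by (simp add: BA)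
    show "lk A c p = lk A0 c p"
      unfolding lkA lkA0
    proof (rule winding_number_scale[OF \<gamma> nin[OF p] k(1)])
      fix t show "\<delta> t - stereo (A *v p) = k * (\<gamma> t - stereo (A0 *v p))"
        by (simp add: \<delta>_def \<gamma>_def sproj_def kk right_diff_distrib)
    qed
  }
qed

lemma on_left_of_lk:
  "on_left_of U c \<longleftrightarrow>
    (\<forall>p\<in>U. \<forall>q\<in>S2 - (U \<union> path_image c). \<forall>A. rotation_matrix A \<and> A *v q = north \<longrightarrow> lk A c p = 1)"
  by (simp add: on_left_of_def lk_def)

text \<open>
  The definition of \<open>on_left_of\<close> refers to all poles and rotations, but by \<open>lk_change\<close> it can be checked
  with one of them. The second claim describes the same curve seen from its other side.
\<close>

lemma on_left_of_both_sides:
  assumes A0: "rotation_matrix A0" "A0 *v q0 = north"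
    and c: "path c" "path_image c \<subseteq> S2" and UV: "U \<inter> V = {}" "U \<union> V = S2 - path_image c" "q0 \<in> V"
    and lU: "\<And>p. p \<in> U \<Longrightarrow> lk A0 c p = 1" and lV: "\<And>p. p \<in> V - {q0} \<Longrightarrow> lk A0 c p = 0"
  shows "on_left_of U c"
    and "\<And>p q A. p \<in> V \<Longrightarrow> q \<in> U \<Longrightarrow> rotation_matrix A \<Longrightarrow> A *v q = north \<Longrightarrow> lk A c p = -1"
proof -
  show "on_left_of U c" unfolding on_left_of_lk
  proof (intro ballI allI impI)
    fix p q A assume p: "p \<in> U" and q: "q \<in> S2 - (U \<union> path_image c)" and A: "rotation_matrix A \<and> A *v q = north"
    have qV: "q \<in> V" using q UV by auto
    have *: "rotation_matrix A" "A *v q = north" "path c" "path_image c \<subseteq> S2 - {q0, q}" "q0 \<in> S2" "q \<in> S2"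
      using A c UV q by auto
    have p': "p \<in> S2 - {q0, q}" "p \<notin> path_image c" using p UV qV by auto
    show "lk A c p = 1"
    proof (cases "q = q0")
      case True then show ?thesis using lk_same_pole[OF A0 *, of p] p' lU[OF p] by auto
    next
      case False
      then show ?thesis using lk_change_pole[OF A0 *, of p] p' lU[OF p] lV[of q] qV by auto
    qed
  qed
  fix p q A assume p: "p \<in> V" and q: "q \<in> U" and A: "rotation_matrix A" "A *v q = north"
  have *: "rotation_matrix A" "A *v q = north" "path c" "path_image c \<subseteq> S2 - {q0, q}" "q0 \<in> S2" "q \<in> S2"
    using A c UV q by auto
  have qq: "q \<noteq> q0" using UV q by auto
  show "lk A c p = -1"
  proof (cases "p = q0")
    case True then show ?thesis using lk_old_pole[OF A0 * qq] lU[OF q] by simp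
  next
    case False
    have p': "p \<in> S2 - {q0, q}" "p \<notin> path_image c" using p UV q False by auto
    show ?thesis using lk_change_pole[OF A0 * qq p'] lV[of p] False p lU[OF q] by simp
  qed
qed

text \<open>
  By invariance of domain, interior and frontier of \<open>X\<close> correspond to the open disk and to its boundary
  circle. So the frontier is a Jordan curve. Its complement is the union of the disjoint open sets
  \<open>interior X\<close> and \<open>- X\<close>, of which the first one is connected and bounded, and this forces it to be the
  inside.
\<close>

lemma plane_disk:
  fixes X :: "complex set"
  assumes X: "X homeomorphic cball (0::real^2) 1" 
  shows "compact X" "connected X" "connected (interior X)" "interior X \<noteq> {}"
    and "inside (frontier X) = interior X" "outside (frontier X) = - X" "connected (- X)"
    and "frontier X \<subseteq> closure (interior X)" "frontier X \<subseteq> closure (- X)"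
    and "\<exists>p. simple_path p \<and> pathfinish p = pathstart p \<and> path_image p = frontier X"
proof -
  show cX: "compact X" using homeomorphic_compactness[OF X] by simp
  show "connected X" using homeomorphic_connectedness[OF X] convex_connected[OF convex_cball] by simp
  have hi: "interior X homeomorphic interior (cball (0::real^2) 1)"
    by (rule homeomorphic_interiors_same_dimension[OF X]) simp
  show ci: "connected (interior X)" using homeomorphic_connectedness[OF hi] convex_connected[OF convex_ball] by simp
  show nei: "interior X \<noteq> {}" using hi homeomorphic_empty(1)[of "interior (cball (0::real^2) 1)"]
    by (auto simp: homeomorphic_empty)
  have hf: "frontier X homeomorphic frontier (cball (0::real^2) 1)"
    by (rule homeomorphic_frontiers_same_dimension[OF X]) (use cX compact_imp_closed in auto)
  also have "frontier (cball (0::real^2) 1) = sphere 0 1" by simp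
  also have "sphere (0::real^2) 1 homeomorphic sphere (0::complex) 1"
    by (rule homeomorphic_spheres_gen) auto
  finally have "sphere (0::complex) 1 homeomorphic frontier X" using homeomorphic_sym by blast
  then obtain h k where hk: "homeomorphism (sphere (0::complex) 1) (frontier X) h k"
    unfolding homeomorphic_def by blast
  have "simple_path (h \<circ> circlepath 0 1)"
    by (rule simple_path_continuous_image)
      (use hk in \<open>auto simp: simple_path_circlepath homeomorphism_cont1 intro: inj_on_inverseI[of _ k] homeomorphism_apply1\<close>)
  moreover have "pathfinish (h \<circ> circlepath 0 1) = pathstart (h \<circ> circlepath 0 1)"
    by (simp add: pathfinish_compose pathstart_compose)
  moreover have "path_image (h \<circ> circlepath 0 1) = frontier X"
    using homeomorphism_image1[OF hk] by (simp add: path_image_compose)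
  ultimately show ex: "\<exists>p. simple_path p \<and> pathfinish p = pathstart p \<and> path_image p = frontier X" by blast
  then obtain p where p: "simple_path p" "pathfinish p = pathstart p" "path_image p = frontier X" by blast
  note J = Jordan_inside_outside[OF p(1,2), unfolded p(3)]
  have clX: "closed X" using cX compact_imp_closed by blast
  have un: "inside (frontier X) \<union> outside (frontier X) = interior X \<union> - X"
    unfolding inside_Un_outside frontier_def closure_closed[OF clX] using interior_subset by auto
  have cut: "S \<subseteq> interior X \<or> S \<subseteq> - X" if "connected S" "S \<subseteq> interior X \<union> - X" for S
  proof -
    have "interior X \<inter> S = {} \<or> - X \<inter> S = {}"
      by (rule connectedD[OF that(1) _ _ _ that(2)]) (use clX interior_subset[of X] in auto)
    then show ?thesis using that(2) by auto
  qed
  have cut2: "S \<subseteq> inside (frontier X) \<or> S \<subseteq> outside (frontier X)" if "connected S" "S \<subseteq> interior X \<union> - X" for S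
  proof -
    have "inside (frontier X) \<inter> S = {} \<or> outside (frontier X) \<inter> S = {}"
      by (rule connectedD[OF that(1)]) (use J that(2) un in auto)
    moreover have "S \<subseteq> inside (frontier X) \<union> outside (frontier X)" using that(2) unfolding un .
    ultimately show ?thesis by blast
  qed
  have bi: "bounded (interior X)" using cX compact_imp_bounded bounded_subset interior_subset by metis
  have i1: "interior X \<subseteq> inside (frontier X)"
  proof (rule ccontr)
    assume "\<not> ?thesis"
    then have io: "interior X \<subseteq> outside (frontier X)" using cut2[OF ci] by auto
    have "outside (frontier X) \<subseteq> interior X \<or> outside (frontier X) \<subseteq> - X"
      using cut J un by (metis Un_upper2)
    then have "outside (frontier X) \<subseteq> interior X" using io nei interior_subset[of X] by blast
    then show False using J bi bounded_subset by blast
  qed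
  have "inside (frontier X) \<subseteq> interior X \<or> inside (frontier X) \<subseteq> - X"
    using cut J un by (metis Un_upper1)
  then have i2: "inside (frontier X) \<subseteq> interior X" using i1 nei interior_subset[of X] by blast
  show ins: "inside (frontier X) = interior X" using i1 i2 by auto
  then show out: "outside (frontier X) = - X"
    using un inside_Int_outside[of "frontier X"] interior_subset[of X] by blast
  show "connected (- X)" using J out by auto
  have "frontier (interior X) = frontier X" using J ins by auto
  then show "frontier X \<subseteq> closure (interior X)" by (metis Diff_subset frontier_def)
  show "frontier X \<subseteq> closure (- X)" by (simp add: frontier_closures)
qed

section \<open>Disks of a CaTherine wheel and their two boundary arcs\<close>

lemma arc_continuous_image:
  assumes "arc p" "continuous_on (path_image p) f" "inj_on f (path_image p)"
  shows "arc (f \<circ> p)"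
  using assms unfolding arc_def path_image_def
  by (metis comp_inj_on path_continuous_image path_image_def)

lemma cis_image_period: "cis ` {a..a + 2 * pi} = S1"
proof
  show "cis ` {a..a + 2 * pi} \<subseteq> S1" by auto
  show "S1 \<subseteq> cis ` {a..a + 2 * pi}"
  proof
    fix z :: complex assume "z \<in> S1"
    then have z: "z = cis (Arg z)" using rcis_cmod_Arg[of z] by (simp add: rcis_def)
    define k where "k = \<lceil>(a - Arg z) / (2 * pi)\<rceil>"
    have k: "(a - Arg z) / (2 * pi) \<le> k" "k < (a - Arg z) / (2 * pi) + 1" unfolding k_def by linarith+
    have "a - Arg z \<le> k * (2 * pi)" using k(1) by (simp add: field_simps)
    moreover have "k * (2 * pi) < a - Arg z + 2 * pi" using k(2) by (simp add: field_simps)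
    ultimately have "Arg z + k * (2 * pi) \<in> {a..a + 2 * pi}" by auto
    moreover have "cis (Arg z + k * (2 * pi)) = z"
      using cis_multiple_2pi[of "of_int k"] z by (simp add: cis_mult[symmetric] mult.commute)
    ultimately show "z \<in> cis ` {a..a + 2 * pi}" by (metis imageI)
  qed
qed

locale wheel =
  fixes f :: "complex \<Rightarrow> real^3"
  assumes wheel: "catherine_wheel f"
begin

definition F :: "real \<Rightarrow> real^3" where "F t = f (cis t)"

definition D :: "real \<Rightarrow> real \<Rightarrow> (real^3) set" where "D a b = F ` {a..b}"

lemma image_interval: "f ` circ_interval a b = D a b"
  by (auto simp: circ_interval_def D_def F_def)

lemma F_period: "F (t + 2 * pi) = F t"
  by (simp add: F_def cis_mult[symmetric])

lemma D_period: "D (a + 2 * pi) (b + 2 * pi) = D a b"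
proof -
  have "{a + 2 * pi..b + 2 * pi} = (\<lambda>t. t + 2 * pi) ` {a..b}" by (simp add: image_add_atLeastAtMost')
  then show ?thesis unfolding D_def by (simp only: image_image F_period)
qed

lemma continuous_F: "continuous_on S F"
proof -
  have "continuous_on S (f \<circ> cis)"
  proof (rule continuous_on_compose)
    show "continuous_on S cis" by (intro continuous_intros)
    show "continuous_on (cis ` S) f"
      using wheel unfolding catherine_wheel_def by (auto intro: continuous_on_subset)
  qed
  then show ?thesis by (simp add: F_def[abs_def] o_def)
qed

lemma D_full: "D a (a + 2 * pi) = S2"
  using wheel cis_image_period[of a] unfolding D_def F_def catherine_wheel_def by (metis image_image)

lemma F_in_S2: "F t \<in> S2"
  using D_full[of t] by (metis D_def atLeastAtMost_iff image_eqI le_add_same_cancel1 order_refl pi_ge_zero zero_le_mult_iff zero_le_numeral)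

lemma D_subset_S2: "D a b \<subseteq> S2"
  using F_in_S2 by (auto simp: D_def)

lemma compact_D: "compact (D a b)"
  unfolding D_def by (intro compact_continuous_image continuous_F) auto

lemma closed_D: "closed (D a b)"
  by (rule compact_imp_closed[OF compact_D])

lemma D_mono: "a' \<le> a \<Longrightarrow> b \<le> b' \<Longrightarrow> D a b \<subseteq> D a' b'"
  unfolding D_def by (intro image_mono) auto

lemma D_split: "a \<le> c \<Longrightarrow> c \<le> b \<Longrightarrow> D a b = D a c \<union> D c b"
  unfolding D_def image_Un[symmetric] by (simp add: ivl_disj_un)

lemma D_ends: "a \<le> b \<Longrightarrow> F a \<in> D a b" "a \<le> b \<Longrightarrow> F b \<in> D a b"
  by (auto simp: D_def)

lemma D_disk: "a < b \<Longrightarrow> b < a + 2 * pi \<Longrightarrow> D a b homeomorphic cball (0::real^2) 1"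
  using wheel unfolding catherine_wheel_def image_interval by blast

lemma F_bdry: "a < b \<Longrightarrow> b < a + 2 * pi \<Longrightarrow> F a \<in> bdry (D a b)" "a < b \<Longrightarrow> b < a + 2 * pi \<Longrightarrow> F b \<in> bdry (D a b)"
  using wheel unfolding catherine_wheel_def image_interval F_def by blast+

lemma bdry_eq_diff: "bdry (D a b) = D a b - intr (D a b)"
proof -
  have "closedin (top_of_set S2) (D a b)"
    using closed_D D_subset_S2 by (metis closed_subset)
  then show ?thesis by (simp add: bdry_def intr_def frontier_of_def closure_of_closedin)
qed

lemma intr_subset: "intr (D a b) \<subseteq> D a b"
  by (simp add: intr_def interior_of_subset)

lemma D_complement_Un: "a \<le> b \<Longrightarrow> b \<le> a + 2 * pi \<Longrightarrow> D a b \<union> D b (a + 2 * pi) = S2"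
  using D_split[of a b "a + 2 * pi"] D_full by simp

text \<open>
  A time \<open>t\<close> outside the interval is an end of the longer interval from \<open>a\<close> to \<open>t\<close>. So \<open>F t\<close> is on the
  boundary of \<open>D a t\<close> and cannot be interior to the smaller set \<open>D a b\<close>.
\<close>

lemma intr_eq: 
  assumes "a < b" "b < a + 2 * pi"
  shows "intr (D a b) = S2 - D b (a + 2 * pi)"
proof
  have "F t \<notin> intr (D a b)" if t: "b \<le> t" "t \<le> a + 2 * pi" for t
  proof (cases "t = a + 2 * pi")
    case True
    then show ?thesis using F_bdry(1)[OF assms] F_period[of a] by (auto simp: bdry_eq_diff)
  next
    case False
    then have "F t \<in> bdry (D a t)" using t assms by (intro F_bdry) auto
    moreover have "intr (D a b) \<subseteq> intr (D a t)" unfolding intr_def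
      by (intro interior_of_mono D_mono) (use t in auto)
    ultimately show ?thesis by (auto simp: bdry_eq_diff)
  qed
  then show "intr (D a b) \<subseteq> S2 - D b (a + 2 * pi)"
    using intr_subset D_subset_S2 by (fastforce simp: D_def[of b])
  have "openin (top_of_set S2) (S2 - D b (a + 2 * pi))"
    using closed_D D_subset_S2 by (metis closed_subset openin_diff openin_subtopology_self topspace_euclidean_subtopology openin_closedin_eq closedin_def)
  then show "S2 - D b (a + 2 * pi) \<subseteq> intr (D a b)" unfolding intr_def
    using D_complement_Un[of a b] assms by (intro interior_of_maximal) auto
qed

lemma bdry_eq: 
  assumes "a < b" "b < a + 2 * pi"
  shows "bdry (D a b) = D a b \<inter> D b (a + 2 * pi)"
  unfolding bdry_eq_diff intr_eq[OF assms] using D_subset_S2 by blast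

lemma complement_bounds:
  assumes "a < b" "b < a + 2 * pi" shows "b < a + 2 * pi" "a + 2 * pi < b + 2 * pi"
  using assms by auto

lemma intr_complement:
  assumes "a < b" "b < a + 2 * pi"
  shows "intr (D b (a + 2 * pi)) = S2 - D a b"
  using intr_eq[OF complement_bounds[OF assms]] by (simp add: D_period)

lemma bdry_complement:
  assumes "a < b" "b < a + 2 * pi"
  shows "bdry (D b (a + 2 * pi)) = bdry (D a b)"
  using bdry_eq[OF complement_bounds[OF assms]] bdry_eq[OF assms] by (auto simp: D_period)

lemma bdry_subset_S2: "bdry (D a b) \<subseteq> S2"
  using D_subset_S2 by (auto simp: bdry_eq_diff)

lemma complement_nonempty:
  assumes "a < b" "b < a + 2 * pi"
  shows "S2 - D a b \<noteq> {}"
proof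
  assume "S2 - D a b = {}"
  then have "D a b = S2" using D_subset_S2 by blast
  then have "intr (D a b) = S2" unfolding intr_def by (metis interior_of_topspace topspace_euclidean_subtopology)
  then show False using F_bdry(1)[OF assms] F_in_S2 by (auto simp: bdry_eq_diff)
qed

lemma infinite_D: assumes "a < b" shows "infinite (D a b)"
proof -
  define c where "c = min b (a + pi)"
  have "c \<le> a + pi" unfolding c_def by (rule min.cobounded2)
  then have "c < a + 2 * pi" using pi_gt_zero by linarith
  then have c: "a < c" "c < a + 2 * pi" "c \<le> b" using assms by (auto simp: c_def)
  have "infinite (cball (0::real^2) 1)" by (rule uncountable_infinite[OF uncountable_cball]) simp
  then have "infinite (D a c)" using D_disk[OF c(1,2)] unfolding homeomorphic_def homeomorphism_def by (metis finite_imageI)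
  then show ?thesis using D_mono[of a a c b] c finite_subset by blast
qed

lemma disk_in_plane:
  assumes ab: "a < b" "b < a + 2 * pi" and A: "rotation_matrix A" "A *v q = north" and q: "q \<in> S2 - D a b"
  defines "X \<equiv> sproj A ` D a b"
  shows "X homeomorphic cball (0::real^2) 1" "interior X = sproj A ` intr (D a b)" "frontier X = sproj A ` bdry (D a b)"
    "- X = sproj A ` (S2 - D a b - {q})"
proof -
  let ?\<psi> = "\<lambda>z. transpose A *v unstereo z"
  note H = homeomorphism_sproj[OF A]
  have sub: "D a b \<subseteq> S2 - {q}" using D_subset_S2 q by auto
  have "homeomorphism (D a b) X (sproj A) ?\<psi>"
    by (rule homeomorphism_of_subsets[OF H sub]) (auto simp: X_def)
  then have DX: "X homeomorphic D a b" using homeomorphic_def homeomorphic_sym by blast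
  then show "X homeomorphic cball (0::real^2) 1" using D_disk[OF ab] homeomorphic_trans by blast
  have clX: "closed X" using homeomorphic_compactness[OF DX] compact_D compact_imp_closed by blast
  show int: "interior X = sproj A ` intr (D a b)"
  proof
    have "openin (top_of_set (S2 - {q})) (intr (D a b))"
    proof (rule openin_subset_trans)
      show "openin (top_of_set S2) (intr (D a b))" by (simp add: intr_def)
    qed (use sub intr_subset in auto)
    then have "open (sproj A ` intr (D a b))"
      using homeomorphism_imp_open_map[OF H] by fastforce
    then show "sproj A ` intr (D a b) \<subseteq> interior X"
      by (rule interior_maximal[rotated]) (use intr_subset in \<open>auto simp: X_def\<close>)
    have "openin (top_of_set (S2 - {q})) (?\<psi> ` interior X)"
      using homeomorphism_imp_open_map[OF homeomorphism_symD[OF H], of "interior X"] by simp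
    moreover have "openin (top_of_set S2) (S2 - {q})" by (simp add: openin_delete)
    ultimately have "openin (top_of_set S2) (?\<psi> ` interior X)" using openin_trans by blast
    moreover have "?\<psi> ` interior X \<subseteq> D a b"
    proof
      fix y assume "y \<in> ?\<psi> ` interior X"
      then obtain x where "x \<in> D a b" "y = ?\<psi> (sproj A x)" using interior_subset by (auto simp: X_def)
      moreover have "?\<psi> (sproj A x) = x" using homeomorphism_apply1[OF H] sub \<open>x \<in> D a b\<close> by blast
      ultimately show "y \<in> D a b" by (simp only:)
    qed
    ultimately have "?\<psi> ` interior X \<subseteq> intr (D a b)" unfolding intr_def by (intro interior_of_maximal)
    then have "sproj A ` ?\<psi> ` interior X \<subseteq> sproj A ` intr (D a b)" by (rule image_mono)
    then show "interior X \<subseteq> sproj A ` intr (D a b)" using homeomorphism_apply2[OF H] by (simp add: image_image)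
  qed
  have inj: "inj_on (sproj A) (D a b)" by (rule inj_on_subset[OF inj_on_sproj[OF A] sub])
  show "frontier X = sproj A ` bdry (D a b)"
    unfolding frontier_def closure_closed[OF clX] int unfolding X_def bdry_eq_diff
    by (rule inj_on_image_set_diff[OF inj, symmetric]) (use intr_subset in auto)
  have "sproj A ` (S2 - {q} - D a b) = sproj A ` (S2 - {q}) - sproj A ` D a b"
    by (rule inj_on_image_set_diff[OF inj_on_sproj[OF A]]) (use sub in auto)
  then show "- X = sproj A ` (S2 - D a b - {q})"
    unfolding homeomorphism_image1[OF H] X_def Compl_eq_Diff_UNIV by (metis Diff_insert2 Diff_insert)
qed

text \<open>
  Translates the labelling of the arcs into winding numbers in the plane. They vanish off the disk,
  which is the outside of the boundary curve.
\<close>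

lemma right_left_arcs_in_plane:
  assumes ab: "a < b" "b < a + 2 * pi" and A: "rotation_matrix A" "A *v q = north" and q: "q \<in> S2 - D a b"
    and rl: "right_left_arcs f a b g h"
  defines "X \<equiv> sproj A ` D a b" and "G \<equiv> sproj A \<circ> g" and "H \<equiv> sproj A \<circ> h"
  shows "arc G" "arc H" "pathstart G = sproj A (F a)" "pathfinish G = sproj A (F b)"
    "pathstart H = sproj A (F a)" "pathfinish H = sproj A (F b)"
    "path_image G \<inter> path_image H = {sproj A (F a), sproj A (F b)}"
    "path_image G \<union> path_image H = frontier X"
    "\<And>z. z \<in> interior X \<Longrightarrow> winding_number G z - winding_number H z = 1"
    "\<And>z. z \<in> - X \<Longrightarrow> winding_number G z - winding_number H z = 0"
    "\<And>p. p \<in> S2 - bdry (D a b) - {q} \<Longrightarrow> lk A (g +++ reversepath h) p = winding_number G (sproj A p) - winding_number H (sproj A p)"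
proof -
  note rl' = rl[unfolded right_left_arcs_def image_interval F_def[symmetric]]
  have un: "path_image g \<union> path_image h = bdry (D a b)" using rl' by blast
  have bq: "bdry (D a b) \<subseteq> S2 - {q}" using q D_subset_S2 by (auto simp: bdry_eq_diff)
  have sub: "path_image g \<subseteq> S2 - {q}" "path_image h \<subseteq> S2 - {q}" using un bq by auto
  have cont: "continuous_on (S2 - {q}) (sproj A)" by (rule homeomorphism_cont1[OF homeomorphism_sproj[OF A]])
  have inj: "inj_on (sproj A) (S2 - {q})" by (rule inj_on_sproj[OF A])
  show arcs: "arc G" "arc H" unfolding G_def H_def using rl' sub cont inj
    by (auto intro!: arc_continuous_image intro: continuous_on_subset inj_on_subset)
  show ends: "pathstart G = sproj A (F a)" "pathfinish G = sproj A (F b)"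
    "pathstart H = sproj A (F a)" "pathfinish H = sproj A (F b)"
    using rl' by (simp_all add: G_def H_def pathstart_compose pathfinish_compose)
  have im: "path_image G = sproj A ` path_image g" "path_image H = sproj A ` path_image h"
    by (simp_all add: G_def H_def path_image_compose)
  show "path_image G \<inter> path_image H = {sproj A (F a), sproj A (F b)}"
    unfolding im using inj_on_image_Int[OF inj sub] rl' by (metis image_empty image_insert)
  note dp = disk_in_plane[OF ab A q, folded X_def]
  show fr: "path_image G \<union> path_image H = frontier X"
    unfolding im dp(3) using un by (metis image_Un)
  have wj: "winding_number (G +++ reversepath H) z = winding_number G z - winding_number H z"
    if "z \<notin> path_image G \<union> path_image H" for z
    using that arcs ends by (simp add: winding_number_join winding_number_reversepath arc_imp_path)
  show lkp: "lk A (g +++ reversepath h) p = winding_number G (sproj A p) - winding_number H (sproj A p)"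
    if "p \<in> S2 - bdry (D a b) - {q}" for p
  proof -
    have "lk A (g +++ reversepath h) p = winding_number (G +++ reversepath H) (sproj A p)"
      by (simp add: lk_alt path_compose_join path_compose_reversepath G_def H_def)
    also have "sproj A p \<notin> path_image G \<union> path_image H"
      unfolding fr dp(3) using inj_on_image_mem_iff[OF inj, of p "bdry (D a b)"] that bq by auto
    then have "winding_number (G +++ reversepath H) (sproj A p) = winding_number G (sproj A p) - winding_number H (sproj A p)"
      by (rule wj)
    finally show ?thesis .
  qed
  show "winding_number G z - winding_number H z = 1" if z: "z \<in> interior X" for z
  proof -
    obtain p where p: "p \<in> intr (D a b)" "z = sproj A p" using z unfolding dp(2) by auto
    have pD: "p \<in> D a b" "p \<in> S2" using p intr_subset D_subset_S2 by blast+
    then have pS: "p \<in> S2 - bdry (D a b) - {q}" using p q by (auto simp: bdry_eq_diff)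
    have pc: "path_image (g +++ reversepath h) = bdry (D a b)" using rl' by (simp add: path_image_join)
    have "q \<in> S2 - (intr (D a b) \<union> path_image (g +++ reversepath h))"
      unfolding pc using q intr_subset by (auto simp: bdry_eq_diff)
    then have "lk A (g +++ reversepath h) p = 1"
      using rl' p A unfolding on_left_of_lk by blast
    then show ?thesis using lkp[OF pS] p by simp
  qed
  show "winding_number G z - winding_number H z = 0" if "z \<in> - X" for z
  proof -
    have z: "z \<in> outside (frontier X)" using plane_disk(6)[OF dp(1)] that by simp
    have pi: "path_image (G +++ reversepath H) = frontier X" using fr ends by (simp add: path_image_join)
    have "winding_number (G +++ reversepath H) z = 0"
      by (rule winding_number_zero_in_outside) (use arcs ends z pi in \<open>auto simp: arc_imp_path\<close>)
    moreover have "z \<notin> path_image G \<union> path_image H" unfolding fr using z outside_no_overlap by blast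
    ultimately show ?thesis using wj by simp
  qed
qed

text \<open>
  The boundary curve winds once around its inside, in one direction or in the other. Accordingly the two
  arcs between \<open>F a\<close> and \<open>F b\<close> are labelled.
\<close>

lemma right_left_arcs_exist:
  assumes ab: "a < b" "b < a + 2 * pi" and ne: "F a \<noteq> F b"
  shows "\<exists>g h. right_left_arcs f a b g h"
proof -
  obtain q where q: "q \<in> S2 - D a b" using complement_nonempty[OF ab] by blast
  then obtain A where A: "rotation_matrix A" "A *v q = north" using rotation_to_north by blast
  let ?\<psi> = "\<lambda>z. transpose A *v unstereo z"
  note H = homeomorphism_sproj[OF A]
  define X where "X = sproj A ` D a b"
  note dp = disk_in_plane[OF ab A q, folded X_def]
  note pd = plane_disk[OF dp(1)]
  obtain p where p: "simple_path p" "pathfinish p = pathstart p" "path_image p = frontier X" using pd(10) by blast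
  have bS: "bdry (D a b) \<subseteq> S2 - {q}" using q D_subset_S2 by (auto simp: bdry_eq_diff)
  have FS: "F a \<in> S2 - {q}" "F b \<in> S2 - {q}" using bS F_bdry[OF ab] by auto
  have ne': "sproj A (F a) \<noteq> sproj A (F b)"
    using inj_on_sproj[OF A] FS ne by (auto simp: inj_on_def)
  have in_fr: "sproj A (F a) \<in> path_image p" "sproj A (F b) \<in> path_image p"
    using F_bdry[OF ab] p dp(3) by auto
  obtain u d where ud: "arc u" "arc d" "pathstart u = sproj A (F a)" "pathfinish u = sproj A (F b)"
       "pathstart d = sproj A (F b)" "pathfinish d = sproj A (F a)"
       "path_image u \<inter> path_image d = {sproj A (F a), sproj A (F b)}"
       "path_image u \<union> path_image d = path_image p"
    using exists_double_arc[OF p(1,2) in_fr ne'] by metis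
  have "\<exists>u1 u2. arc u1 \<and> arc u2 \<and> pathstart u1 = sproj A (F a) \<and> pathfinish u1 = sproj A (F b)
      \<and> pathstart u2 = sproj A (F a) \<and> pathfinish u2 = sproj A (F b)
      \<and> path_image u1 \<inter> path_image u2 = {sproj A (F a), sproj A (F b)}
      \<and> path_image u1 \<union> path_image u2 = frontier X
      \<and> (\<forall>z\<in>interior X. winding_number (u1 +++ reversepath u2) z = 1)"
  proof -
    have sp: "simple_path (u +++ d)" using ud by (intro simple_path_join_loop) auto
    have pi: "path_image (u +++ d) = frontier X" using ud p by (simp add: path_image_join)
    consider "\<And>z. z \<in> interior X \<Longrightarrow> winding_number (u +++ d) z = 1"
      | "\<And>z. z \<in> interior X \<Longrightarrow> winding_number (u +++ d) z = -1"
      using simple_closed_path_winding_number_inside[OF sp] unfolding pi pd(5) by metis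
    then show ?thesis
    proof cases
      case 1
      then show ?thesis using ud p
        by (intro exI[of _ u] exI[of _ "reversepath d"]) (auto simp: arc_reversepath)
    next
      case 2
      have "winding_number (reversepath d +++ reversepath u) z = 1" if z: "z \<in> interior X" for z
      proof -
        have "z \<notin> path_image (u +++ d)" unfolding pi using z by (auto simp: frontier_def)
        then have "winding_number (reversepath (u +++ d)) z = 1"
          using 2[OF z] sp by (simp add: winding_number_reversepath simple_path_imp_path)
        then show ?thesis using ud by (simp add: reversepath_joinpaths)
      qed
      then show ?thesis using ud p
        by (intro exI[of _ "reversepath d"] exI[of _ u]) (auto simp: arc_reversepath)
    qed
  qed
  then obtain u1 u2 where u: "arc u1" "arc u2" "pathstart u1 = sproj A (F a)" "pathfinish u1 = sproj A (F b)"
      "pathstart u2 = sproj A (F a)" "pathfinish u2 = sproj A (F b)"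
      "path_image u1 \<inter> path_image u2 = {sproj A (F a), sproj A (F b)}"
      "path_image u1 \<union> path_image u2 = frontier X"
      "\<And>z. z \<in> interior X \<Longrightarrow> winding_number (u1 +++ reversepath u2) z = 1" by metis
  define g where "g = ?\<psi> \<circ> u1"
  define h where "h = ?\<psi> \<circ> u2"
  have cpsi: "continuous_on S ?\<psi>" for S using homeomorphism_cont2[OF H] continuous_on_subset by blast
  have ipsi: "inj_on ?\<psi> S" for S by (rule inj_on_inverseI[where g = "sproj A"]) (rule homeomorphism_apply2[OF H UNIV_I])
  have arcs: "arc g" "arc h" unfolding g_def h_def using u by (auto intro!: arc_continuous_image cpsi ipsi)
  have unproj: "?\<psi> (sproj A x) = x" if "x \<in> S2 - {q}" for x using homeomorphism_apply1[OF H that] .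
  have ends: "pathstart g = F a" "pathfinish g = F b" "pathstart h = F a" "pathfinish h = F b"
    unfolding g_def h_def using u FS unproj by (simp_all add: pathstart_compose pathfinish_compose)
  have im: "path_image g = ?\<psi> ` path_image u1" "path_image h = ?\<psi> ` path_image u2"
    by (simp_all add: g_def h_def path_image_compose)
  have int: "path_image g \<inter> path_image h = {F a, F b}"
    unfolding im image_Int[OF ipsi[of UNIV], symmetric] u(7) using unproj FS by simp
  have un: "path_image g \<union> path_image h = bdry (D a b)"
  proof -
    have "path_image g \<union> path_image h = ?\<psi> ` sproj A ` bdry (D a b)"
      unfolding im image_Un[symmetric] u(8) dp(3) ..
    also have "\<dots> = bdry (D a b)" using unproj bS by (force simp: image_image)
    finally show ?thesis .
  qed
  define c where "c = g +++ reversepath h"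
  have c: "path c" "path_image c = bdry (D a b)"
    using arcs ends un by (auto simp: c_def arc_imp_path path_image_join)
  have gu: "sproj A \<circ> g = u1" "sproj A \<circ> h = u2"
    unfolding g_def h_def o_def using homeomorphism_apply2[OF H] by simp_all
  have lkc: "lk A c p = winding_number (u1 +++ reversepath u2) (sproj A p)" for p
    unfolding c_def by (simp add: lk_alt path_compose_join path_compose_reversepath gu)
  have "on_left_of (intr (D a b)) c"
  proof (rule on_left_of_both_sides(1)[OF A c(1), where V = "S2 - D a b"])
    show "path_image c \<subseteq> S2" using c bS by auto
    show "intr (D a b) \<inter> (S2 - D a b) = {}" using intr_subset by auto
    show "intr (D a b) \<union> (S2 - D a b) = S2 - path_image c"
      unfolding c bdry_eq_diff using intr_subset D_subset_S2 by blast
    show "q \<in> S2 - D a b" by (rule q)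
    show "lk A c p = 1" if "p \<in> intr (D a b)" for p
      unfolding lkc using that dp(2) u(9) by blast
    show "lk A c p = 0" if "p \<in> S2 - D a b - {q}" for p
    proof -
      have "sproj A p \<in> - X" unfolding dp(4) using that by blast
      then have "sproj A p \<in> outside (path_image (u1 +++ reversepath u2))"
        using pd(6) u by (simp add: path_image_join)
      then show ?thesis unfolding lkc
        using u by (intro winding_number_zero_in_outside) (auto simp: arc_imp_path)
    qed
  qed
  then have "right_left_arcs f a b g h"
    unfolding right_left_arcs_def image_interval F_def[symmetric] c_def
    using arcs ends int un by blast
  then show ?thesis by blast
qed

text \<open>
  Seen from the complementary disk, the boundary curve runs in the opposite direction. The interchange
  of initial and final end compensates for this.
\<close>

lemma right_left_arcs_complement:
  assumes ab: "a < b" "b < a + 2 * pi" and rl: "right_left_arcs f a b g h"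
  shows "right_left_arcs f b (a + 2 * pi) (reversepath g) (reversepath h)"
proof -
  note rl' = rl[unfolded right_left_arcs_def image_interval F_def[symmetric]]
  define c where "c = g +++ reversepath h"
  have c: "path c" "path_image c = bdry (D a b)"
    using rl' by (auto simp: c_def arc_imp_path path_image_join)
  obtain q0 where q0: "q0 \<in> S2 - D a b" using complement_nonempty[OF ab] by blast
  then obtain A0 where A0: "rotation_matrix A0" "A0 *v q0 = north" using rotation_to_north by blast
  note pl = right_left_arcs_in_plane[OF ab A0 q0 rl, folded c_def]
  note dp = disk_in_plane[OF ab A0 q0]
  have neg: "lk A c p = -1" if "p \<in> S2 - D a b" "q \<in> intr (D a b)" "rotation_matrix A" "A *v q = north" for p q A
  proof (rule on_left_of_both_sides(2)[OF A0 c(1) _ _ _ _ _ _ that])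
    show "path_image c \<subseteq> S2" using c bdry_subset_S2 by auto
    show "intr (D a b) \<inter> (S2 - D a b) = {}" using intr_subset by auto
    show "intr (D a b) \<union> (S2 - D a b) = S2 - path_image c"
      unfolding c bdry_eq_diff using intr_subset D_subset_S2 by blast
    show "q0 \<in> S2 - D a b" by (rule q0)
    show "lk A0 c p = 1" if p: "p \<in> intr (D a b)" for p
    proof -
      have "p \<in> D a b" "p \<in> S2" using p intr_subset D_subset_S2 by blast+
      then have "p \<in> S2 - bdry (D a b) - {q0}" using p q0 by (auto simp: bdry_eq_diff)
      moreover have "sproj A0 p \<in> interior (sproj A0 ` D a b)" using p dp(2) by blast
      ultimately show ?thesis using pl(9,11) by simp
    qed
    show "lk A0 c p = 0" if p: "p \<in> S2 - D a b - {q0}" for p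
    proof -
      have "p \<in> S2 - bdry (D a b) - {q0}" using p by (auto simp: bdry_eq_diff)
      moreover have "sproj A0 p \<in> - (sproj A0 ` D a b)" using p dp(4) by blast
      ultimately show ?thesis using pl(10,11) by simp
    qed
  qed
  define c' where "c' = reversepath g +++ h"
  have c': "path_image c' = bdry (D a b)" using rl' by (auto simp: c'_def path_image_join)
  have "on_left_of (S2 - D a b) c'"
    unfolding on_left_of_lk c'
  proof (intro ballI allI impI)
    fix p q A assume p: "p \<in> S2 - D a b" and q: "q \<in> S2 - (S2 - D a b \<union> bdry (D a b))"
      and A: "rotation_matrix A \<and> A *v q = north"
    have qi: "q \<in> intr (D a b)" using q by (auto simp: bdry_eq_diff)
    have "path_image g \<union> path_image h = bdry (D a b)" using rl' by blast
    then have sub: "path_image g \<subseteq> S2 - {q}" "path_image h \<subseteq> S2 - {q}" "p \<notin> path_image g" "p \<notin> path_image h"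
      using q p bdry_subset_S2 by (auto simp: bdry_eq_diff)
    have ps: "path (sproj A \<circ> g)" "path (sproj A \<circ> h)"
      using path_sproj[of A q g] path_sproj[of A q h] A sub rl' arc_imp_path by blast+
    have pq: "p \<in> S2 - {q}" using p qi intr_subset by auto
    have nin: "sproj A p \<notin> path_image (sproj A \<circ> g)" "sproj A p \<notin> path_image (sproj A \<circ> h)"
      using sproj_notin_path[of A q g p] sproj_notin_path[of A q h p] A sub pq by blast+
    have j1: "pathfinish (sproj A \<circ> g) = pathstart (reversepath (sproj A \<circ> h))"
      "pathfinish (reversepath (sproj A \<circ> g)) = pathstart (sproj A \<circ> h)"
      using rl' by (simp_all add: pathfinish_compose pathstart_compose)
    have "lk A c p = winding_number (sproj A \<circ> g) (sproj A p) - winding_number (sproj A \<circ> h) (sproj A p)"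
      unfolding c_def lk_alt path_compose_join path_compose_reversepath
      using ps nin j1 by (simp add: winding_number_join winding_number_reversepath)
    moreover have "lk A c' p = - winding_number (sproj A \<circ> g) (sproj A p) + winding_number (sproj A \<circ> h) (sproj A p)"
      unfolding c'_def lk_alt path_compose_join path_compose_reversepath
      using ps nin j1 by (simp add: winding_number_join winding_number_reversepath)
    ultimately have "lk A c' p = - lk A c p" by simp
    then show "lk A c' p = 1" using neg[OF p qi] A by simp
  qed
  then show ?thesis
    unfolding right_left_arcs_def image_interval F_def[symmetric] F_period bdry_complement[OF ab] intr_complement[OF ab]
    using rl' by (auto simp: arc_reversepath c'_def)
qed

text \<open>
  Seen from a point \<open>q\<close> off the union of the two disks, they are plane disks. Their union is again a disk
  and has a connected complement, so by Janiszewski's theorem their intersection is connected. It lies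
  in both boundary curves and contains \<open>F c\<close>. The points \<open>F a\<close> and \<open>F b\<close> lie on the boundary of the union.
\<close>

lemma adjacent_arcs_disjoint:
  assumes ac: "a < c" and cb: "c < b" and ba: "b < a + 2 * pi"
    and rl: "right_left_arcs f a c g h" and rl2: "right_left_arcs f c b g' h'"
  shows "path_image g \<inter> path_image h' \<subseteq> {F a, F c, F b}" "path_image h \<inter> path_image g' \<subseteq> {F a, F c, F b}"
proof -
  have ac': "c < a + 2 * pi" and cb': "b < c + 2 * pi" and ab: "a < b" using assms by auto
  obtain q where q: "q \<in> S2 - D a b" using complement_nonempty[OF ab ba] by blast
  then obtain A where A: "rotation_matrix A" "A *v q = north" using rotation_to_north by blast
  have Dab: "D a b = D a c \<union> D c b" using D_split ac cb by auto
  have q1: "q \<in> S2 - D a c" and q2: "q \<in> S2 - D c b" using q Dab by auto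
  define X where "X = sproj A ` D a b"
  define X1 where "X1 = sproj A ` D a c"
  define X2 where "X2 = sproj A ` D c b"
  have XX: "X = X1 \<union> X2" by (simp add: X_def X1_def X2_def Dab image_Un)
  note dp = disk_in_plane[OF ab ba A q, folded X_def]
  note dp1 = disk_in_plane[OF ac ac' A q1, folded X1_def]
  note dp2 = disk_in_plane[OF cb cb' A q2, folded X2_def]
  note pd = plane_disk[OF dp(1)]
  note pd1 = plane_disk[OF dp1(1)]
  note pd2 = plane_disk[OF dp2(1)]
  define M where "M = X1 \<inter> X2"
  have inj: "inj_on (sproj A) (S2 - {q})" by (rule inj_on_sproj[OF A])
  have sS: "D a b \<subseteq> S2 - {q}" using q D_subset_S2 by auto
  have cM: "connected M" unfolding M_def
    by (rule Janiszewski_dual) (use pd1 pd2 pd(7) XX in auto)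
  have d1: "intr (D a c) \<inter> D c b = {}"
    using intr_eq[OF ac ac'] D_mono[of c c b "a + 2 * pi"] ba by auto
  have "D a c \<subseteq> D b (c + 2 * pi)" using D_mono[of b "a + 2 * pi" "c + 2 * pi" "c + 2 * pi"] ba D_period[of a c] by auto
  then have d2: "intr (D c b) \<inter> D a c = {}" using intr_eq[OF cb cb'] by auto
  have sub: "D a c \<subseteq> S2 - {q}" "D c b \<subseteq> S2 - {q}" using sS Dab by auto
  have isub: "intr (D a c) \<subseteq> S2 - {q}" "intr (D c b) \<subseteq> S2 - {q}"
    using sub intr_subset[of a c] intr_subset[of c b] by auto
  have e1: "interior X1 \<inter> X2 = {}"
    unfolding dp1(2) X2_def inj_on_image_Int[OF inj isub(1) sub(2), symmetric] d1 by simp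
  have e2: "interior X2 \<inter> X1 = {}"
    unfolding dp2(2) X1_def inj_on_image_Int[OF inj isub(2) sub(1), symmetric] d2 by simp
  have cl1: "closed X1" "closed X2" using pd1(1) pd2(1) compact_imp_closed by auto
  have fr: "frontier X1 = X1 - interior X1" "frontier X2 = X2 - interior X2"
    using cl1 by (simp_all add: frontier_def)
  have M1: "M \<subseteq> frontier X1" "M \<subseteq> frontier X2" unfolding M_def fr using e1 e2 by auto
  note pl1 = right_left_arcs_in_plane[OF ac ac' A q1 rl, folded X1_def]
  note pl2 = right_left_arcs_in_plane[OF cb cb' A q2 rl2, folded X2_def]
  have PS: "sproj A (F a) \<in> closure (- X)" "sproj A (F b) \<in> closure (- X)"
    using F_bdry[OF ab ba] dp(3) pd(9) by blast+
  have QM: "sproj A (F c) \<in> M" using D_ends ac cb by (auto simp: M_def X1_def X2_def)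
  have off: "(interior X1 \<union> interior X2 \<union> - X) \<inter> (frontier X1 \<union> frontier X2) = {}"
    unfolding fr using e1 e2 interior_subset[of X1] interior_subset[of X2] XX by blast
  have FS: "F a \<in> S2 - {q}" "F b \<in> S2 - {q}" "F c \<in> S2 - {q}" using sS D_ends[of a b] D_ends[of a c] ab ac cb Dab by auto
  have gsub: "path_image g \<union> path_image h = bdry (D a c)" "path_image g' \<union> path_image h' = bdry (D c b)"
    using rl rl2 by (simp_all add: right_left_arcs_def image_interval)
  then have gS: "path_image g \<union> path_image h \<subseteq> D a c" "path_image g' \<union> path_image h' \<subseteq> D c b"
    by (auto simp: bdry_eq_diff)
  have in_ne: "sproj A x \<noteq> sproj A (F t)" if "x \<in> D a b" "x \<noteq> F t" "F t \<in> S2 - {q}" for x t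
    using inj_onD[OF inj, of x "F t"] that sS by blast
  have off': "(interior X1 \<union> interior X2 \<union> - X) \<inter> (R \<union> R' \<union> R2 \<union> R2') = {}"
    if "R \<union> R' = frontier X1" "R2 \<union> R2' = frontier X2" for R R' R2 R2' using off that by blast
  have out: "z \<in> - X1" if "z \<in> interior X2 \<union> - X" for z using that e2 XX by blast
  have out2: "z \<in> - X2" if "z \<in> interior X1 \<union> - X" for z using that e1 XX by blast
  show "path_image g \<inter> path_image h' \<subseteq> {F a, F c, F b}"
  proof (rule ccontr)
    assume "\<not> ?thesis"
    then obtain x where x: "x \<in> path_image g" "x \<in> path_image h'" "x \<noteq> F a" "x \<noteq> F c" "x \<noteq> F b" by auto
    have xD: "x \<in> D a c" "x \<in> D c b" using x gS by auto
    then have xM: "sproj A x \<in> M" by (simp add: M_def X1_def X2_def)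
    have xne: "sproj A x \<noteq> sproj A (F a)" "sproj A x \<noteq> sproj A (F c)" "sproj A x \<noteq> sproj A (F b)"
      using in_ne[of x] xD(1) Dab x(3-5) FS by blast+
    show False
    proof (rule opposite_sides_core[where M=M and x="sproj A x" and UA = "interior X1" and UB = "interior X2" and UC = "- X" and k=1, OF pl1(1,2) pl2(1,2) pl1(3-6) pl2(3-6) pl1(7) pl2(7)])
      show "sproj A x \<in> path_image (sproj A \<circ> g)" "sproj A x \<in> path_image (sproj A \<circ> h')"
        using x by (auto simp: path_image_compose)
      show "winding_number (sproj A \<circ> g) z - winding_number (sproj A \<circ> h) z = 0" if "z \<in> interior X2 \<union> - X" for z
        using pl1(10)[OF out[OF that]] .
      show "winding_number (sproj A \<circ> g') z - winding_number (sproj A \<circ> h') z = 0" if "z \<in> interior X1 \<union> - X" for z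
        using pl2(10)[OF out2[OF that]] .
    qed (use xne cM xM QM M1 PS pd1(8) pd2(8) pl1(8,9) pl2(8,9) off'[OF pl1(8) pl2(8)] in auto)
  qed
  show "path_image h \<inter> path_image g' \<subseteq> {F a, F c, F b}"
  proof (rule ccontr)
    assume "\<not> ?thesis"
    then obtain x where x: "x \<in> path_image h" "x \<in> path_image g'" "x \<noteq> F a" "x \<noteq> F c" "x \<noteq> F b" by auto
    have xD: "x \<in> D a c" "x \<in> D c b" using x gS by auto
    then have xM: "sproj A x \<in> M" by (simp add: M_def X1_def X2_def)
    have xne: "sproj A x \<noteq> sproj A (F a)" "sproj A x \<noteq> sproj A (F c)" "sproj A x \<noteq> sproj A (F b)"
      using in_ne[of x] xD(1) Dab x(3-5) FS by blast+
    have c1: "path_image (sproj A \<circ> h) \<union> path_image (sproj A \<circ> g) = frontier X1"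
      "path_image (sproj A \<circ> h') \<union> path_image (sproj A \<circ> g') = frontier X2" using pl1(8) pl2(8) by auto
    show False
    proof (rule opposite_sides_core[where M=M and x="sproj A x" and UA = "interior X1" and UB = "interior X2" and UC = "- X" and k="-1", OF pl1(2,1) pl2(2,1) pl1(5,6,3,4) pl2(5,6,3,4)])
      show "sproj A x \<in> path_image (sproj A \<circ> h)" "sproj A x \<in> path_image (sproj A \<circ> g')"
        using x by (auto simp: path_image_compose)
      show "winding_number (sproj A \<circ> h) z - winding_number (sproj A \<circ> g) z = 0" if "z \<in> interior X2 \<union> - X" for z
        using pl1(10)[OF out[OF that]] by simp
      show "winding_number (sproj A \<circ> h') z - winding_number (sproj A \<circ> g') z = 0" if "z \<in> interior X1 \<union> - X" for z
        using pl2(10)[OF out2[OF that]] by simp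
      show "winding_number (sproj A \<circ> h) z - winding_number (sproj A \<circ> g) z = -1" if "z \<in> interior X1" for z
        using pl1(9)[OF that] by (simp add: algebra_simps)
      show "winding_number (sproj A \<circ> h') z - winding_number (sproj A \<circ> g') z = -1" if "z \<in> interior X2" for z
        using pl2(9)[OF that] by (simp add: algebra_simps)
    qed (use xne cM xM QM M1 PS pd1(8) pd2(8) pl1(7) pl2(7) c1 off'[OF c1] in auto)
  qed
qed

end

section \<open>The two halves of the zipper\<close>

text \<open>
  What the combinatorial part uses of the right arcs \<open>P a b\<close> and the left arcs \<open>N a b\<close>. The conditions are
  symmetric in \<open>P\<close> and \<open>N\<close>, so that each result also holds with the two interchanged (\<open>sides_flip\<close>).
\<close>

locale sides = wheel f for f +
  fixes P N :: "real \<Rightarrow> real \<Rightarrow> (real^3) set"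
  assumes bdry_sides: "a < b \<Longrightarrow> b < a + 2 * pi \<Longrightarrow> F a \<noteq> F b \<Longrightarrow> bdry (D a b) = {F a, F b} \<union> P a b \<union> N a b"
    and ends_notin: "F a \<notin> P a b" "F b \<notin> P a b" "F a \<notin> N a b" "F b \<notin> N a b"
    and complement: "a < b \<Longrightarrow> b < a + 2 * pi \<Longrightarrow> P b (a + 2 * pi) = P a b"
      "a < b \<Longrightarrow> b < a + 2 * pi \<Longrightarrow> N b (a + 2 * pi) = N a b"
    and adjacent: "a < c \<Longrightarrow> c < b \<Longrightarrow> b < a + 2 * pi \<Longrightarrow> P a c \<inter> N c b = {}"
      "a < c \<Longrightarrow> c < b \<Longrightarrow> b < a + 2 * pi \<Longrightarrow> N a c \<inter> P c b = {}"
begin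

lemma sides_flip: "sides f N P"
  by unfold_locales (use bdry_sides ends_notin complement adjacent in auto)

definition valid :: "real \<Rightarrow> real \<Rightarrow> bool" where
  "valid a b \<longleftrightarrow> a < b \<and> b < a + 2 * pi \<and> F a \<noteq> F b"

definition Zip :: "(real^3) set" where "Zip = {x. \<exists>a b. valid a b \<and> x \<in> P a b}"

lemma valid_complement: "valid a b \<Longrightarrow> valid b (a + 2 * pi)"
  by (auto simp: valid_def F_period)

lemma P_period: "a < b \<Longrightarrow> b < a + 2 * pi \<Longrightarrow> P (a + 2 * pi) (b + 2 * pi) = P a b"
  using complement(1)[of a b] complement(1)[of b "a + 2 * pi"] by simp

lemma P_period_back: "a < b \<Longrightarrow> b < a + 2 * pi \<Longrightarrow> P (a - 2 * pi) (b - 2 * pi) = P a b"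
  using P_period[of "a - 2 * pi" "b - 2 * pi"] by simp

lemma F_period_int: "F (t + 2 * pi * of_int k) = F t"
proof (induction k rule: int_induct[where k = 0])
  case (step1 i)
  then show ?case using F_period[of "t + 2 * pi * of_int i"] by (simp add: algebra_simps)
next
  case (step2 i)
  then show ?case using F_period[of "t + 2 * pi * of_int i - 2 * pi"] by (simp add: algebra_simps)
qed simp

lemma P_period_int: 
  assumes "a < b" "b < a + 2 * pi"
  shows "P (a + 2 * pi * of_int k) (b + 2 * pi * of_int k) = P a b"
proof (induction k rule: int_induct[where k = 0])
  case (step1 i)
  then show ?case using P_period[of "a + 2 * pi * of_int i" "b + 2 * pi * of_int i"] assms by (simp add: algebra_simps)
next
  case (step2 i)
  then show ?case using P_period_back[of "a + 2 * pi * of_int i" "b + 2 * pi * of_int i"] assms by (simp add: algebra_simps)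
qed simp

lemma bdry_cases:
  assumes "valid a b" "x \<in> D a b" "x \<in> D b (a + 2 * pi)" "x \<noteq> F a" "x \<noteq> F b"
  shows "x \<in> P a b \<or> x \<in> N a b"
  using assms bdry_sides[of a b] bdry_eq[of a b] unfolding valid_def by blast

lemma P_subset_bdry: "valid a b \<Longrightarrow> x \<in> P a b \<Longrightarrow> x \<in> D a b \<and> x \<in> D b (a + 2 * pi) \<and> x \<noteq> F a \<and> x \<noteq> F b"
  using bdry_sides[of a b] bdry_eq[of a b] ends_notin unfolding valid_def by blast

lemma P_subset_S2: "valid a b \<Longrightarrow> P a b \<subseteq> S2"
  using P_subset_bdry D_subset_S2 by blast

text \<open>
  If the end \<open>b\<close> is moved to \<open>b'\<close>, the arc changes only within the disk \<open>D b b'\<close>. So a given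
  point of the arc stays on it if \<open>b'\<close> is close to \<open>b\<close>. Since \<open>D b b'\<close> is infinite, the new end can avoid a finite set, which
  brings finitely many intervals into general position.
\<close>

lemma extend_end:
  assumes v: "valid a b" and x: "x \<in> P a b" and Q: "finite Q"
  obtains b' where "b < b'" "b' < a + 2 * pi" "F b' \<notin> Q" "valid a b'" "x \<in> P a b'"
proof -
  have ab: "a < b" "b < a + 2 * pi" "F a \<noteq> F b" using v by (auto simp: valid_def)
  have xb: "x \<noteq> F b" "x \<noteq> F a" "x \<in> D a b" "x \<in> D b (a + 2 * pi)" using P_subset_bdry[OF v x] by auto
  have "isCont F b" using continuous_F[of UNIV] by (simp add: continuous_on_eq_continuous_at)
  then obtain d where d: "d > 0" "\<And>t. dist t b < d \<Longrightarrow> dist (F t) (F b) < dist x (F b)"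
    using xb(1) unfolding continuous_at_eps_delta by (metis zero_less_dist_iff)
  \<comment> \<open>Until \<open>b + e\<close> the images stay away from \<open>x\<close> and the turn is not complete.\<close>
  define e where "e = min (d / 2) ((a + 2 * pi - b) / 2)"
  have e: "e > 0" "e < d" "b + e < a + 2 * pi"
    using d(1) ab(2) by (auto simp: e_def min_def field_simps)
  have far: "x \<noteq> F t" if "t \<in> {b..b + e}" for t
    using d(2)[of t] that e by (auto simp: dist_real_def dist_commute)
  have "infinite (D b (b + e))" by (rule infinite_D) (use e in simp)
  then have "\<not> D b (b + e) \<subseteq> Q \<union> {F a, F b}" using Q by (meson finite.intros finite_UnI finite_subset)
  then obtain y where y: "y \<in> D b (b + e)" "y \<notin> Q \<union> {F a, F b}" by blast
  from y(1) obtain b' where "b' \<in> {b..b + e}" "y = F b'" unfolding D_def by (rule imageE)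
  with y(2) have b': "b' \<in> {b..b + e}" "F b' \<notin> Q" "F b' \<noteq> F a" "F b' \<noteq> F b" by auto
  have bb: "b < b'" "b' < a + 2 * pi" using b' e by (auto simp: less_le)
  have v': "valid a b'" using bb ab b' by (auto simp: valid_def)
  have "x \<in> D b b' \<union> D b' (a + 2 * pi)" using xb(4) D_split[of b b' "a + 2 * pi"] bb by auto
  moreover have "x \<notin> D b b'"
  proof
    assume "x \<in> D b b'"
    then obtain t where t: "t \<in> {b..b'}" "x = F t" unfolding D_def by (metis imageE)
    then have "t \<in> {b..b + e}" using b'(1) by auto
    then show False using far t(2) by blast
  qed
  ultimately have "x \<in> D b' (a + 2 * pi)" by simp
  moreover have "x \<in> D a b'" using xb(3) D_mono[of a a b b'] bb by auto
  ultimately have "x \<in> P a b' \<or> x \<in> N a b'"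
    using bdry_cases[OF v'] far[OF b'(1)] xb(2) by blast
  moreover have "x \<notin> N a b'"
  proof
    assume "x \<in> N a b'"
    then have "x \<in> N b' (a + 2 * pi)" using complement(2)[of a b'] bb ab by simp
    moreover have "x \<in> P (a + 2 * pi) (b + 2 * pi)" using P_period[of a b] ab x by simp
    ultimately show False using adjacent(2)[of b' "a + 2 * pi" "b + 2 * pi"] bb ab by auto
  qed
  ultimately show thesis using that[of b'] bb b' v' by blast
qed

text \<open>
  After a small move of one end, a common point would be on opposite sides of two adjacent intervals.
\<close>

lemma sides_disjoint: assumes v: "valid a b" shows "P a b \<inter> N a b = {}"
proof (rule ccontr)
  assume "\<not> ?thesis"
  then obtain x where x: "x \<in> P a b" "x \<in> N a b" by auto
  obtain b' where b': "b < b'" "b' < a + 2 * pi" "valid a b'" "x \<in> P a b'"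
    using extend_end[OF v x(1), of "{}"] by auto
  have ab: "a < b" "b < a + 2 * pi" using v by (auto simp: valid_def)
  interpret flip: sides f N P by (rule sides_flip)
  have "x \<in> P b' (a + 2 * pi)" using complement(1)[of a b'] b' ab by simp
  moreover have "x \<in> N (a + 2 * pi) (b + 2 * pi)" using flip.P_period[of a b] ab x by simp
  ultimately show False using adjacent(1)[of b' "a + 2 * pi" "b + 2 * pi"] b' ab by auto
qed

text \<open>
  The point \<open>x\<close> is on the boundary of one of the two shorter disks. If it were on its negative side, it
  would be on opposite sides of two adjacent intervals, one of which is the complement of the interval
  from \<open>a\<close> to \<open>b\<close>.
\<close>

lemma split_side:
  assumes o: "a < c" "c < b" "b < a + 2 * pi" and ne: "F a \<noteq> F c" "F c \<noteq> F b" "F a \<noteq> F b"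
    and x: "x \<in> P a b" "x \<noteq> F c"
  shows "x \<in> P a c \<or> x \<in> P c b"
proof -
  interpret flip: sides f N P by (rule sides_flip)
  have v: "valid a b" "valid a c" "valid c b" using o ne by (auto simp: valid_def)
  note xb = P_subset_bdry[OF v(1) x(1)]
  have xc: "x \<in> P b (a + 2 * pi)" using complement(1)[of a b] o x by simp
  have "x \<in> D a c \<union> D c b" using xb D_split[of a c b] o by auto
  then show ?thesis
  proof
    assume xx: "x \<in> D a c"
    have "x \<in> D c (a + 2 * pi)" using xb D_mono[of c b "a + 2 * pi" "a + 2 * pi"] o by auto
    then have "x \<in> P a c \<or> x \<in> N a c" using bdry_cases[OF v(2) xx] xb x by blast
    moreover have "x \<notin> N a c"
    proof
      assume "x \<in> N a c"
      then have "x \<in> N (a + 2 * pi) (c + 2 * pi)" using flip.P_period[of a c] o by simp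
      then show False using adjacent(1)[of b "a + 2 * pi" "c + 2 * pi"] o xc by auto
    qed
    ultimately show ?thesis by blast
  next
    assume xx: "x \<in> D c b"
    have "x \<in> D b (c + 2 * pi)" using xb D_mono[of b b "a + 2 * pi" "c + 2 * pi"] o by auto
    then have "x \<in> P c b \<or> x \<in> N c b" using bdry_cases[OF v(3) xx] xb x by blast
    moreover have "x \<notin> N c b" using adjacent(2)[of c b "a + 2 * pi"] o xc by auto
    ultimately show ?thesis by blast
  qed
qed

definition cyclic4 :: "real \<Rightarrow> real \<Rightarrow> real \<Rightarrow> real \<Rightarrow> bool" where
  "cyclic4 p q r s \<longleftrightarrow> p < q \<and> q < r \<and> r < s \<and> s < p + 2 * pi \<and>
    F p \<noteq> F q \<and> F p \<noteq> F r \<and> F p \<noteq> F s \<and> F q \<noteq> F r \<and> F q \<noteq> F s \<and> F r \<noteq> F s"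

lemma cyclic4_rotate: "cyclic4 p q r s \<Longrightarrow> cyclic4 q r s (p + 2 * pi)"
  unfolding cyclic4_def F_period by auto

text \<open>
  A common point is also on the boundary of the disk of \<open>q\<close>, \<open>r\<close> or of that of \<open>p\<close>, \<open>r\<close>. Whichever side
  it is on there, this contradicts the condition on adjacent intervals.
\<close>

lemma opposite_disjoint:
  assumes c: "cyclic4 p q r s"
  shows "P p q \<inter> N r s = {}"
proof (rule ccontr)
  assume "\<not> ?thesis"
  then obtain x where x: "x \<in> P p q" "x \<in> N r s" by auto
  interpret flip: sides f N P by (rule sides_flip)
  note c' = c[unfolded cyclic4_def]
  have v: "valid p q" "valid q r" "valid p r" using c' by (auto simp: valid_def)
  note xb = P_subset_bdry[OF v(1) x(1)]
  have xr: "x \<noteq> F r" using ends_notin x by metis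
  have "x \<in> D q r \<union> D r (p + 2 * pi)" using xb D_split[of q r "p + 2 * pi"] c' by auto
  then show False
  proof
    assume xx: "x \<in> D q r"
    have "x \<in> D (p + 2 * pi) (q + 2 * pi)" using xb D_period by simp
    then have "x \<in> D r (q + 2 * pi)" using D_mono[of r "p + 2 * pi" "q + 2 * pi" "q + 2 * pi"] c' by auto
    then have "x \<in> P q r \<or> x \<in> N q r" using bdry_cases[OF v(2) xx] xb xr by blast
    then show False using adjacent[of p q r] adjacent[of q r s] c' x by auto
  next
    assume xx: "x \<in> D r (p + 2 * pi)"
    have "x \<in> D p r" using xb D_mono[of p p q r] c' by auto
    then have "x \<in> P p r \<or> x \<in> N p r" using bdry_cases[OF v(3) _ xx] xb xr by blast
    then show False
    proof
      assume "x \<in> P p r"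
      then show False using adjacent(1)[of p r s] c' x by auto
    next
      assume "x \<in> N p r"
      then have "x \<in> N r (p + 2 * pi)" using complement(2)[of p r] c' by simp
      moreover have "x \<in> P (p + 2 * pi) (q + 2 * pi)" using P_period[of p q] c' x by simp
      ultimately show False using adjacent(2)[of r "p + 2 * pi" "q + 2 * pi"] c' by auto
    qed
  qed
qed

text \<open>
  Splitting both intervals puts a common point on a positive arc and on a negative arc of two of the three
  consecutive intervals from \<open>p\<close> to \<open>s\<close>. These may be equal, adjacent or opposite.
\<close>

lemma crossing_disjoint:
  assumes c: "cyclic4 p q r s"
  shows "P p r \<inter> N q s = {}"
proof (rule ccontr)
  assume "\<not> ?thesis"
  then obtain x where x: "x \<in> P p r" "x \<in> N q s" by auto
  interpret flip: sides f N P by (rule sides_flip)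
  note c' = c[unfolded cyclic4_def]
  have xr: "x \<noteq> F r" "x \<noteq> F q" using ends_notin x by metis+
  have "x \<in> P p q \<or> x \<in> P q r" by (rule split_side) (use c' x xr in auto)
  moreover have "x \<in> N q r \<or> x \<in> N r s" by (rule flip.split_side) (use c' x xr in auto)
  moreover have "valid q r" using c' by (auto simp: valid_def)
  ultimately show False
    using adjacent[of p q r] adjacent[of q r s] opposite_disjoint[OF c] sides_disjoint[of q r] c' by auto
qed

lemma complementary_pairs_disjoint:
  assumes c: "cyclic4 p q r s"
  shows "P p q \<inter> N r s = {}" "P p r \<inter> N q s = {}" "P p s \<inter> N q r = {}"
    and "P r s \<inter> N p q = {}" "P q s \<inter> N p r = {}" "P q r \<inter> N p s = {}"
proof -
  interpret flip: sides f N P by (rule sides_flip)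
  note c' = c[unfolded cyclic4_def]
  show 1: "P p q \<inter> N r s = {}" by (rule opposite_disjoint[OF c])
  show 2: "P p r \<inter> N q s = {}" by (rule crossing_disjoint[OF c])
  show "P r s \<inter> N p q = {}" using flip.opposite_disjoint[OF c] by auto
  show "P q s \<inter> N p r = {}" using flip.crossing_disjoint[OF c] by auto
  note r = cyclic4_rotate[OF c]
  show "P q r \<inter> N p s = {}" using opposite_disjoint[OF r] complement(2)[of p s] c' by simp
  show "P p s \<inter> N q r = {}" using flip.opposite_disjoint[OF r] complement(1)[of p s] c' by auto
qed

text \<open>
  A shift by a multiple of the period brings the initial end into the first period. If the final end is
  then beyond this period, the complementary interval, which has the same arcs, is used instead.
\<close>

lemma normalize_interval:
  assumes v: "valid a b"
  obtains u w where "0 \<le> u" "u < w" "w < 2 * pi" "F u \<noteq> F w" "P u w = P a b" "{F u, F w} = {F a, F b}"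
proof -
  have ab: "a < b" "b < a + 2 * pi" "F a \<noteq> F b" using v by (auto simp: valid_def)
  define k where "k = - \<lfloor>a / (2 * pi)\<rfloor>"
  have k: "- of_int k \<le> a / (2 * pi)" "a / (2 * pi) < - of_int k + 1" unfolding k_def by linarith+
  define a' where "a' = a + 2 * pi * of_int k"
  define b' where "b' = b + 2 * pi * of_int k"
  have a': "0 \<le> a'" "a' < 2 * pi" using k pi_gt_zero by (auto simp: a'_def field_simps)
  have b': "a' < b'" "b' < a' + 2 * pi" using ab by (auto simp: a'_def b'_def)
  have F': "F a' = F a" "F b' = F b" by (simp_all add: a'_def b'_def F_period_int)
  have P': "P a' b' = P a b" unfolding a'_def b'_def by (rule P_period_int[OF ab(1,2)])
  show thesis
  proof (cases "b' < 2 * pi")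
    case True
    then show thesis using that[of a' b'] a' b' F' P' ab by auto
  next
    case False
    have "P (b' - 2 * pi) a' = P b' (a' + 2 * pi)"
      using P_period[of "b' - 2 * pi" a'] b' by simp
    also have "\<dots> = P a b" using complement(1)[OF b'] P' by simp
    finally have "P (b' - 2 * pi) a' = P a b" .
    moreover have "F (b' - 2 * pi) = F b" using F_period[of "b' - 2 * pi"] F' by simp
    ultimately show thesis using that[of "b' - 2 * pi" a'] a' b' F' ab False by auto
  qed
qed

lemma general_interval:
  assumes x: "x \<in> Zip" and Q: "finite Q"
  obtains u w where "0 \<le> u" "u < w" "w < 2 * pi" "F u \<noteq> F w" "x \<in> P u w" "F u \<notin> Q" "F w \<notin> Q"
proof -
  obtain a b where ab: "valid a b" "x \<in> P a b" using x by (auto simp: Zip_def)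
  obtain b' where b': "F b' \<notin> Q" "valid a b'" "x \<in> P a b'"
    using extend_end[OF ab Q] by metis
  have v: "valid b' (a + 2 * pi)" by (rule valid_complement[OF b'(2)])
  have "x \<in> P b' (a + 2 * pi)" using complement(1)[of a b'] b' by (simp add: valid_def)
  from extend_end[OF v this Q] obtain a' where a': "F a' \<notin> Q" "valid b' a'" "x \<in> P b' a'" by metis
  obtain u w where uw: "0 \<le> u" "u < w" "w < 2 * pi" "F u \<noteq> F w" "P u w = P b' a'" "{F u, F w} = {F b', F a'}"
    using normalize_interval[OF a'(2)] by metis
  then show thesis using that[of u w] a' b' by (auto simp: doubleton_eq_iff)
qed

text \<open>
  Complementary intervals need not be distinguished, so the linear order of the four ends in one period
  is all that matters.
\<close>

lemma two_pairs_cases: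
  assumes "0 \<le> u" "u < w" "w < 2 * pi" "0 \<le> u'" "u' < w'" "w' < 2 * pi"
    and "F u \<noteq> F w" "F u' \<noteq> F w'" "F u' \<notin> {F u, F w}" "F w' \<notin> {F u, F w}"
  shows "cyclic4 u w u' w' \<or> cyclic4 u u' w w' \<or> cyclic4 u u' w' w \<or> cyclic4 u' w' u w \<or> cyclic4 u' u w' w \<or> cyclic4 u' u w w'"
proof -
  have "u \<noteq> u'" "u \<noteq> w'" "w \<noteq> u'" "w \<noteq> w'" using assms by auto
  moreover have ne: "F u \<noteq> F u'" "F u \<noteq> F w'" "F w \<noteq> F u'" "F w \<noteq> F w'" using assms by auto
  ultimately consider "w < u'" | "u < u'" "u' < w" "w < w'" | "u < u'" "w' < w" | "w' < u" | "u' < u" "u < w'" "w' < w" | "u' < u" "w < w'"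
    by linarith
  then show ?thesis
    using assms ne ne[symmetric] by cases (simp_all add: cyclic4_def)
qed

lemma Zip_disjoint: "Zip \<inter> {x. \<exists>a b. valid a b \<and> x \<in> N a b} = {}"
proof (rule ccontr)
  interpret flip: sides f N P by (rule sides_flip)
  have Z2: "{x. \<exists>a b. valid a b \<and> x \<in> N a b} = flip.Zip" by (simp add: flip.Zip_def)
  assume "\<not> ?thesis"
  then obtain x where x: "x \<in> Zip" "x \<in> flip.Zip" unfolding Z2 by auto
  obtain u w where uw: "0 \<le> u" "u < w" "w < 2 * pi" "F u \<noteq> F w" "x \<in> P u w"
    using general_interval[OF x(1), of "{}"] by auto
  obtain u' w' where uw': "0 \<le> u'" "u' < w'" "w' < 2 * pi" "F u' \<noteq> F w'" "x \<in> N u' w'" "F u' \<notin> {F u, F w}" "F w' \<notin> {F u, F w}"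
    using flip.general_interval[OF x(2), of "{F u, F w}"] by auto
  show False
    using two_pairs_cases[OF uw(1-3) uw'(1-3) uw(4) uw'(4,6,7)]
    by (elim disjE) (use complementary_pairs_disjoint uw(5) uw'(5) in \<open>metis disjoint_iff\<close>)+
qed

lemma Zip_subset_S2: "Zip \<subseteq> S2"
  using P_subset_S2 by (auto simp: Zip_def)

lemma small_interval:
  assumes e: "e > 0"
  obtains b where "a < b" "b < a + 2 * pi" "valid a b" "\<And>t. t \<in> {a..b} \<Longrightarrow> dist (F t) (F a) < e"
proof -
  have "isCont F a" using continuous_F[of UNIV] by (simp add: continuous_on_eq_continuous_at)
  then obtain d where d: "d > 0" "\<And>t. dist t a < d \<Longrightarrow> dist (F t) (F a) < e"
    using e unfolding continuous_at_eps_delta by metis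
  define d' where "d' = min (d / 2) pi"
  have d': "d' > 0" "d' < d" "a + d' < a + 2 * pi" using d(1) pi_gt_zero by (auto simp: d'_def min_def)
  have "infinite (D a (a + d'))" by (rule infinite_D) (use d' in simp)
  then have "\<not> D a (a + d') \<subseteq> {F a}" by (meson finite.intros finite_subset)
  then obtain y where y: "y \<in> D a (a + d')" "y \<noteq> F a" by blast
  from y(1) obtain b where "b \<in> {a..a + d'}" "y = F b" unfolding D_def by (rule imageE)
  with y(2) have b: "b \<in> {a..a + d'}" "F b \<noteq> F a" by auto
  show thesis
  proof (rule that[of b])
    show "a < b" "b < a + 2 * pi" using b d' by (auto simp: less_le)
    then show "valid a b" using b by (auto simp: valid_def)
    show "dist (F t) (F a) < e" if "t \<in> {a..b}" for t
      using d(2)[of t] that b d' by (auto simp: dist_real_def)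
  qed
qed

end

section \<open>Connectedness and density of the halves\<close>

text \<open>
  Path connectedness is not part of the first locale, because for the arcs of a wheel it rests on a result
  proved there: that an interval has only one right arc follows from \<open>sides_disjoint\<close>.
\<close>

locale path_sides = sides +
  assumes path_connected_sides: "valid a b \<Longrightarrow> path_connected (P a b)"
      "valid a b \<Longrightarrow> path_connected (N a b)"
    and infinite_sides: "valid a b \<Longrightarrow> infinite (P a b)" "valid a b \<Longrightarrow> infinite (N a b)"
begin

lemma path_sides_flip: "path_sides f N P"
proof -
  interpret flip: sides f N P by (rule sides_flip)
  show ?thesis
    by unfold_locales (use path_connected_sides infinite_sides in auto)
qed

definition linked :: "(real^3) set \<Rightarrow> (real^3) set \<Rightarrow> bool" where
  "linked A B \<longleftrightarrow> (\<forall>x\<in>A. \<forall>y\<in>B. path_component Zip x y)"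

lemma linked_sym: "linked A B \<Longrightarrow> linked B A"
  by (auto simp: linked_def intro: path_component_sym)

lemma linked_trans: "linked A B \<Longrightarrow> linked B C \<Longrightarrow> B \<noteq> {} \<Longrightarrow> linked A C"
  unfolding linked_def by (meson ex_in_conv path_component_trans)

lemma P_subset_Zip: "valid a b \<Longrightarrow> P a b \<subseteq> Zip"
  by (auto simp: Zip_def)

lemma linked_meet:
  assumes "valid a b" "valid c d" "z \<in> P a b" "z \<in> P c d"
  shows "linked (P a b) (P c d)"
  unfolding linked_def
proof (intro ballI)
  fix x y assume "x \<in> P a b" "y \<in> P c d"
  then have "path_component (P a b) x z" "path_component (P c d) z y"
    using assms path_connected_sides(1) by (auto simp: path_connected_component)
  then show "path_component Zip x y"
    using assms P_subset_Zip path_component_of_subset path_component_trans by metis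
qed

text \<open>
  The three intervals between the times \<open>a\<close>, \<open>c\<close>, \<open>b\<close> have the arcs \<open>P a c\<close>, \<open>P c b\<close> and \<open>P a b\<close>. By
  \<open>split_side\<close>, applied to the complement of each interval, each arc intersects one of the other two. A
  graph with three vertices and without isolated ones is connected.
\<close>

lemma linked_triple:
  assumes o: "a < c" "c < b" "b < a + 2 * pi" and ne: "F a \<noteq> F c" "F c \<noteq> F b" "F a \<noteq> F b"
  shows "linked (P a c) (P c b)" "linked (P a c) (P a b)" "linked (P c b) (P a b)"
proof -
  have v: "valid a b" "valid a c" "valid c b" using o ne by (auto simp: valid_def)
  have nonemp: "P a b \<noteq> {}" "P a c \<noteq> {}" "P c b \<noteq> {}" using infinite_sides(1) v by fastforce+
  have pick: "\<exists>x. x \<in> P p q \<and> x \<noteq> y" if "valid p q" for p q y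
    using infinite_sides(1)[OF that] by (metis finite.intros finite_subset insertI1 subsetI)
  obtain x1 where x1: "x1 \<in> P a b" "x1 \<noteq> F c" using pick[OF v(1)] by blast
  have "x1 \<in> P a c \<or> x1 \<in> P c b" by (rule split_side) (use o ne x1 in auto)
  then have 1: "linked (P a b) (P a c) \<or> linked (P a b) (P c b)"
    using linked_meet v x1 by blast
  obtain x2 where x2: "x2 \<in> P a c" "x2 \<noteq> F b" using pick[OF v(2)] by blast
  have "x2 \<in> P c (a + 2 * pi)" using complement(1)[of a c] o x2 by simp
  then have "x2 \<in> P c b \<or> x2 \<in> P b (a + 2 * pi)"
    using split_side[of c b "a + 2 * pi" x2] o ne x2 F_period[of a] by auto
  then have "x2 \<in> P c b \<or> x2 \<in> P a b" using complement(1)[of a b] o by simp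
  then have 2: "linked (P a c) (P c b) \<or> linked (P a c) (P a b)"
    using linked_meet v x2 by blast
  obtain x3 where x3: "x3 \<in> P c b" "x3 \<noteq> F a" using pick[OF v(3)] by blast
  have "x3 \<in> P b (c + 2 * pi)" using complement(1)[of c b] o x3 by simp
  then have "x3 \<in> P b (a + 2 * pi) \<or> x3 \<in> P (a + 2 * pi) (c + 2 * pi)"
    using split_side[of b "a + 2 * pi" "c + 2 * pi" x3] o ne x3 F_period[of a] F_period[of c] by auto
  then have "x3 \<in> P a b \<or> x3 \<in> P a c" using complement(1)[of a b] P_period[of a c] o by simp
  then have 3: "linked (P c b) (P a b) \<or> linked (P c b) (P a c)"
    using linked_meet v x3 by blast
  show "linked (P a c) (P c b)" "linked (P a c) (P a b)" "linked (P c b) (P a b)"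
    using 1 2 3 linked_sym linked_trans nonemp by metis+
qed

lemma linked_pairs:
  assumes c: "cyclic4 p q r s"
  shows "linked (P p q) (P r s)" "linked (P p r) (P q s)" "linked (P p s) (P q r)"
proof -
  note c' = c[unfolded cyclic4_def]
  have v: "valid q r" "valid p q" using c' by (auto simp: valid_def)
  then have n: "P q r \<noteq> {}" "P p q \<noteq> {}" using infinite_sides(1) by fastforce+
  have 1: "linked (P p q) (P q r)" "linked (P p q) (P p r)" using linked_triple[of p q r] c' by auto
  have 2: "linked (P q r) (P r s)" using linked_triple[of q r s] c' by auto
  have 3: "linked (P p q) (P q s)" "linked (P p q) (P p s)" using linked_triple[of p q s] c' by auto
  show "linked (P p q) (P r s)" using 1 2 n linked_trans by blast
  show "linked (P p r) (P q s)" using 1 3 n linked_trans linked_sym by blast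
  show "linked (P p s) (P q r)" using 1 3 n linked_trans linked_sym by blast
qed

lemma path_connected_Zip: "path_connected Zip"
  unfolding path_connected_component
proof (intro ballI)
  fix x y assume x: "x \<in> Zip" and y: "y \<in> Zip"
  obtain u w where uw: "0 \<le> u" "u < w" "w < 2 * pi" "F u \<noteq> F w" "x \<in> P u w"
    using general_interval[OF x, of "{}"] by auto
  obtain u' w' where uw': "0 \<le> u'" "u' < w'" "w' < 2 * pi" "F u' \<noteq> F w'" "y \<in> P u' w'" "F u' \<notin> {F u, F w}" "F w' \<notin> {F u, F w}"
    using general_interval[OF y, of "{F u, F w}"] by auto
  have "linked (P u w) (P u' w')"
    using two_pairs_cases[OF uw(1-3) uw'(1-3) uw(4) uw'(4,6,7)]
    by (elim disjE) (use linked_pairs linked_sym in metis)+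
  then show "path_component Zip x y" using uw(5) uw'(5) by (auto simp: linked_def)
qed

lemma Zip_dense:
  assumes "openin (top_of_set S2) U" "U \<noteq> {}"
  shows "U \<inter> Zip \<noteq> {}"
proof -
  obtain y where y: "y \<in> U" using assms by auto
  then obtain e where e: "e > 0" "\<And>z. z \<in> S2 \<Longrightarrow> dist z y < e \<Longrightarrow> z \<in> U"
    using assms(1) unfolding openin_euclidean_subtopology_iff by blast
  have "y \<in> D 0 (0 + 2 * pi)" using y assms(1) D_full[of 0] openin_imp_subset by blast
  then obtain a where a: "y = F a" by (auto simp: D_def)
  obtain b where b: "a < b" "valid a b" "\<And>t. t \<in> {a..b} \<Longrightarrow> dist (F t) (F a) < e"
    using small_interval[OF e(1)] by metis
  have "P a b \<noteq> {}" using infinite_sides(1)[OF b(2)] by auto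
  then obtain x where x: "x \<in> P a b" by auto
  then have "x \<in> D a b" using P_subset_bdry[OF b(2)] by auto
  then have "x \<in> U" using e(2) b(3) a F_in_S2 by (auto simp: D_def)
  moreover have "x \<in> Zip" using x b(2) P_subset_Zip by auto
  ultimately show ?thesis by auto
qed

text \<open>
  The other half is connected, dense and disjoint from the curve. So it would lie on one side of the
  curve and yet meet both.
\<close>

lemma no_simple_loop:
  assumes c: "simple_path c" "pathfinish c = pathstart c" "path_image c \<subseteq> Zip"
  shows False
proof -
  interpret flip: path_sides f N P by (rule path_sides_flip)
  have Z2: "{x. \<exists>a b. valid a b \<and> x \<in> N a b} = flip.Zip" by (simp add: flip.Zip_def)
  have disj: "Zip \<inter> flip.Zip = {}" using Zip_disjoint unfolding Z2 .
  \<comment> \<open>With a pole \<open>q\<close> in the other half, \<open>q\<close> itself is a point of that half outside the curve.\<close>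
  have "S2 \<inter> flip.Zip \<noteq> {}" by (rule flip.Zip_dense) (use F_in_S2 in auto)
  then obtain q where q: "q \<in> flip.Zip" "q \<in> S2" by auto
  then obtain A where A: "rotation_matrix A" "A *v q = north" using rotation_to_north by blast
  note H = homeomorphism_sproj[OF A]
  let ?\<psi> = "\<lambda>z. transpose A *v unstereo z"
  have cS: "path_image c \<subseteq> S2 - {q}" using c(3) Zip_subset_S2 q disj by auto
  have sp: "simple_path (sproj A \<circ> c)"
    by (rule simple_path_continuous_image[OF c(1)])
      (use cS H inj_on_sproj[OF A] in \<open>auto intro: continuous_on_subset inj_on_subset dest: homeomorphism_cont1\<close>)
  have cl: "pathfinish (sproj A \<circ> c) = pathstart (sproj A \<circ> c)"
    using c(2) by (simp add: pathfinish_compose pathstart_compose)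
  define C where "C = path_image (sproj A \<circ> c)"
  note J = Jordan_inside_outside[OF sp cl, folded C_def]
  have C: "?\<psi> ` C = path_image c"
    unfolding C_def path_image_compose image_image using homeomorphism_apply1[OF H] cS by force
  define U where "U = ?\<psi> ` inside C"
  define K where "K = ?\<psi> ` closure (inside C)"
  have "openin (top_of_set (S2 - {q})) U"
    unfolding U_def using homeomorphism_imp_open_map[OF homeomorphism_symD[OF H], of "inside C"] J by simp
  moreover have "openin (top_of_set S2) (S2 - {q})" by (simp add: openin_delete)
  ultimately have oU: "openin (top_of_set S2) U" using openin_trans by blast
  have "compact (closure (inside C))" using J by (simp add: compact_closure)
  then have "compact K" unfolding K_def
    by (rule compact_continuous_image[rotated]) (use homeomorphism_cont2[OF H] in \<open>auto intro: continuous_on_subset\<close>)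
  then have clK: "closed K" by (rule compact_imp_closed)
  have "closure (inside C) = inside C \<union> C"
    using J by (metis closure_Un_frontier)
  then have K: "K = U \<union> path_image c" by (simp add: K_def U_def image_Un C)
  have qK: "q \<notin> K" unfolding K_def using homeomorphism_image2[OF H] by fastforce
  have "U \<noteq> {}" using J by (simp add: U_def)
  then obtain z where z: "z \<in> U" "z \<in> flip.Zip" using flip.Zip_dense[OF oU] by auto
  obtain O1 where O1: "open O1" "U = S2 \<inter> O1" using oU unfolding openin_open by auto
  have con: "connected flip.Zip" by (rule path_connected_imp_connected[OF flip.path_connected_Zip])
  have zS: "flip.Zip \<subseteq> S2" by (rule flip.Zip_subset_S2)
  have "O1 \<inter> flip.Zip = {} \<or> (- K) \<inter> flip.Zip = {}"
  proof (rule connectedD[OF con O1(1)])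
    show "open (- K)" by (rule open_Compl[OF clK])
    show "O1 \<inter> - K \<inter> flip.Zip = {}" using O1 K zS by auto
    show "flip.Zip \<subseteq> O1 \<union> - K" using K O1 disj c(3) by auto
  qed
  then show False using z O1 q qK by auto
qed

end

section \<open>The arcs of a wheel form two halves\<close>

context wheel begin

definition right_side :: "real \<Rightarrow> real \<Rightarrow> (real^3) set" where
  "right_side a b = {x. \<exists>g h. right_left_arcs f a b g h \<and> x \<in> path_image g - {F a, F b}}"

definition left_side :: "real \<Rightarrow> real \<Rightarrow> (real^3) set" where
  "left_side a b = {x. \<exists>g h. right_left_arcs f a b g h \<and> x \<in> path_image h - {F a, F b}}"

lemma arcs_bdry: "right_left_arcs f a b g h \<Longrightarrow> path_image g \<union> path_image h = bdry (D a b)"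
  by (simp add: right_left_arcs_def image_interval)

lemma sides_wheel: "sides f right_side left_side"
proof unfold_locales
  fix a b :: real assume ab: "a < b" "b < a + 2 * pi"
  show "bdry (D a b) = {F a, F b} \<union> right_side a b \<union> left_side a b" if ne: "F a \<noteq> F b"
  proof -
    obtain g h where "right_left_arcs f a b g h" using right_left_arcs_exist[OF ab ne] by blast
    then show ?thesis
      using arcs_bdry[of a b] F_bdry[OF ab] unfolding right_side_def left_side_def by blast
  qed
  have 1: "\<exists>g' h'. right_left_arcs f b (a + 2 * pi) g' h' \<and> path_image g' = path_image g \<and> path_image h' = path_image h"
    if "right_left_arcs f a b g h" for g h
    using right_left_arcs_complement[OF ab that] by (metis path_image_reversepath)
  have per: "right_left_arcs f (a + 2 * pi) (b + 2 * pi) g h = right_left_arcs f a b g h" for g h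
    using F_period[of a] F_period[of b]
    by (simp add: right_left_arcs_def image_interval D_period F_def[symmetric])
  have 2: "\<exists>g' h'. right_left_arcs f a b g' h' \<and> path_image g' = path_image g \<and> path_image h' = path_image h"
    if "right_left_arcs f b (a + 2 * pi) g h" for g h
    using right_left_arcs_complement[OF complement_bounds[OF ab] that] unfolding per by (metis path_image_reversepath)
  show "right_side b (a + 2 * pi) = right_side a b" "left_side b (a + 2 * pi) = left_side a b"
    unfolding right_side_def left_side_def F_period using 1 2 by (auto, metis+)
next
  fix a b c :: real assume o: "a < c" "c < b" "b < a + 2 * pi"
  show "right_side a c \<inter> left_side c b = {}" "left_side a c \<inter> right_side c b = {}"
    unfolding right_side_def left_side_def using adjacent_arcs_disjoint[OF o] by blast+
qed (auto simp: right_side_def left_side_def)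

lemma arc_interior:
  fixes g :: "real \<Rightarrow> real^3"
  assumes "arc g"
  shows "path_connected (path_image g - {pathstart g, pathfinish g})" "infinite (path_image g - {pathstart g, pathfinish g})"
proof -
  have inj: "inj_on g {0..1}" and cont: "continuous_on {0..1} g" using assms by (auto simp: arc_def path_def)
  have "{0<..<1::real} = {0..1} - {0, 1}" by auto
  then have "g ` {0<..<1} = g ` {0..1} - g ` {0, 1}"
    using inj_on_image_set_diff[OF inj, of "{0..1}" "{0,1}"] by simp
  then have eq: "path_image g - {pathstart g, pathfinish g} = g ` {0<..<1}"
    by (simp add: path_image_def pathstart_def pathfinish_def)
  show "path_connected (path_image g - {pathstart g, pathfinish g})" unfolding eq
    by (rule path_connected_continuous_image) (use cont in \<open>auto intro: continuous_on_subset convex_imp_path_connected\<close>)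
  have "uncountable (path_image g)" by (rule arc_image_uncountable[OF assms])
  then show "infinite (path_image g - {pathstart g, pathfinish g})"
    using uncountable_infinite by (metis finite.emptyI finite_insert infinite_remove Diff_insert)
qed

text \<open>
  Two choices of the arcs \<open>g\<close> and \<open>h\<close> for the same interval have the same images, because right and left
  sides are disjoint and their union is the boundary without the two ends.
\<close>

lemma path_sides_wheel: "path_sides f right_side left_side"
proof -
  interpret S: sides f right_side left_side by (rule sides_wheel)
  have single: "right_side a b = path_image g - {F a, F b} \<and> left_side a b = path_image h - {F a, F b}"
    if v: "S.valid a b" and rl: "right_left_arcs f a b g h" for a b g h
  proof -
    have dis: "right_side a b \<inter> left_side a b = {}" by (rule S.sides_disjoint[OF v])
    have 1: "path_image g - {F a, F b} \<subseteq> right_side a b" "path_image h - {F a, F b} \<subseteq> left_side a b"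
      unfolding right_side_def left_side_def using rl by blast+
    have "right_side a b \<union> left_side a b \<subseteq> bdry (D a b)"
      unfolding right_side_def left_side_def using arcs_bdry by blast
    then have "right_side a b \<union> left_side a b \<subseteq> path_image g \<union> path_image h" using arcs_bdry[OF rl] by simp
    moreover have "F a \<notin> right_side a b \<union> left_side a b" "F b \<notin> right_side a b \<union> left_side a b"
      by (auto simp: right_side_def left_side_def)
    ultimately show ?thesis using dis 1 by blast
  qed
  have ex: "\<exists>g h. arc g \<and> arc h \<and> right_side a b = path_image g - {pathstart g, pathfinish g}
      \<and> left_side a b = path_image h - {pathstart h, pathfinish h}" if v: "S.valid a b" for a b
  proof -
    obtain g h where rl: "right_left_arcs f a b g h" using right_left_arcs_exist v by (metis S.valid_def)
    have "arc g \<and> arc h \<and> pathstart g = F a \<and> pathfinish g = F b \<and> pathstart h = F a \<and> pathfinish h = F b"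
      using rl by (simp add: right_left_arcs_def F_def)
    then show ?thesis using single[OF v rl] by metis
  qed
  show ?thesis
    by unfold_locales (use ex arc_interior in metis)+
qed

end

section \<open>Finite trees assembled from arcs\<close>

lemma arc_first_hit:
  fixes q :: "real \<Rightarrow> 'a::real_normed_vector"
  assumes q: "arc q" and T: "closed T" "pathfinish q \<in> T" "pathstart q \<notin> T"
  obtains g where "arc g" "pathstart g = pathstart q" "pathfinish g \<in> T"
    "path_image g \<inter> T = {pathfinish g}" "path_image g \<subseteq> path_image q"
proof -
  have cont: "continuous_on {0..1} q" using q by (simp add: arc_def path_def)
  define S where "S = {0..1} \<inter> q -` T"
  have "compact S" unfolding S_def
    using continuous_closed_preimage[OF cont _ T(1)] by (metis closed_atLeastAtMost compact_Int_closed compact_Icc inf.left_idem)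
  moreover have "1 \<in> S" using T(2) by (simp add: S_def pathfinish_def)
  ultimately obtain s where s: "s \<in> S" "\<And>t. t \<in> S \<Longrightarrow> s \<le> t"
    using compact_attains_inf[of S] by blast
  have s0: "s \<noteq> 0" using s(1) T(3) by (auto simp: S_def pathstart_def)
  have s01: "0 < s" "s \<le> 1" using s s0 by (auto simp: S_def less_le)
  have im: "path_image (subpath 0 s q) = q ` {0..s}" using s01 by (simp add: path_image_subpath)
  show thesis
  proof (rule that[of "subpath 0 s q"])
    show "arc (subpath 0 s q)" using q s01 by (auto intro!: arc_subpath_arc)
    show "path_image (subpath 0 s q) \<subseteq> path_image q" unfolding im using s01 by (auto simp: path_image_def)
    show "pathstart (subpath 0 s q) = pathstart q" by (simp add: pathstart_def subpath_def)
    have fin: "pathfinish (subpath 0 s q) = q s" by (simp add: pathfinish_def subpath_def)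
    show "pathfinish (subpath 0 s q) \<in> T" unfolding fin using s by (simp add: S_def)
    show "path_image (subpath 0 s q) \<inter> T = {pathfinish (subpath 0 s q)}"
    proof
      show "path_image (subpath 0 s q) \<inter> T \<subseteq> {pathfinish (subpath 0 s q)}"
      proof
        fix y assume "y \<in> path_image (subpath 0 s q) \<inter> T"
        then obtain t where t: "t \<in> {0..s}" "y = q t" "q t \<in> T" unfolding im by auto
        then have "t \<in> S" using s01 by (auto simp: S_def)
        then have "t = s" using s(2) t(1) by force
        then show "y \<in> {pathfinish (subpath 0 s q)}" using t fin by simp
      qed
      show "{pathfinish (subpath 0 s q)} \<subseteq> path_image (subpath 0 s q) \<inter> T"
        unfolding fin im using s s01 by (auto simp: S_def)
    qed
  qed
qed

text \<open>
  A rooted tree of arcs with vertices \<open>pt v\<close>, where \<open>\<gamma> v\<close> is the edge that joins \<open>v\<close> to its parent. The rank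
  grows along the edges. It is real so that a new vertex fits between a vertex and its parent.
\<close>

locale arc_tree =
  fixes V :: "nat set" and r :: nat and par :: "nat \<Rightarrow> nat" and rk :: "nat \<Rightarrow> real"
    and pt :: "nat \<Rightarrow> 'a::real_normed_vector" and \<gamma> :: "nat \<Rightarrow> real \<Rightarrow> 'a"
  assumes fin: "finite V" and root: "r \<in> V"
    and par: "v \<in> V - {r} \<Longrightarrow> par v \<in> V" "v \<in> V - {r} \<Longrightarrow> rk (par v) < rk v"
    and arcs: "v \<in> V - {r} \<Longrightarrow> arc (\<gamma> v)" "v \<in> V - {r} \<Longrightarrow> pathstart (\<gamma> v) = pt (par v)"
      "v \<in> V - {r} \<Longrightarrow> pathfinish (\<gamma> v) = pt v"
    and inj: "inj_on pt V"
    and meet_vertices: "v \<in> V - {r} \<Longrightarrow> path_image (\<gamma> v) \<inter> pt ` V \<subseteq> {pt (par v), pt v}"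
    and meet_arcs: "v \<in> V - {r} \<Longrightarrow> w \<in> V - {r} \<Longrightarrow> v \<noteq> w \<Longrightarrow> path_image (\<gamma> v) \<inter> path_image (\<gamma> w) \<subseteq> pt ` V"
begin

definition T :: "'a set" where "T = pt ` V \<union> (\<Union>v\<in>V - {r}. path_image (\<gamma> v))"

definition E :: "nat set set" where "E = (\<lambda>v. {v, par v}) ` (V - {r})"

lemma compact_T: "compact T"
proof -
  have "compact (pt ` V)" using fin by (simp add: finite_imp_compact)
  moreover have "compact (\<Union>v\<in>V - {r}. path_image (\<gamma> v))"
    by (rule compact_UN) (use fin arcs(1) in \<open>auto simp: compact_arc_image\<close>)
  ultimately show ?thesis unfolding T_def by (rule compact_Un)
qed

lemma edge_cases: assumes "{x, y} \<in> E" "rk y \<le> rk x" shows "x \<in> V - {r}" "y = par x"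
proof -
  obtain v where v: "v \<in> V - {r}" "{x, y} = {v, par v}" using assms(1) by (auto simp: E_def)
  show "x \<in> V - {r}" "y = par x" using v par(2)[OF v(1)] assms(2) by (auto simp: doubleton_eq_iff)
qed

lemma edges_sym: "sym {(x, y). {x, y} \<in> E}"
  by (auto simp: sym_def insert_commute)

lemma root_induct [consumes 1, case_names base step]:
  assumes "v \<in> V" and r: "Q r" and step: "\<And>v. v \<in> V - {r} \<Longrightarrow> Q (par v) \<Longrightarrow> Q v"
  shows "Q v"
  using assms(1)
proof (induction "card {w \<in> V. rk w < rk v}" arbitrary: v rule: less_induct)
  case less
  show ?case
  proof (cases "v = r")
    case False
    then have v: "v \<in> V - {r}" using less by auto
    have "{w \<in> V. rk w < rk (par v)} \<subset> {w \<in> V. rk w < rk v}" using par[OF v] by force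
    then have "card {w \<in> V. rk w < rk (par v)} < card {w \<in> V. rk w < rk v}"
      using fin by (intro psubset_card_mono) auto
    then show ?thesis using less(1) par(1)[OF v] step[OF v] by blast
  qed (use r in simp)
qed

lemma reach_root: "v \<in> V \<Longrightarrow> (v, r) \<in> {(x, y). {x, y} \<in> E}\<^sup>*"
proof (induction rule: root_induct)
  case (step v)
  then have "(v, par v) \<in> {(x, y). {x, y} \<in> E}" by (auto simp: E_def)
  then show ?case using step by (meson converse_rtrancl_into_rtrancl)
qed simp

text \<open>
  A vertex of maximal rank on a cycle has two neighbours of smaller rank, but only its parent is one.
\<close>

lemma no_graph_cycle: "\<not> graph_cycle E p"
proof
  assume c: "graph_cycle E p"
  define n where "n = length p"
  have n: "3 \<le> n" and d: "distinct p" and e: "\<And>i. i < n \<Longrightarrow> {p ! i, p ! (Suc i mod n)} \<in> E"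
    using c by (auto simp: graph_cycle_def n_def)
  have "{..<n} \<noteq> {}" using n by (simp add: lessThan_empty_iff)
  then have "Max ((\<lambda>i. rk (p ! i)) ` {..<n}) \<in> (\<lambda>i. rk (p ! i)) ` {..<n}" by (intro Max_in) auto
  then obtain i where i: "i < n" "Max ((\<lambda>i. rk (p ! i)) ` {..<n}) = rk (p ! i)" by auto
  have mx: "rk (p ! j) \<le> rk (p ! i)" if "j < n" for j
    unfolding i(2)[symmetric] using that by (intro Max_ge) auto
  define j where "j = Suc i mod n"
  define k where "k = (if i = 0 then n - 1 else i - 1)"
  have jk: "j < n" "k < n" using n i by (auto simp: j_def k_def)
  have ki: "Suc k mod n = i" using n i by (auto simp: k_def)
  have "p ! j = par (p ! i)" using edge_cases(2)[of "p ! i" "p ! j"] e[OF i(1)] mx[OF jk(1)] by (simp add: j_def)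
  moreover have "p ! k = par (p ! i)"
    using edge_cases(2)[of "p ! i" "p ! k"] e[OF jk(2)] mx[OF jk(2)] by (simp add: ki insert_commute)
  ultimately have "j = k" using d jk by (metis n_def nth_eq_iff_index_eq)
  moreover have "j \<noteq> k"
  proof (cases "Suc i < n")
    case True
    then show ?thesis using n by (auto simp: j_def k_def)
  next
    case False
    then have "Suc i = n" using i by simp
    then show ?thesis using n by (auto simp: j_def k_def)
  qed
  ultimately show False by simp
qed

lemma finite_tree_graph_E: "finite_tree_graph V E"
  unfolding finite_tree_graph_def
proof (intro conjI ballI)
  show "finite V" "V \<noteq> {}" using fin root by auto
  show "\<exists>u\<in>V. \<exists>v\<in>V. u \<noteq> v \<and> e = {u, v}" if e: "e \<in> E" for e
  proof -
    obtain v where v: "v \<in> V - {r}" "e = {v, par v}" using e by (auto simp: E_def)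
    then show ?thesis using par[OF v(1)] by (intro bexI[of _ v] bexI[of _ "par v"]) auto
  qed
  show "(u, v) \<in> {(x, y). {x, y} \<in> E}\<^sup>*" if "u \<in> V" "v \<in> V" for u v
  proof -
    have "(r, v) \<in> {(x, y). {x, y} \<in> E}\<^sup>*" 
      by (rule symD[OF sym_rtrancl[OF edges_sym] reach_root[OF that(2)]])
    then show ?thesis using reach_root[OF that(1)] by (meson rtrancl_trans)
  qed
  show "\<not> (\<exists>p. graph_cycle E p)" using no_graph_cycle by blast
qed

definition vertex_coord :: "nat \<Rightarrow> nat \<Rightarrow> real" where
  "vertex_coord w = (\<lambda>i. if i = w then 1 else 0)"

definition edge_coord :: "nat \<Rightarrow> real \<Rightarrow> nat \<Rightarrow> real" where
  "edge_coord v s = (\<lambda>i. if i = v then s else if i = par v then 1 - s else 0)"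

text \<open>
  Relates a point of the tree to its barycentric coordinates. Only inner points of an edge are described
  by the edge, so that every point has exactly one description.
\<close>

definition coords :: "'a \<Rightarrow> (nat \<Rightarrow> real) \<Rightarrow> bool" where
  "coords x y \<longleftrightarrow> (\<exists>w\<in>V. x = pt w \<and> y = vertex_coord w) \<or>
     (\<exists>v\<in>V - {r}. \<exists>s. 0 < s \<and> s < 1 \<and> x = \<gamma> v s \<and> y = edge_coord v s)"

lemma par_ne: "v \<in> V - {r} \<Longrightarrow> par v \<noteq> v"
  using par(2) by fastforce

lemma arc_at: "v \<in> V - {r} \<Longrightarrow> \<gamma> v 0 = pt (par v)" "v \<in> V - {r} \<Longrightarrow> \<gamma> v 1 = pt v"
  using arcs(2,3) by (auto simp: pathstart_def pathfinish_def)

lemma arc_inj: "v \<in> V - {r} \<Longrightarrow> s \<in> {0..1} \<Longrightarrow> t \<in> {0..1} \<Longrightarrow> \<gamma> v s = \<gamma> v t \<Longrightarrow> s = t"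
  using arcs(1)[of v] by (auto simp: arc_def inj_on_def)

lemma interior_not_vertex: 
  assumes "v \<in> V - {r}" "0 < s" "s < 1" shows "\<gamma> v s \<notin> pt ` V"
proof
  assume "\<gamma> v s \<in> pt ` V"
  moreover have "\<gamma> v s \<in> path_image (\<gamma> v)" unfolding path_image_def by (rule imageI) (use assms in auto)
  ultimately have "\<gamma> v s \<in> {\<gamma> v 0, \<gamma> v 1}" using meet_vertices[OF assms(1)] arc_at[OF assms(1)] by auto
  then show False using arc_inj[OF assms(1), of s 0] arc_inj[OF assms(1), of s 1] assms by auto
qed

lemma coords_edge:
  assumes v: "v \<in> V - {r}" and s: "s \<in> {0..1}" shows "coords (\<gamma> v s) (edge_coord v s)"
proof -
  consider "s = 0" | "s = 1" | "0 < s" "s < 1" using s by fastforce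
  then show ?thesis
  proof cases
    case 1
    then have "edge_coord v s = vertex_coord (par v)" using par_ne[OF v] by (auto simp: edge_coord_def vertex_coord_def)
    then show ?thesis using 1 arc_at(1)[OF v] par(1)[OF v] by (auto simp: coords_def)
  next
    case 2
    then have "edge_coord v s = vertex_coord v" by (auto simp: edge_coord_def vertex_coord_def)
    then show ?thesis using 2 arc_at(2)[OF v] v by (auto simp: coords_def)
  next
    case 3
    then show ?thesis using v by (auto simp: coords_def)
  qed
qed

lemma coords_functional: assumes "coords x y" "coords x y'" shows "y = y'"
proof (cases "x \<in> pt ` V")
  case True
  then obtain w where w: "w \<in> V" "x = pt w" by auto
  have "z = vertex_coord w" if "coords x z" for z
    using that True w interior_not_vertex inj unfolding coords_def by (metis inj_onD)
  then show ?thesis using assms by metis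
next
  case False
  obtain v s where v: "v \<in> V - {r}" "0 < s" "s < 1" "x = \<gamma> v s" "y = edge_coord v s"
    using assms(1) False unfolding coords_def by blast
  obtain v' s' where v': "v' \<in> V - {r}" "0 < s'" "s' < 1" "x = \<gamma> v' s'" "y' = edge_coord v' s'"
    using assms(2) False unfolding coords_def by blast
  have "x \<in> path_image (\<gamma> v)" unfolding path_image_def v(4) by (rule imageI) (use v in auto)
  moreover have "x \<in> path_image (\<gamma> v')" unfolding path_image_def v'(4) by (rule imageI) (use v' in auto)
  ultimately have "v = v'" using meet_arcs[OF v(1) v'(1)] False by blast
  then show ?thesis using arc_inj[OF v(1), of s s'] v v' by auto
qed

lemma support_vertex: "{i. vertex_coord w i \<noteq> 0} = {w}"
  by (auto simp: vertex_coord_def)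

lemma support_edge: "0 < s \<Longrightarrow> s < 1 \<Longrightarrow> {i. edge_coord v s i \<noteq> 0} = {v, par v}"
  by (auto simp: edge_coord_def)

lemma coords_injective: assumes "coords x y" "coords x' y" shows "x = x'"
proof -
  have sp: "v = w" if "{v, par v} = {w, par w}" "v \<in> V - {r}" "w \<in> V - {r}" for v w
    using that par(2)[OF that(2)] par(2)[OF that(3)] by (auto simp: doubleton_eq_iff)
  from assms(1) consider (v) w where "w \<in> V" "x = pt w" "y = vertex_coord w"
    | (e) v s where "v \<in> V - {r}" "0 < s" "s < 1" "x = \<gamma> v s" "y = edge_coord v s" unfolding coords_def by blast
  then show ?thesis
  proof cases
    case v
    then have supp: "{i. y i \<noteq> 0} = {w}" by (simp add: support_vertex)
    from assms(2) consider w' where "w' \<in> V" "x' = pt w'" "y = vertex_coord w'"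
      | v' s' where "v' \<in> V - {r}" "0 < s'" "s' < 1" "y = edge_coord v' s'" unfolding coords_def by blast
    then show ?thesis
    proof cases
      case 1
      then have "{w} = {w'}" using supp by (simp add: support_vertex)
      then show ?thesis using v 1 by simp
    next
      case 2
      have "{w} = {v', par v'}" using supp unfolding 2(4) support_edge[OF 2(2,3)] by (rule sym)
      then have "par v' = v'" by (metis insertCI singletonD)
      then show ?thesis using par_ne[OF 2(1)] by simp
    qed
  next
    case e
    then have supp: "{i. y i \<noteq> 0} = {v, par v}" by (simp add: support_edge)
    from assms(2) consider w' where "w' \<in> V" "y = vertex_coord w'"
      | v' s' where "v' \<in> V - {r}" "0 < s'" "s' < 1" "x' = \<gamma> v' s'" "y = edge_coord v' s'" unfolding coords_def by blast
    then show ?thesis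
    proof cases
      case 1
      have "{w'} = {v, par v}" using supp unfolding 1(2) support_vertex .
      then have "par v = v" by (metis insertCI singletonD)
      then show ?thesis using par_ne[OF e(1)] by simp
    next
      case 2
      have "{v', par v'} = {v, par v}" using supp unfolding 2(5) support_edge[OF 2(2,3)] .
      then have "v' = v" using sp 2 e by blast
      moreover have "s = s'" using 2(5) e(5) \<open>v' = v\<close> unfolding edge_coord_def by (metis (full_types))
      ultimately show ?thesis using 2 e by simp
    qed
  qed
qed

lemma coords_total: assumes "x \<in> T" shows "\<exists>y. coords x y"
proof (cases "x \<in> pt ` V")
  case True
  then show ?thesis by (auto simp: coords_def)
next
  case False
  then obtain v where "v \<in> V - {r}" "x \<in> path_image (\<gamma> v)" using assms by (auto simp: T_def)
  then show ?thesis using coords_edge unfolding path_image_def by blast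
qed

lemma coords_in_realization: assumes "coords x y" shows "x \<in> T" "y \<in> graph_realization V E"
proof -
  from assms consider (v) w where "w \<in> V" "x = pt w" "y = vertex_coord w"
    | (e) v s where "v \<in> V - {r}" "0 < s" "s < 1" "x = \<gamma> v s" "y = edge_coord v s" unfolding coords_def by blast
  then have "x \<in> T \<and> y \<in> graph_realization V E"
  proof cases
    case v
    then have "(\<Sum>i\<in>V. y i) = 1" using fin by (simp add: vertex_coord_def sum.delta)
    moreover have "{i. y i \<noteq> 0} \<in> (\<lambda>v. {v}) ` V" using v by (simp add: support_vertex)
    moreover have "\<forall>i. 0 \<le> y i" using v by (simp add: vertex_coord_def)
    ultimately show ?thesis using v by (simp add: T_def graph_realization_def)
  next
    case e
    have "(\<Sum>i\<in>V. y i) = (\<Sum>i\<in>{v, par v}. y i)"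
      by (rule sum.mono_neutral_right) (use e fin par(1)[OF e(1)] in \<open>auto simp: edge_coord_def\<close>)
    also have "\<dots> = 1" using e par_ne[OF e(1)] by (simp add: edge_coord_def)
    finally have "(\<Sum>i\<in>V. y i) = 1" .
    moreover have "{i. y i \<noteq> 0} \<in> E" using e by (simp add: support_edge E_def)
    moreover have "\<forall>i. 0 \<le> y i" using e by (simp add: edge_coord_def)
    moreover have "x \<in> path_image (\<gamma> v)" unfolding path_image_def using e by auto
    ultimately show ?thesis using e by (auto simp: T_def graph_realization_def)
  qed
  then show "x \<in> T" "y \<in> graph_realization V E" by auto
qed

lemma coords_onto: assumes y: "y \<in> graph_realization V E" shows "\<exists>x. coords x y"
proof -
  have nn: "\<forall>i. 0 \<le> y i" and sm: "(\<Sum>i\<in>V. y i) = 1" and sp: "{i. y i \<noteq> 0} \<in> (\<lambda>v. {v}) ` V \<union> E"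
    using y by (auto simp: graph_realization_def)
  from sp consider (v) w where "w \<in> V" "{i. y i \<noteq> 0} = {w}" | (e) v where "v \<in> V - {r}" "{i. y i \<noteq> 0} = {v, par v}"
    unfolding E_def by blast
  then show ?thesis
  proof cases
    case v
    have z: "y i = 0" if "i \<noteq> w" for i using v(2) that by blast
    have "(\<Sum>i\<in>V. y i) = (\<Sum>i\<in>{w}. y i)" by (rule sum.mono_neutral_right) (use v fin z in auto)
    then have "y w = 1" using sm by simp
    then have "y = vertex_coord w" using z by (auto simp: vertex_coord_def)
    then show ?thesis using v by (auto simp: coords_def)
  next
    case e
    have z: "y i = 0" if "i \<noteq> v" "i \<noteq> par v" for i using e(2) that by blast
    have "(\<Sum>i\<in>V. y i) = (\<Sum>i\<in>{v, par v}. y i)"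
      by (rule sum.mono_neutral_right) (use e par(1)[OF e(1)] fin z in auto)
    then have s: "y v + y (par v) = 1" using sm par_ne[OF e(1)] by simp
    have "y v \<noteq> 0" "y (par v) \<noteq> 0" using e(2) by auto
    then have "0 < y v" "0 < y (par v)" using nn by (auto simp: less_le)
    then have "y v \<in> {0..1}" using s by auto
    moreover have "y = edge_coord v (y v)" using z s by (auto simp: edge_coord_def)
    ultimately show ?thesis using coords_edge[OF e(1)] by metis
  qed
qed

text \<open>
  The coordinates depend continuously on the point of each edge, hence of the tree. The coordinate map is
  bijective and the tree is compact, so the map is a homeomorphism.
\<close>

lemma topological_finite_tree_T: "topological_finite_tree T"
proof -
  define q where "q x = (THE y. coords x y)" for x
  have q: "q x = y" if "coords x y" for x y
    unfolding q_def using that coords_functional by (intro the_equality) auto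
  have qT: "coords x (q x)" if "x \<in> T" for x using coords_total[OF that] q by metis
  have "continuous_on T q"
  proof -
    have "T = pt ` V \<union> (\<Union>v\<in>V - {r}. path_image (\<gamma> v))" by (rule T_def)
    moreover have "continuous_on (pt ` V \<union> (\<Union>v\<in>V - {r}. path_image (\<gamma> v))) q"
    proof (rule continuous_on_closed_Un)
      show "closed (pt ` V)" using fin by (simp add: finite_imp_closed)
      show "closed (\<Union>v\<in>V - {r}. path_image (\<gamma> v))"
        using fin arcs(1) by (intro closed_UN) (auto simp: closed_arc_image)
      show "continuous_on (pt ` V) q" using fin by (simp add: continuous_on_finite)
      show "continuous_on (\<Union>v\<in>V - {r}. path_image (\<gamma> v)) q"
      proof (rule continuous_on_closed_Union)
        show "finite (V - {r})" using fin by simp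
        fix v assume v: "v \<in> V - {r}"
        show "closed (path_image (\<gamma> v))" using arcs(1)[OF v] by (rule closed_arc_image)
        obtain h where h: "homeomorphism {0..1} (path_image (\<gamma> v)) (\<gamma> v) h"
          using homeomorphism_arc[OF arcs(1)[OF v]] by blast
        have qe: "q x = edge_coord v (h x)" if "x \<in> path_image (\<gamma> v)" for x
        proof -
          have "h x \<in> {0..1}" using homeomorphism_image2[OF h] that by blast
          then show ?thesis using coords_edge[OF v, of "h x"] homeomorphism_apply2[OF h that] q by simp
        qed
        have "continuous_on (path_image (\<gamma> v)) (\<lambda>x. edge_coord v (h x) i)" for i
          unfolding edge_coord_def using homeomorphism_cont2[OF h]
          by (cases "i = v"; cases "i = par v") (auto intro!: continuous_intros)
        then have "continuous_on (path_image (\<gamma> v)) (\<lambda>x. edge_coord v (h x))"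
          by (rule continuous_on_coordinatewise_then_product)
        then show "continuous_on (path_image (\<gamma> v)) q"
          using qe by (simp cong: continuous_on_cong)
      qed
    qed
    ultimately show ?thesis by simp
  qed
  moreover have "q ` T = graph_realization V E"
  proof
    show "q ` T \<subseteq> graph_realization V E" using coords_in_realization(2)[OF qT] by blast
    show "graph_realization V E \<subseteq> q ` T"
    proof
      fix y assume "y \<in> graph_realization V E"
      then obtain x where "coords x y" using coords_onto by blast
      then show "y \<in> q ` T" using q coords_in_realization(1) by blast
    qed
  qed
  moreover have "inj_on q T"
  proof (rule inj_onI)
    fix x x' assume "x \<in> T" "x' \<in> T" "q x = q x'"
    then show "x = x'" using coords_injective[of x "q x" x'] qT[of x] qT[of x'] by simp
  qed
  ultimately have "\<exists>g. homeomorphism T (graph_realization V E) q g"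
    by (intro homeomorphism_compact compact_T)
  then show ?thesis unfolding topological_finite_tree_def homeomorphic_def using finite_tree_graph_E by blast
qed

lemma path_connected_T: "path_connected T"
proof -
  have vr: "path_component T (pt v) (pt r)" if "v \<in> V" for v
    using that
  proof (induction rule: root_induct)
    case base
    then show ?case using root by (auto simp: T_def intro: path_component_refl)
  next
    case (step v)
    have "path_image (\<gamma> v) \<subseteq> T" using step by (auto simp: T_def)
    then have "path_component T (pt (par v)) (pt v)"
      unfolding path_component_def using arcs[OF step(1)] arc_imp_path by blast
    then show ?case using step(2) path_component_sym path_component_trans by metis
  qed
  have "path_component T x (pt r)" if x: "x \<in> T" for x
  proof (cases "x \<in> pt ` V")
    case True then show ?thesis using vr by auto
  next
    case False
    then obtain v where v: "v \<in> V - {r}" "x \<in> path_image (\<gamma> v)" using x by (auto simp: T_def)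
    have "path_connected (path_image (\<gamma> v))" using arcs(1)[OF v(1)] by (simp add: arc_imp_path path_connected_path_image)
    then have "path_component (path_image (\<gamma> v)) x (pt v)"
      using v arcs(3)[OF v(1)] pathfinish_in_path_image[of "\<gamma> v"] by (auto simp: path_connected_component)
    then have "path_component T x (pt v)" by (rule path_component_of_subset[rotated]) (use v in \<open>auto simp: T_def\<close>)
    then show ?thesis using vr[of v] v path_component_trans by blast
  qed
  then show ?thesis unfolding path_connected_component using path_component_sym path_component_trans by metis
qed

lemma fresh: obtains n where "n \<notin> V" using fin ex_new_if_finite infinite_UNIV_nat by blast

text \<open>
  A tree grows by arcs that are attached at a vertex; \<open>subdivide\<close> turns any point of the tree into one.
\<close>

lemma add_leaf:
  assumes k: "k \<in> V" and g: "arc g" "pathstart g = pt k" "path_image g \<inter> T = {pt k}"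
  obtains V' par' rk' pt' \<gamma>' where "arc_tree V' r par' rk' pt' \<gamma>'"
    "arc_tree.T V' r pt' \<gamma>' = T \<union> path_image g"
proof -
  obtain n where n: "n \<notin> V" by (rule fresh)
  define z where "z = pathfinish g"
  have zk: "z \<noteq> pt k" using g(1,2) arc_distinct_ends unfolding z_def by metis
  have zg: "z \<in> path_image g" by (simp add: z_def pathfinish_in_path_image)
  have zT: "z \<notin> T" using zk zg g(3) by auto
  have nr: "n \<noteq> r" using n root by auto
  let ?V = "insert n V" and ?par = "par(n := k)" and ?rk = "rk(n := rk k + 1)" and ?pt = "pt(n := z)" and ?\<gamma> = "\<gamma>(n := g)"
  have im: "?pt ` ?V = insert z (pt ` V)" using n by auto
  have vT: "pt ` V \<subseteq> T" "\<And>v. v \<in> V - {r} \<Longrightarrow> path_image (\<gamma> v) \<subseteq> T" by (auto simp: T_def)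
  have old: "v \<in> V - {r}" "v \<noteq> n" if "v \<in> ?V - {r}" "v \<noteq> n" for v using that by auto
  have parn: "par v \<noteq> n" if "v \<in> V - {r}" for v using par(1)[OF that] n by auto
  have tree: "arc_tree ?V r ?par ?rk ?pt ?\<gamma>"
  proof
    show "finite ?V" "r \<in> ?V" using fin root by auto
    show "inj_on ?pt ?V" using inj n zT vT(1) by (auto simp: inj_on_def)
    fix v assume v: "v \<in> ?V - {r}"
    show "?par v \<in> ?V" using v k par(1) by auto
    show "?rk (?par v) < ?rk v" using v n k par(2) parn by (cases "v = n") auto
    show "arc (?\<gamma> v)" using v g arcs(1) by (cases "v = n") auto
    show "pathstart (?\<gamma> v) = ?pt (?par v)" using v g(2) arcs(2) n k parn by (cases "v = n") auto
    show "pathfinish (?\<gamma> v) = ?pt v" using v arcs(3) by (cases "v = n") (auto simp: z_def)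
    show "path_image (?\<gamma> v) \<inter> ?pt ` ?V \<subseteq> {?pt (?par v), ?pt v}"
    proof (cases "v = n")
      case True
      have kn: "k \<noteq> n" using k n by auto
      show ?thesis unfolding im using True g(3) vT(1) kn by auto
    next
      case False
      then have v': "v \<in> V - {r}" using v by auto
      have "z \<notin> path_image (\<gamma> v)" using vT(2)[OF v'] zT by auto
      then show ?thesis unfolding im using False meet_vertices[OF v'] parn[OF v'] by auto
    qed
    fix w assume w: "w \<in> ?V - {r}" "v \<noteq> w"
    have A: "path_image g \<inter> path_image (\<gamma> u) \<subseteq> pt ` V" if "u \<in> V - {r}" for u
      using g(3) vT(2)[OF that] k by auto
    show "path_image (?\<gamma> v) \<inter> path_image (?\<gamma> w) \<subseteq> ?pt ` ?V"
    proof (cases "v = n")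
      case True
      then have "w \<in> V - {r}" "w \<noteq> n" using w old by auto
      then show ?thesis unfolding im using A[of w] True by auto
    next
      case False
      then have v': "v \<in> V - {r}" using old v by auto
      show ?thesis
      proof (cases "w = n")
        case True
        then show ?thesis unfolding im using A[OF v'] False by auto
      next
        case False
        then have "w \<in> V - {r}" using old w by auto
        then show ?thesis unfolding im using meet_arcs[OF v' _ w(2)] \<open>v \<noteq> n\<close> False by auto
      qed
    qed
  qed
  have unchanged: "(\<Union>v\<in>V - {r}. path_image (?\<gamma> v)) = (\<Union>v\<in>V - {r}. path_image (\<gamma> v))"
    by (rule SUP_cong) (use n in auto)
  have "arc_tree.T ?V r ?pt ?\<gamma> = ?pt ` ?V \<union> (\<Union>v\<in>?V - {r}. path_image (?\<gamma> v))"
    by (rule arc_tree.T_def[OF tree])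
  also have "?V - {r} = insert n (V - {r})" using nr by auto
  also have "(\<Union>v\<in>insert n (V - {r}). path_image (?\<gamma> v)) = path_image g \<union> (\<Union>v\<in>V - {r}. path_image (\<gamma> v))"
    unfolding UN_insert unchanged by simp
  finally have eq: "arc_tree.T ?V r ?pt ?\<gamma> = ?pt ` ?V \<union> (path_image g \<union> (\<Union>v\<in>V - {r}. path_image (\<gamma> v)))" .
  have "arc_tree.T ?V r ?pt ?\<gamma> = T \<union> path_image g" unfolding eq im T_def using zg by blast
  then show thesis using that tree by blast
qed

lemma subdivide:
  assumes y: "y \<in> T"
  obtains V' par' rk' pt' \<gamma>' k where "arc_tree V' r par' rk' pt' \<gamma>'" "arc_tree.T V' r pt' \<gamma>' = T" "k \<in> V'" "pt' k = y"
proof (cases "y \<in> pt ` V")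
  case True
  then obtain k where "k \<in> V" "pt k = y" by auto
  then show thesis using that[of V par rk pt \<gamma> k] arc_tree_axioms by blast
next
  case False
  then obtain k where k: "k \<in> V - {r}" "y \<in> path_image (\<gamma> k)" using y by (auto simp: T_def)
  have yk: "y \<noteq> pt k" "y \<noteq> pt (par k)" using False k par(1)[OF k(1)] by auto
  obtain g1 g2 where g: "arc g1" "arc g2" "pathstart g1 = pt (par k)" "pathfinish g1 = y"
    "pathstart g2 = y" "pathfinish g2 = pt k" "path_image g1 \<union> path_image g2 = path_image (\<gamma> k)"
    "path_image g1 \<inter> path_image g2 = {y}"
  proof -
    obtain s where s: "0 < s" "s < 1" "\<gamma> k s = y" "arc (subpath 0 s (\<gamma> k))" "arc (subpath s 1 (\<gamma> k))"
      "path_image (subpath 0 s (\<gamma> k)) \<union> path_image (subpath s 1 (\<gamma> k)) = path_image (\<gamma> k)"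
      "path_image (subpath 0 s (\<gamma> k)) \<inter> path_image (subpath s 1 (\<gamma> k)) = {y}"
      using arc_cut[OF arcs(1)[OF k(1)] k(2)] yk arcs(2,3)[OF k(1)] by auto
    show thesis
      by (rule that[OF s(4,5) _ _ _ _ s(6,7)])
        (use s(3) arc_at[OF k(1)] in \<open>auto simp: pathstart_def pathfinish_def subpath_def\<close>)
  qed
  obtain n where n: "n \<notin> V" by (rule fresh)
  have nr: "n \<noteq> r" "n \<noteq> k" using n root k by auto
  let ?V = "insert n V" and ?par = "par(n := par k, k := n)" and ?rk = "rk(n := (rk k + rk (par k)) / 2)"
    and ?pt = "pt(n := y)" and ?\<gamma> = "\<gamma>(n := g1, k := g2)"
  have im: "?pt ` ?V = insert y (pt ` V)" using n by auto
  have parn: "par v \<noteq> n" if "v \<in> V - {r}" for v using par(1)[OF that] n by auto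
  have pk: "par k \<in> V" "rk (par k) < rk k" using par k by auto
  have ends: "pt (par k) \<in> path_image g1" "pt k \<in> path_image g2"
    using g pathstart_in_path_image pathfinish_in_path_image by metis+
  have nin: "pt k \<notin> path_image g1" "pt (par k) \<notin> path_image g2"
    using g(8) ends yk by auto
  have sub: "path_image g1 \<subseteq> path_image (\<gamma> k)" "path_image g2 \<subseteq> path_image (\<gamma> k)" using g(7) by auto
  have mv: "path_image g1 \<inter> pt ` V \<subseteq> {pt (par k)}" "path_image g2 \<inter> pt ` V \<subseteq> {pt k}"
  proof -
    have "path_image g1 \<inter> pt ` V \<subseteq> {pt (par k), pt k}" "path_image g2 \<inter> pt ` V \<subseteq> {pt (par k), pt k}"
      by (rule order_trans[OF Int_mono[OF sub(1) order_refl] meet_vertices[OF k(1)]],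
          rule order_trans[OF Int_mono[OF sub(2) order_refl] meet_vertices[OF k(1)]])
    then show "path_image g1 \<inter> pt ` V \<subseteq> {pt (par k)}" "path_image g2 \<inter> pt ` V \<subseteq> {pt k}"
      using nin by auto
  qed
  have ynot: "y \<notin> path_image (\<gamma> v)" if "v \<in> V - {r}" "v \<noteq> k" for v
    using meet_arcs[OF that(1) k(1) that(2)] False k(2) by blast
  have tree: "arc_tree ?V r ?par ?rk ?pt ?\<gamma>"
  proof
    show "finite ?V" "r \<in> ?V" using fin root by auto
    show "inj_on ?pt ?V" using inj n False by (auto simp: inj_on_def)
    fix v assume v: "v \<in> ?V - {r}"
    consider "v = n" | "v = k" | "v \<noteq> n" "v \<noteq> k" "v \<in> V - {r}" using v by auto
    note cases = this
    show "?par v \<in> ?V" using cases by cases (use nr pk par(1) in auto)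
    show "?rk (?par v) < ?rk v" using cases by cases (use nr pk par(2) parn n k in auto)
    show "arc (?\<gamma> v)" using cases by cases (use nr g arcs(1) in auto)
    show "pathstart (?\<gamma> v) = ?pt (?par v)" using cases by cases (use nr g arcs(2) parn k in auto)
    show "pathfinish (?\<gamma> v) = ?pt v" using cases by cases (use nr g arcs(3) in auto)
    show "path_image (?\<gamma> v) \<inter> ?pt ` ?V \<subseteq> {?pt (?par v), ?pt v}"
      using cases
    proof cases
      case 1 then show ?thesis unfolding im using mv(1) nr parn[OF k(1)] by auto
    next
      case 2 then show ?thesis unfolding im using mv(2) nr by auto
    next
      case 3 then show ?thesis unfolding im using meet_vertices[OF 3(3)] ynot[OF 3(3,2)] parn[OF 3(3)] by auto
    qed
    fix w assume w: "w \<in> ?V - {r}" "v \<noteq> w"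
    have A: "path_image g1 \<inter> path_image (\<gamma> u) \<subseteq> pt ` V" "path_image g2 \<inter> path_image (\<gamma> u) \<subseteq> pt ` V"
      if "u \<in> V - {r}" "u \<noteq> k" for u
      by (rule order_trans[OF Int_mono[OF sub(1) order_refl] meet_arcs[OF k(1) that(1) that(2)[symmetric]]],
          rule order_trans[OF Int_mono[OF sub(2) order_refl] meet_arcs[OF k(1) that(1) that(2)[symmetric]]])
    have w': "w = n \<or> w = k \<or> (w \<noteq> n \<and> w \<noteq> k \<and> w \<in> V - {r})" using w by auto
    show "path_image (?\<gamma> v) \<inter> path_image (?\<gamma> w) \<subseteq> ?pt ` ?V"
      using cases
    proof cases
      case 1
      then show ?thesis unfolding im using w' w(2) nr g(8) A[of w] by auto
    next
      case 2
      then show ?thesis unfolding im using w' w(2) nr g(8) A[of w] by auto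
    next
      case 3
      then have "path_image (\<gamma> v) \<inter> path_image (\<gamma> w) \<subseteq> pt ` V" if "w \<in> V - {r}" using meet_arcs that w(2) by blast
      then show ?thesis unfolding im using 3 w' nr A[of v] by auto
    qed
  qed
  have unchanged: "(\<Union>v\<in>V - {r} - {k}. path_image (?\<gamma> v)) = (\<Union>v\<in>V - {r} - {k}. path_image (\<gamma> v))"
    by (rule SUP_cong) (use n in auto)
  have "arc_tree.T ?V r ?pt ?\<gamma> = ?pt ` ?V \<union> (\<Union>v\<in>?V - {r}. path_image (?\<gamma> v))"
    by (rule arc_tree.T_def[OF tree])
  also have "?V - {r} = insert n (insert k (V - {r} - {k}))" using nr k by auto
  also have "(\<Union>v\<in>insert n (insert k (V - {r} - {k})). path_image (?\<gamma> v)) = path_image g1 \<union> path_image g2 \<union> (\<Union>v\<in>V - {r} - {k}. path_image (\<gamma> v))"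
    unfolding UN_insert unchanged using nr by (simp add: Un_assoc)
  also have "\<dots> = (\<Union>v\<in>V - {r}. path_image (\<gamma> v))" unfolding g(7) using k by auto
  finally have eq: "arc_tree.T ?V r ?pt ?\<gamma> = ?pt ` ?V \<union> (\<Union>v\<in>V - {r}. path_image (\<gamma> v))" .
  have "arc_tree.T ?V r ?pt ?\<gamma> = T" unfolding eq im T_def using k by blast
  then show thesis using that[of ?V ?par ?rk ?pt ?\<gamma> n] tree by simp
qed

end

text \<open>
  A further point is joined to the tree by an arc, which is attached up to its first point in the tree.
\<close>

lemma finite_subset_in_tree:
  fixes Z :: "'a::{complete_space, real_normed_vector} set"
  assumes "finite Q" "Q \<noteq> {}" "Q \<subseteq> Z" and Z: "path_connected Z"
  shows "\<exists>T. Q \<subseteq> T \<and> T \<subseteq> Z \<and> compact T \<and> path_connected T \<and> topological_finite_tree T"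
proof -
  have "\<exists>V r par rk pt \<gamma>. arc_tree V r par rk (pt :: nat \<Rightarrow> 'a) \<gamma> \<and> Q \<subseteq> arc_tree.T V r pt \<gamma> \<and> arc_tree.T V r pt \<gamma> \<subseteq> Z"
    using assms(1-3)
  proof (induction Q rule: finite_ne_induct)
    case (singleton x)
    have tree: "arc_tree {0} 0 id (\<lambda>_. 0) (\<lambda>_. x) (\<lambda>_ _. x)"
      by unfold_locales auto
    have "arc_tree.T {0} 0 (\<lambda>_. x) (\<lambda>_ _. x) = {x}" unfolding arc_tree.T_def[OF tree] by auto
    then show ?case using tree singleton by (metis order_refl)
  next
    case (insert x Q)
    then obtain V r par rk pt \<gamma> where "arc_tree V r par rk (pt :: nat \<Rightarrow> 'a) \<gamma>"
      and QT: "Q \<subseteq> arc_tree.T V r pt \<gamma>" "arc_tree.T V r pt \<gamma> \<subseteq> Z" by auto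
    then interpret A: arc_tree V r par rk pt \<gamma> by simp
    show ?case
    proof (cases "x \<in> A.T")
      case True
      then show ?thesis using QT A.arc_tree_axioms by blast
    next
      case False
      obtain t0 where t0: "t0 \<in> A.T" using insert(2) QT by auto
      then obtain p where p: "path p" "path_image p \<subseteq> Z" "pathstart p = x" "pathfinish p = t0"
        using Z insert(5) QT unfolding path_connected_def by blast
      have "x \<noteq> t0" using t0 False by auto
      then obtain q where q: "arc q" "path_image q \<subseteq> path_image p" "pathstart q = x" "pathfinish q = t0"
        using path_contains_arc[OF p(1,3,4)] by metis
      obtain g where g: "arc g" "pathstart g = x" "pathfinish g \<in> A.T" "path_image g \<inter> A.T = {pathfinish g}" "path_image g \<subseteq> path_image q"
        using arc_first_hit[OF q(1) compact_imp_closed[OF A.compact_T]] q t0 False by metis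
      obtain V1 par1 rk1 pt1 \<gamma>1 k where 1: "arc_tree V1 r par1 rk1 pt1 \<gamma>1" "arc_tree.T V1 r pt1 \<gamma>1 = A.T" "k \<in> V1" "pt1 k = pathfinish g"
        using A.subdivide[OF g(3)] by metis
      interpret B: arc_tree V1 r par1 rk1 pt1 \<gamma>1 by (rule 1(1))
      have leaf: "arc (reversepath g)" "pathstart (reversepath g) = pt1 k" "path_image (reversepath g) \<inter> B.T = {pt1 k}"
        using g 1 by (auto simp: arc_reversepath)
      obtain V2 par2 rk2 pt2 \<gamma>2 where 2: "arc_tree V2 r par2 rk2 pt2 \<gamma>2"
        "arc_tree.T V2 r pt2 \<gamma>2 = B.T \<union> path_image (reversepath g)"
        by (rule B.add_leaf[OF 1(3) leaf])
      have "x \<in> path_image g" using g(2) pathstart_in_path_image by metis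
      then have "insert x Q \<subseteq> arc_tree.T V2 r pt2 \<gamma>2" unfolding 2 using QT 1(2) by auto
      moreover have "arc_tree.T V2 r pt2 \<gamma>2 \<subseteq> Z" unfolding 2 using QT 1(2) g(5) q(2) p(2) by auto
      ultimately show ?thesis using 2(1) by blast
    qed
  qed
  then obtain V r par rk pt \<gamma> where "arc_tree V r par rk (pt :: nat \<Rightarrow> 'a) \<gamma>"
      and QT: "Q \<subseteq> arc_tree.T V r pt \<gamma>" "arc_tree.T V r pt \<gamma> \<subseteq> Z" by blast
  then interpret A: arc_tree V r par rk pt \<gamma> by simp
  show ?thesis using QT A.compact_T A.path_connected_T A.topological_finite_tree_T by blast
qed

section \<open>Short hair\<close>

context path_sides begin

lemma connected_avoiding_bdry:
  assumes ab: "a < b" "b < a + 2 * pi" and S: "connected S" "S \<subseteq> S2" "S \<inter> bdry (D a b) = {}" "S \<inter> D a b \<noteq> {}"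
  shows "S \<subseteq> D a b"
proof -
  have "openin (top_of_set S2) (intr (D a b))" by (simp add: intr_def)
  then obtain O1 where O1: "open O1" "intr (D a b) = S2 \<inter> O1" unfolding openin_open by auto
  have "O1 \<inter> S = {} \<or> (- D a b) \<inter> S = {}"
  proof (rule connectedD[OF S(1) O1(1)])
    show "open (- D a b)" by (rule open_Compl[OF closed_D])
    show "O1 \<inter> - D a b \<inter> S = {}" using O1(2) intr_subset[of a b] S(2) by blast
    show "S \<subseteq> O1 \<union> - D a b" using O1(2) S(2,3) unfolding bdry_eq_diff by blast
  qed
  moreover have "O1 \<inter> S \<noteq> {}" using S O1(2) unfolding bdry_eq_diff by blast
  ultimately show ?thesis by blast
qed

text \<open>
  The intervals may overlap. This freedom is used to choose their final ends such that the two ends have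
  different images.
\<close>

lemma small_cover:
  assumes e: "e > 0"
  shows "\<exists>I. finite I \<and> I \<noteq> {} \<and> (\<forall>(a, b)\<in>I. valid a b) \<and>
    (\<forall>(a, b)\<in>I. \<forall>x\<in>D a b. \<forall>y\<in>D a b. dist x y < e) \<and> (\<forall>y\<in>S2. \<exists>(a, b)\<in>I. y \<in> D a b)"
proof -
  have "uniformly_continuous_on {0..4 * pi} F"
    by (rule compact_uniformly_continuous[OF continuous_F]) auto
  then obtain d where d: "d > 0" "\<And>s t. s \<in> {0..4 * pi} \<Longrightarrow> t \<in> {0..4 * pi} \<Longrightarrow> dist s t < d \<Longrightarrow> dist (F s) (F t) < e"
    using e unfolding uniformly_continuous_on_def by metis
  \<comment> \<open>The intervals start at the multiples of \<open>h\<close> and have length at most \<open>3 / 2 * h\<close>, which is less than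
    \<open>d\<close> and than a full turn.\<close>
  obtain N0 :: nat where N0: "4 * pi / d < real N0" using reals_Archimedean2 by blast
  define N where "N = max N0 3"
  have N: "N \<ge> 3" "4 * pi / d < real N" using N0 by (auto simp: N_def)
  define h where "h = 2 * pi / real N"
  have Nh: "real N * h = 2 * pi" using N by (simp add: h_def)
  have h0: "h > 0" using N pi_gt_zero by (simp add: h_def)
  have h3: "3 * h \<le> 2 * pi" using Nh N(1) h0 by (metis mult_right_mono less_imp_le of_nat_mono of_nat_numeral)
  have hd: "2 * h < d" using N(2) d(1) N(1) by (simp add: h_def field_simps)
  have ex: "\<exists>b\<in>{real k * h + h..real k * h + 3 / 2 * h}. F b \<noteq> F (real k * h)" for k
  proof -
    have "infinite (D (real k * h + h) (real k * h + 3 / 2 * h))" by (rule infinite_D) (use h0 in simp)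
    then have "\<not> D (real k * h + h) (real k * h + 3 / 2 * h) \<subseteq> {F (real k * h)}" by (meson finite.intros finite_subset)
    then show ?thesis unfolding D_def by blast
  qed
  then obtain \<beta> where b: "\<And>k. \<beta> k \<in> {real k * h + h..real k * h + 3 / 2 * h}" "\<And>k. F (\<beta> k) \<noteq> F (real k * h)"
    by metis
  define I where "I = (\<lambda>k. (real k * h, \<beta> k)) ` {..<N}"
  have I: "valid a c \<and> (\<forall>x\<in>D a c. \<forall>y\<in>D a c. dist x y < e)" if ac: "(a, c) \<in> I" for a c
  proof -
    obtain k where k: "k < N" "a = real k * h" "c = \<beta> k" using ac by (auto simp: I_def)
    have bk: "a + h \<le> c" "c \<le> a + 3 / 2 * h" using b(1)[of k] k by auto
    have "F c \<noteq> F a" using b(2)[of k] k by simp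
    then have v: "valid a c" using bk h0 h3 unfolding valid_def by auto
    have "real k * h \<le> real N * h" using k(1) h0 by (intro mult_right_mono) auto
    then have a: "0 \<le> a" "a \<le> 2 * pi" using k(2) h0 Nh by auto
    have "dist x y < e" if xy: "x \<in> D a c" "y \<in> D a c" for x y
    proof -
      obtain s t where st: "s \<in> {a..c}" "x = F s" "t \<in> {a..c}" "y = F t" using xy unfolding D_def by blast
      have "s \<in> {0..4 * pi}" "t \<in> {0..4 * pi}" "dist s t < d"
        using st(1,3) a bk h3 hd h0 by (auto simp: dist_real_def)
      then show ?thesis using d(2) st by blast
    qed
    then show ?thesis using v by blast
  qed
  show ?thesis
  proof (intro exI[of _ I] conjI ballI)
    show "finite I" by (simp add: I_def)
    show "I \<noteq> {}" using N by (auto simp: I_def lessThan_empty_iff)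
    show "case p of (a, b) \<Rightarrow> valid a b" if "p \<in> I" for p using I that by (cases p) auto
    show "case p of (a, b) \<Rightarrow> \<forall>x\<in>D a b. \<forall>y\<in>D a b. dist x y < e" if "p \<in> I" for p
      using I that by (cases p) auto
  next
    fix y assume "y \<in> S2"
    then have "y \<in> D 0 (0 + 2 * pi)" using D_full[of 0] by blast
    then obtain t0 where t0: "0 \<le> t0" "t0 \<le> 2 * pi" "y = F t0" by (auto simp: D_def)
    obtain t where t: "0 \<le> t" "t < 2 * pi" "y = F t"
    proof (cases "t0 = 2 * pi")
      case True
      then show ?thesis using that[of 0] t0 F_period[of 0] pi_gt_zero by simp
    next
      case False
      then show ?thesis using that[of t0] t0 by simp
    qed
    define k where "k = nat \<lfloor>t / h\<rfloor>"
    have "0 \<le> t / h" using t h0 by simp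
    then have k: "real k \<le> t / h" "t / h < real k + 1" unfolding k_def by linarith+
    have k': "real k * h \<le> t" "t < real k * h + h" using k h0 by (auto simp: field_simps)
    have "real k * h < real N * h" using k'(1) t(2) Nh by linarith
    then have "k < N" using h0 by simp
    then have "(real k * h, \<beta> k) \<in> I" by (auto simp: I_def)
    moreover have "y \<in> D (real k * h) (\<beta> k)" using t(3) k' b(1)[of k] by (auto simp: D_def)
    ultimately show "\<exists>(a, b)\<in>I. y \<in> D a b" by blast
  qed
qed

text \<open>
  Otherwise a piece of the path from \<open>u\<close> to \<open>w\<close>, which avoids \<open>T\<close>, and a path between the ends of this
  piece in the union of the two arcs and \<open>T\<close> form a simple closed curve in \<open>Zip\<close>.
\<close>

lemma sides_meet:
  assumes v: "valid a b" "valid c d" and T: "T \<subseteq> Zip" "path_connected T" "T \<inter> P a b \<noteq> {}" "T \<inter> P c d \<noteq> {}"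
    and uw: "u \<in> P a b" "w \<in> P c d" and pc: "path_component (Zip - T) u w"
  shows "P a b \<inter> P c d \<noteq> {}"
proof
  assume dis: "P a b \<inter> P c d = {}"
  obtain t1 t2 where t: "t1 \<in> T" "t1 \<in> P a b" "t2 \<in> T" "t2 \<in> P c d" using T(3,4) by auto
  obtain r1 where r1: "path r1" "path_image r1 \<subseteq> P a b" "pathstart r1 = u" "pathfinish r1 = t1"
    using path_connected_sides(1)[OF v(1)] uw t unfolding path_connected_def by blast
  obtain r2 where r2: "path r2" "path_image r2 \<subseteq> P c d" "pathstart r2 = w" "pathfinish r2 = t2"
    using path_connected_sides(1)[OF v(2)] uw t unfolding path_connected_def by blast
  define K1 where "K1 = path_image r1"
  define K2 where "K2 = path_image r2"
  have K: "closed K1" "closed K2" "K1 \<inter> K2 = {}" "u \<in> K1" "t1 \<in> K1" "w \<in> K2" "t2 \<in> K2"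
    using r1 r2 dis pathstart_in_path_image[of r1] pathfinish_in_path_image[of r1]
      pathstart_in_path_image[of r2] pathfinish_in_path_image[of r2]
    by (auto simp: K1_def K2_def closed_path_image)
  obtain p where p: "path p" "path_image p \<subseteq> Zip - T" "pathstart p = u" "pathfinish p = w"
    using pc unfolding path_component_def by blast
  have "u \<noteq> w" using K by auto
  then obtain q where q: "arc q" "path_image q \<subseteq> path_image p" "pathstart q = u" "pathfinish q = w"
    using path_contains_arc[OF p(1,3,4)] by metis
  \<comment> \<open>Shorten the path to an arc that meets \<open>K1\<close> and \<open>K2\<close> only at its ends.\<close>
  obtain g1 where g1: "arc g1" "pathstart g1 = u" "pathfinish g1 \<in> K2" "path_image g1 \<inter> K2 = {pathfinish g1}"
      "path_image g1 \<subseteq> path_image q"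
    using arc_first_hit[OF q(1) K(2)] q K by (metis disjoint_iff)
  have rg: "arc (reversepath g1)" "pathfinish (reversepath g1) \<in> K1" "pathstart (reversepath g1) \<notin> K1"
    using g1 K by (auto simp: arc_reversepath)
  obtain g2 where g2: "arc g2" "pathstart g2 = pathfinish g1" "pathfinish g2 \<in> K1" "path_image g2 \<inter> K1 = {pathfinish g2}"
      "path_image g2 \<subseteq> path_image g1"
    using arc_first_hit[OF rg(1) K(1) rg(2,3)] by (metis path_image_reversepath pathstart_reversepath)
  define x where "x = pathstart g2"
  define y where "y = pathfinish g2"
  have xy: "x \<in> K2" "y \<in> K1" "x \<noteq> y" using g1 g2 K(3) by (auto simp: x_def y_def)
  have g2K: "path_image g2 \<inter> K1 \<subseteq> {y}" "path_image g2 \<inter> K2 \<subseteq> {x}" "path_image g2 \<inter> T = {}" "path_image g2 \<subseteq> Zip"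
  proof -
    have "path_image g2 \<subseteq> Zip - T" using g2(5) g1(5) q(2) p(2) by (meson order_trans)
    then show "path_image g2 \<inter> T = {}" "path_image g2 \<subseteq> Zip" by auto
    show "path_image g2 \<inter> K1 \<subseteq> {y}" using g2(4) by (simp add: y_def)
    have "path_image g2 \<inter> K2 \<subseteq> path_image g1 \<inter> K2" using g2(5) by blast
    then show "path_image g2 \<inter> K2 \<subseteq> {x}" unfolding g1(4) x_def g2(2) .
  qed
  have "path_connected (K1 \<union> T)"
    by (rule path_connected_Un) (use T(2) r1(1) K(5) t in \<open>auto simp: K1_def path_connected_path_image\<close>)
  then have "path_connected ((K1 \<union> T) \<union> K2)"
    by (rule path_connected_Un) (use r2(1) K(7) t in \<open>auto simp: K2_def path_connected_path_image\<close>)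
  then obtain k0 where k0: "path k0" "path_image k0 \<subseteq> (K1 \<union> T) \<union> K2" "pathstart k0 = y" "pathfinish k0 = x"
    using xy unfolding path_connected_def by blast
  obtain k where k: "arc k" "path_image k \<subseteq> path_image k0" "pathstart k = y" "pathfinish k = x"
    using path_contains_arc[OF k0(1,3,4)] xy by metis
  have kK: "path_image k \<subseteq> (K1 \<union> T) \<union> K2" using k(2) k0(2) by blast
  have sp: "simple_path (g2 +++ k)"
  proof (rule simple_path_join_loop[OF g2(1) k(1)])
    show "path_image g2 \<inter> path_image k \<subseteq> {pathstart g2, pathstart k}"
    proof -
      have "path_image g2 \<inter> path_image k \<subseteq> path_image g2 \<inter> (K1 \<union> T \<union> K2)"
        using kK by (intro Int_mono) auto
      also have "\<dots> \<subseteq> {x, y}" unfolding Int_Un_distrib using g2K(1,2,3) by auto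
      finally show ?thesis unfolding k(3) x_def .
    qed
  qed (use k in \<open>auto simp: x_def y_def\<close>)
  have "K1 \<subseteq> Zip" "K2 \<subseteq> Zip" using r1(2) r2(2) P_subset_Zip v unfolding K1_def K2_def by blast+
  then have "path_image (g2 +++ k) \<subseteq> Zip"
    using kK g2K(4) T(1) k by (auto simp: path_image_join y_def)
  moreover have "pathfinish (g2 +++ k) = pathstart (g2 +++ k)" using k by (simp add: x_def)
  ultimately show False by (intro no_simple_loop[OF sp])
qed

text \<open>
  Let \<open>p\<close> be a path off the tree that meets a boundary of one of the small disks. Before its first and after
  its last point on such a boundary it stays in one disk each. At these two points it is on the arcs \<open>P a b\<close> and \<open>P a' b'\<close> of two disks,
  which intersect by \<open>sides_meet\<close>. So four disks lead from one end of \<open>p\<close> to the other.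
\<close>

lemma short_hair_dist:
  assumes e: "e > 0"
  shows "\<exists>T. T \<subseteq> Zip \<and> compact T \<and> topological_finite_tree T \<and>
     (\<forall>x y. path_component (Zip - T) x y \<longrightarrow> dist x y < e)"
proof -
  have e4: "e / 4 > 0" using e by simp
  obtain I where I12: "finite I" "I \<noteq> {}" and I3: "\<forall>(a, b)\<in>I. valid a b"
    and I4: "\<forall>(a, b)\<in>I. \<forall>x\<in>D a b. \<forall>y\<in>D a b. dist x y < e / 4"
    and I5: "\<forall>y\<in>S2. \<exists>(a, b)\<in>I. y \<in> D a b"
    using small_cover[OF e4] by (elim exE conjE)
  have I: "finite I" "I \<noteq> {}" "\<And>a b. (a, b) \<in> I \<Longrightarrow> valid a b"
    "\<And>a b x y. (a, b) \<in> I \<Longrightarrow> x \<in> D a b \<Longrightarrow> y \<in> D a b \<Longrightarrow> dist x y < e / 4"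
    "\<And>y. y \<in> S2 \<Longrightarrow> \<exists>(a, b)\<in>I. y \<in> D a b"
    using I12 I3 I4 I5 by fast+
  define c where "c = (\<lambda>(a, b). SOME x. x \<in> P a b)"
  have c: "c (a, b) \<in> P a b" if "(a, b) \<in> I" for a b
  proof -
    have "\<exists>x. x \<in> P a b" using infinite_sides(1)[OF I(3)[OF that]] by (metis finite.emptyI ex_in_conv)
    then have "(SOME x. x \<in> P a b) \<in> P a b" by (rule someI_ex)
    then show ?thesis by (simp add: c_def)
  qed
  \<comment> \<open>Images of ends that lie in \<open>Zip\<close> go into the tree, because they are boundary points on neither arc.\<close>
  define Q where "Q = c ` I \<union> ((\<lambda>(a, b). F a) ` I \<union> (\<lambda>(a, b). F b) ` I) \<inter> Zip"
  have Q: "finite Q" "Q \<noteq> {}" using I(1,2) by (simp_all add: Q_def)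
  have QZ: "Q \<subseteq> Zip"
  proof -
    have "c i \<in> Zip" if "i \<in> I" for i using that c[of "fst i" "snd i"] I(3)[of "fst i" "snd i"] P_subset_Zip by auto
    then show ?thesis by (auto simp: Q_def)
  qed
  obtain T where T: "Q \<subseteq> T" "T \<subseteq> Zip" "compact T" "path_connected T" "topological_finite_tree T"
    using finite_subset_in_tree[OF Q QZ path_connected_Zip] by blast
  define \<Gamma> where "\<Gamma> = (\<Union>(a, b)\<in>I. bdry (D a b))"
  have "closed (bdry (D a b))" if "(a, b) \<in> I" for a b
    using I(3)[OF that] bdry_eq[of a b] closed_D by (simp add: valid_def closed_Int)
  then have cl: "closed \<Gamma>" unfolding \<Gamma>_def using I(1) by (intro closed_UN) auto
  have on_side: "\<exists>(a, b)\<in>I. z \<in> P a b" if z: "z \<in> \<Gamma>" "z \<in> Zip - T" for z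
  proof -
    obtain a b where ab: "(a, b) \<in> I" "z \<in> bdry (D a b)" using z(1) by (auto simp: \<Gamma>_def)
    have v: "valid a b" using I(3) ab by blast
    have "F a \<in> Zip \<longrightarrow> F a \<in> T" "F b \<in> Zip \<longrightarrow> F b \<in> T" using ab(1) T(1) by (force simp: Q_def)+
    then have "z \<noteq> F a" "z \<noteq> F b" using z(2) by auto
    moreover have "z \<notin> N a b" using Zip_disjoint v z(2) by blast
    ultimately have "z \<in> P a b" using bdry_sides[of a b] ab(2) v unfolding valid_def by blast
    then show ?thesis using ab(1) by blast
  qed
  have near_hit: "dist (p 0) (p s) < e / 4"
    if p: "path p" "path_image p \<subseteq> S2" and s: "s \<in> {0..1}" "\<And>t. 0 \<le> t \<Longrightarrow> t < s \<Longrightarrow> p t \<notin> \<Gamma>" for p s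
  proof (cases "s = 0")
    case True then show ?thesis using e by simp
  next
    case False
    then have s0: "0 < s" "s \<le> 1" using s(1) by auto
    have pim: "p t \<in> S2" if "t \<in> {0..1}" for t using p(2) imageI[OF that, of p] unfolding path_image_def by blast
    have "p 0 \<in> S2" by (rule pim) simp
    then obtain a b where ab: "(a, b) \<in> I" "p 0 \<in> D a b" using I(5) by blast
    have v: "a < b" "b < a + 2 * pi" using I(3)[OF ab(1)] by (auto simp: valid_def)
    have cont: "continuous_on {0..s} p" using p(1) s0 unfolding path_def by (auto intro: continuous_on_subset)
    have sub: "p ` {0..<s} \<subseteq> D a b"
    proof (rule connected_avoiding_bdry[OF v])
      show "connected (p ` {0..<s})"
        by (rule connected_continuous_image[OF continuous_on_subset[OF cont]]) auto
      show "p ` {0..<s} \<subseteq> S2" by (rule image_subsetI, rule pim) (use s0 in auto)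
      show "p ` {0..<s} \<inter> bdry (D a b) = {}" using s(2) ab(1) by (force simp: \<Gamma>_def)
      show "p ` {0..<s} \<inter> D a b \<noteq> {}" using ab(2) s0 by force
    qed
    have "p ` closure {0..<s} \<subseteq> D a b"
      by (rule image_closure_subset[OF _ closed_D sub]) (use cont s0 in \<open>simp add: closure_atLeastLessThan\<close>)
    then have "p s \<in> D a b" using s0 by (auto simp: closure_atLeastLessThan)
    then show ?thesis using I(4)[OF ab(1)] ab(2) by blast
  qed
  have "dist x y < e" if xy: "path_component (Zip - T) x y" for x y
  proof -
    obtain p where p: "path p" "path_image p \<subseteq> Zip - T" "pathstart p = x" "pathfinish p = y"
      using xy unfolding path_component_def by blast
    have pS: "path_image p \<subseteq> S2" using p(2) Zip_subset_S2 by blast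
    have x: "x = p 0" and y: "y = p 1" using p(3,4) by (auto simp: pathstart_def pathfinish_def)
    define S where "S = {0..1} \<inter> p -` \<Gamma>"
    show ?thesis
    proof (cases "S = {}")
      case True
      have "p t \<notin> \<Gamma>" if "t \<in> {0..1}" for t using True that unfolding S_def by blast
      then have "dist (p 0) (p 1) < e / 4"
        by (intro near_hit[OF p(1) pS]) auto
      then show ?thesis using e x y by simp
    next
      case False
      have "closed S" unfolding S_def
        using continuous_closed_preimage[OF _ closed_atLeastAtMost cl] p(1) by (simp add: path_def)
      then have "compact S" by (metis S_def compact_Icc compact_Int_closed inf.left_idem)
      obtain s where s: "s \<in> S" "\<And>t. t \<in> S \<Longrightarrow> s \<le> t" using compact_attains_inf[OF \<open>compact S\<close> False] by blast
      obtain s' where s': "s' \<in> S" "\<And>t. t \<in> S \<Longrightarrow> t \<le> s'" using compact_attains_sup[OF \<open>compact S\<close> False] by blast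
      have ss: "s \<in> {0..1}" "p s \<in> \<Gamma>" "s' \<in> {0..1}" "p s' \<in> \<Gamma>" using s s' by (auto simp: S_def)
      have d1: "dist x (p s) < e / 4" unfolding x
      proof (rule near_hit[OF p(1) pS ss(1)])
        show "p t \<notin> \<Gamma>" if t: "0 \<le> t" "t < s" for t
        proof
          assume "p t \<in> \<Gamma>"
          then have "t \<in> S" using t ss(1) by (auto simp: S_def)
          then show False using s(2)[of t] t by simp
        qed
      qed
      have "dist (reversepath p 0) (reversepath p (1 - s')) < e / 4"
      proof (rule near_hit)
        show "reversepath p t \<notin> \<Gamma>" if t: "0 \<le> t" "t < 1 - s'" for t
        proof
          assume "reversepath p t \<in> \<Gamma>"
          then have "1 - t \<in> S" using t ss(3) by (auto simp: S_def reversepath_def)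
          then show False using s'(2)[of "1 - t"] t by simp
        qed
      qed (use p(1) pS ss(3) in auto)
      then have d2: "dist y (p s') < e / 4" by (simp add: y reversepath_def)
      have ps: "p s \<in> path_image p" "p s' \<in> path_image p"
        unfolding path_image_def by (rule imageI[OF ss(1)], rule imageI[OF ss(3)])
      obtain a b where ab: "(a, b) \<in> I" "p s \<in> P a b" using on_side[OF ss(2)] ps(1) p(2) by blast
      obtain a' b' where ab': "(a', b') \<in> I" "p s' \<in> P a' b'" using on_side[OF ss(4)] ps(2) p(2) by blast
      note v = I(3)[OF ab(1)] I(3)[OF ab'(1)]
      have "path_component (path_image p) (p s) (p s')"
        using ps path_connected_path_image[OF p(1)] by (simp add: path_connected_component)
      then have pc: "path_component (Zip - T) (p s) (p s')" by (rule path_component_of_subset[OF p(2)])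
      have cT: "c (a, b) \<in> T" "c (a', b') \<in> T" using T(1) ab(1) ab'(1) by (auto simp: Q_def)
      then have "T \<inter> P a b \<noteq> {}" "T \<inter> P a' b' \<noteq> {}" using c[OF ab(1)] c[OF ab'(1)] by auto
      then obtain z where z: "z \<in> P a b" "z \<in> P a' b'"
        using sides_meet[OF v T(2,4) _ _ ab(2) ab'(2) pc] by blast
      have "dist (p s) z < e / 4"
        using I(4)[OF ab(1)] P_subset_bdry[OF v(1)] ab(2) z(1) by blast
      moreover have "dist z (p s') < e / 4"
        using I(4)[OF ab'(1)] P_subset_bdry[OF v(2)] ab'(2) z(2) by blast
      ultimately show ?thesis
        using d1 d2 dist_triangle[of x y "p s"] dist_triangle[of "p s" y z] dist_triangle[of z y "p s'"] dist_commute[of y "p s'"]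
        by linarith
    qed
  qed
  then show ?thesis using T by blast
qed

end

text \<open>
  On the compact sphere the identity is uniformly continuous from the Euclidean metric to any other
  metric for its topology.
\<close>

lemma short_hair_from_dist:
  assumes Z: "Z \<subseteq> S2"
    and small: "\<And>e. e > 0 \<Longrightarrow> \<exists>T. T \<subseteq> Z \<and> compact T \<and> topological_finite_tree T \<and>
      (\<forall>x y. path_component (Z - T) x y \<longrightarrow> dist x y < e)"
  shows "short_hair Z"
  unfolding short_hair_def
proof (intro allI impI)
  fix d :: "real^3 \<Rightarrow> real^3 \<Rightarrow> real" and \<epsilon> :: real
  assume d: "Metric_space S2 d \<and> Metric_space.mtopology S2 d = top_of_set S2" and e: "\<epsilon> > 0"
  interpret M: Metric_space S2 d using d by blast
  have top: "M.mtopology = top_of_set S2" using d by blast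
  have "\<exists>G. open G \<and> M.mball z (\<epsilon> / 4) = S2 \<inter> G" for z
    using M.openin_mball[of z "\<epsilon> / 4"] unfolding top openin_open by auto
  then obtain G where G: "\<And>z. open (G z)" "\<And>z. M.mball z (\<epsilon> / 4) = S2 \<inter> G z" by metis
  have cov: "S2 \<subseteq> \<Union> (G ` S2)"
  proof
    fix z assume z: "z \<in> S2"
    then have "z \<in> M.mball z (\<epsilon> / 4)" using e by simp
    then show "z \<in> \<Union> (G ` S2)" using G(2)[of z] z by blast
  qed
  have "\<exists>r>0. \<forall>x\<in>S2. \<exists>B\<in>G ` S2. ball x r \<subseteq> B"
  proof (rule Heine_Borel_lemma[OF compact_sphere cov])
    show "open B" if "B \<in> G ` S2" for B using G(1) that by blast
    fix r :: real assume "0 < r" "\<And>x. x \<in> S2 \<Longrightarrow> \<exists>B\<in>G ` S2. ball x r \<subseteq> B"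
    then show ?thesis by blast
  qed
  then obtain r where r: "0 < r" "\<And>x. x \<in> S2 \<Longrightarrow> \<exists>B\<in>G ` S2. ball x r \<subseteq> B" by blast
  have close: "d x y < \<epsilon> / 2" if xy: "x \<in> S2" "y \<in> S2" "dist x y < r" for x y
  proof -
    obtain z where z: "z \<in> S2" "ball x r \<subseteq> G z" using r(2)[OF xy(1)] by blast
    have "x \<in> G z" "y \<in> G z" using z(2) xy(3) r(1) by (auto simp: subset_iff)
    then have "x \<in> M.mball z (\<epsilon> / 4)" "y \<in> M.mball z (\<epsilon> / 4)"
      unfolding G(2) using xy(1,2) by blast+
    then have "d z x < \<epsilon> / 4" "d z y < \<epsilon> / 4" by simp_all
    then show ?thesis using M.triangle[OF xy(1) z(1) xy(2)] M.commute[of x z] by linarith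
  qed
  obtain T where T: "T \<subseteq> Z" "compact T" "topological_finite_tree T"
    "\<And>x y. path_component (Z - T) x y \<Longrightarrow> dist x y < r"
    using small[OF r(1)] by blast
  have "diam d C < \<epsilon>" if C: "C \<in> path_components_of (top_of_set (Z - T))" for C
  proof -
    obtain x0 where x0': "x0 \<in> Z - T" "C = path_component_of_set (top_of_set (Z - T)) x0"
      using C unfolding path_components_of_def by auto
    have x0: "x0 \<in> Z - T" "C = {y. path_component (Z - T) x0 y}"
      using x0' by (auto simp: set_eq_iff)
    have "x0 \<in> C" unfolding x0(2) using path_component_refl[OF x0(1)] by simp
    then have ne: "C \<times> C \<noteq> {}" by auto
    have "(case w of (x, y) \<Rightarrow> d x y) \<le> \<epsilon> / 2" if w: "w \<in> C \<times> C" for w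
    proof -
      obtain x y where xy: "w = (x, y)" "path_component (Z - T) x0 x" "path_component (Z - T) x0 y"
        using w x0(2) by auto
      then have pc: "path_component (Z - T) x y" using path_component_trans[OF path_component_sym] by blast
      then have "x \<in> S2" "y \<in> S2" using Z path_component_mem[OF pc] by blast+
      then show ?thesis using close[of x y] T(4)[OF pc] xy(1) by simp
    qed
    then have "diam d C \<le> \<epsilon> / 2" unfolding diam_def by (intro cSUP_least[OF ne])
    then show ?thesis using e by simp
  qed
  then show "\<exists>T\<subseteq>Z. compact T \<and> topological_finite_tree T \<and> (\<forall>C\<in>path_components_of (top_of_set (Z - T)). diam d C < \<epsilon>)"
    using T by blast
qed

theorem proposition1p4:
  fixes f :: "complex \<Rightarrow> real^3"
  assumes "catherine_wheel f"
  shows "short_hair (zipper_plus f) \<and> short_hair (zipper_minus f)"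
proof -
  interpret wheel f by unfold_locales (rule assms)
  interpret R: path_sides f right_side left_side by (rule path_sides_wheel)
  interpret L: path_sides f left_side right_side by (rule R.path_sides_flip)
  have "zipper_plus f = R.Zip"
    unfolding zipper_plus_def R.Zip_def right_side_def R.valid_def F_def by blast
  moreover have "zipper_minus f = L.Zip"
    unfolding zipper_minus_def L.Zip_def left_side_def R.valid_def F_def by blast
  ultimately show ?thesis
    using short_hair_from_dist[OF R.Zip_subset_S2 R.short_hair_dist]
      short_hair_from_dist[OF L.Zip_subset_S2 L.short_hair_dist] by simp
qed

end
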